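(* Let $\mathcal{R}$ be a projective rectangle of order $(m,n)$ (with $m,n$ finite) and let $G$ be its graph of lines. Then: (a) $G$ has $n^2$ vertices. (b) $G$ is $(m+1)(n-1)$-regular. (c) $G$ is strongly regular with parameters $\lambda = m(m-1)+n-2 = n+(m+1)(m-2)$ and $\mu = m(m+1)$. (d) The eigenvalues of $G$ are $\tau_0=(m+1)(n-1)$ with multiplicity $1$, $\tau_1=n-m-1$ with multiplicity $(m+1)(n-1)$, and $\tau_2=-(m+1)$ with multiplicity $(n-m)(n-1)$. (e) If $\mathcal{R}$ is nontrivial, the diameter of $G$ is $2$; if $\mathcal{R}$ is trivial, $G$ is a complete graph. (f) Suppose $\mathcal{R}$ is nontrivial. The maximal cliques of $G$ are exactly the plane cliques, of size $m^2$, and the point cliques, of size $n$, and all of these are distinct sets. There are $n^2(n-1)/(m^2(m-1))$ plane cliques and $(m+1)n$ point cliques. The maximum clique size is $n$. Every vertex of $G$ lies in exactly $(n-1)/(m-1)$ plane cliques and exactly $m+1$ point cliques. Any two adjacent vertices lie together in exactly one plane clique and exactly one point clique. Two distinct plane cliques intersect in at most one vertex, and two distinct point cliques intersect in at most one vertex. A plane clique and a point clique are either disjoint or intersect in exactly $m$ vertices. (g) The (vertex) connectivity of $G$ is $(m+1)(n-1)$.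
   Context: An incidence structure consists of a set of points, a set of lines, and an incidence relation between them. A projective rectangle is an incidence structure satisfying: (A1) every two distinct points are incident with exactly one line; (A2) there exist four points no three of which are collinear; (A3) every line is incident with at least three distinct points; (A4) there is a distinguished point $D$, the special point; lines incident with $D$ are called special, lines not incident with $D$ are called ordinary, and points other than $D$ are called ordinary; (A5) each special line intersects every other line in exactly one point; (A6) if two ordinary lines $l_1,l_2$ intersect in a point, then every two lines that intersect both $l_1$ and $l_2$ in four distinct points intersect in a point. If $\mathcal{R}$ has $m+1$ special lines, each incident with $n+1$ points, its order is $(m,n)$; here $m,n$ are finite. $\mathcal{R}$ is trivial if it is a projective plane. The graph of lines of $\mathcal{R}$ has as vertices the ordinary lines of $\mathcal{R}$, two being adjacent iff they have a common point. A subplane of $\mathcal{R}$ is an incidence substructure (a subset of the points together with restrictions of lines to that subset) that is a projective plane; a plane is a maximal subplane. The plane clique of a plane $\pi$ is the set of ordinary lines of $\mathcal{R}$ that are lines of $\pi$. The point clique of an ordinary point $p$ is the set of all ordinary lines incident with $p$. *)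

theory Defs
  imports
    "Graph_Theory.Graph_Theory"
    "Jordan_Normal_Form.Char_Poly"
begin

section \<open>Incidence structures and projective rectangles\<close>

record ('p, 'l) incidence =
  points :: "'p set"
  lines :: "'l set"
  inc :: "('p \<times> 'l) set"

definition wf_incidence :: "('p, 'l) incidence \<Rightarrow> bool" where
  "wf_incidence R \<longleftrightarrow> inc R \<subseteq> points R \<times> lines R"

definition line_points :: "('p, 'l) incidence \<Rightarrow> 'l \<Rightarrow> 'p set" where
  "line_points R l = {p \<in> points R. (p, l) \<in> inc R}"

definition lines_meet :: "('p, 'l) incidence \<Rightarrow> 'l \<Rightarrow> 'l \<Rightarrow> bool" where
  "lines_meet R l l' \<longleftrightarrow> (\<exists>p \<in> points R. (p, l) \<in> inc R \<and> (p, l') \<in> inc R)"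

definition collinear3 :: "('p, 'l) incidence \<Rightarrow> 'p \<Rightarrow> 'p \<Rightarrow> 'p \<Rightarrow> bool" where
  "collinear3 R a b c \<longleftrightarrow>
     (\<exists>l \<in> lines R. (a, l) \<in> inc R \<and> (b, l) \<in> inc R \<and> (c, l) \<in> inc R)"

definition has_quadrangle :: "('p, 'l) incidence \<Rightarrow> bool" where
  "has_quadrangle R \<longleftrightarrow>
     (\<exists>a \<in> points R. \<exists>b \<in> points R. \<exists>c \<in> points R. \<exists>d \<in> points R. distinct [a, b, c, d] \<and>
        \<not> collinear3 R a b c \<and> \<not> collinear3 R a b d \<and>
        \<not> collinear3 R a c d \<and> \<not> collinear3 R b c d)"

definition projective_plane :: "('p, 'l) incidence \<Rightarrow> bool" where
  "projective_plane R \<longleftrightarrow>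
     wf_incidence R \<and>
     (\<forall>p \<in> points R. \<forall>q \<in> points R. p \<noteq> q \<longrightarrow>
        (\<exists>!l. l \<in> lines R \<and> (p, l) \<in> inc R \<and> (q, l) \<in> inc R)) \<and>
     (\<forall>l \<in> lines R. \<forall>k \<in> lines R. l \<noteq> k \<longrightarrow>
        (\<exists>!p. p \<in> points R \<and> (p, l) \<in> inc R \<and> (p, k) \<in> inc R)) \<and>
     has_quadrangle R"

definition special_lines :: "('p, 'l) incidence \<Rightarrow> 'p \<Rightarrow> 'l set" where
  "special_lines R D = {l \<in> lines R. (D, l) \<in> inc R}"

definition ordinary_lines :: "('p, 'l) incidence \<Rightarrow> 'p \<Rightarrow> 'l set" where
  "ordinary_lines R D = {l \<in> lines R. (D, l) \<notin> inc R}"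

definition ordinary_points :: "('p, 'l) incidence \<Rightarrow> 'p \<Rightarrow> 'p set" where
  "ordinary_points R D = points R - {D}"

locale projective_rectangle =
  fixes R :: "('p, 'l) incidence" and D :: 'p
  assumes wf: "wf_incidence R"
    and A1: "\<lbrakk>p \<in> points R; q \<in> points R; p \<noteq> q\<rbrakk>
      \<Longrightarrow> \<exists>!l. l \<in> lines R \<and> (p, l) \<in> inc R \<and> (q, l) \<in> inc R"
    and A2: "has_quadrangle R"
    and A3: "l \<in> lines R \<Longrightarrow>
      \<exists>a \<in> line_points R l. \<exists>b \<in> line_points R l. \<exists>c \<in> line_points R l. distinct [a, b, c]"
    and A4: "D \<in> points R"
    and A5: "\<lbrakk>s \<in> special_lines R D; l \<in> lines R; l \<noteq> s\<rbrakk>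
      \<Longrightarrow> \<exists>!p. p \<in> points R \<and> (p, s) \<in> inc R \<and> (p, l) \<in> inc R"
    and A6: "\<lbrakk>l1 \<in> ordinary_lines R D; l2 \<in> ordinary_lines R D; l1 \<noteq> l2; lines_meet R l1 l2;
        g1 \<in> lines R; g2 \<in> lines R; g1 \<noteq> g2;
        a \<in> line_points R g1 \<inter> line_points R l1; b \<in> line_points R g1 \<inter> line_points R l2;
        c \<in> line_points R g2 \<inter> line_points R l1; d \<in> line_points R g2 \<inter> line_points R l2;
        distinct [a, b, c, d]\<rbrakk>
      \<Longrightarrow> lines_meet R g1 g2"

text \<open>The cardinalities below are positive, so both sets are forced to be finite.\<close>

definition has_order :: "('p, 'l) incidence \<Rightarrow> 'p \<Rightarrow> nat \<Rightarrow> nat \<Rightarrow> bool" where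
  "has_order R D m n \<longleftrightarrow>
     card (special_lines R D) = m + 1 \<and>
     (\<forall>s \<in> special_lines R D. card (line_points R s) = n + 1)"

definition trivial_rectangle :: "('p, 'l) incidence \<Rightarrow> bool" where
  "trivial_rectangle R \<longleftrightarrow> projective_plane R"

text \<open>
  The restriction of a line \<open>l\<close> of \<open>R\<close> to the points of \<open>S\<close> is represented by \<open>l\<close> itself
  together with the restricted incidence relation.  In a projective plane every line has at least
  three points, and two points of \<open>R\<close> lie on a unique line, so for subplanes different lines have
  different restrictions.
\<close>

definition substructure :: "('p, 'l) incidence \<Rightarrow> ('p, 'l) incidence \<Rightarrow> bool" where
  "substructure S R \<longleftrightarrow>
     points S \<subseteq> points R \<and> lines S \<subseteq> lines R \<and> inc S = inc R \<inter> (points S \<times> lines S)"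

definition subplane :: "('p, 'l) incidence \<Rightarrow> ('p, 'l) incidence \<Rightarrow> bool" where
  "subplane S R \<longleftrightarrow> substructure S R \<and> projective_plane S"

definition planes :: "('p, 'l) incidence \<Rightarrow> ('p, 'l) incidence set" where
  "planes R = {S. subplane S R \<and> (\<forall>T. subplane T R \<and> substructure S T \<longrightarrow> T = S)}"

definition plane_clique :: "('p, 'l) incidence \<Rightarrow> 'p \<Rightarrow> ('p, 'l) incidence \<Rightarrow> 'l set" where
  "plane_clique R D S = ordinary_lines R D \<inter> lines S"

definition point_clique :: "('p, 'l) incidence \<Rightarrow> 'p \<Rightarrow> 'p \<Rightarrow> 'l set" where
  "point_clique R D p = {l \<in> ordinary_lines R D. (p, l) \<in> inc R}"

definition plane_cliques :: "('p, 'l) incidence \<Rightarrow> 'p \<Rightarrow> 'l set set" where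
  "plane_cliques R D = plane_clique R D ` planes R"

definition point_cliques :: "('p, 'l) incidence \<Rightarrow> 'p \<Rightarrow> 'l set set" where
  "point_cliques R D = point_clique R D ` ordinary_points R D"

section \<open>Graphs\<close>

text \<open>
  Simple graphs are loop-free symmetric digraphs without parallel arcs
  (locale \<^locale>\<open>graph\<close>); in these the degree of a vertex is its out-degree.
\<close>

definition graph_of_lines :: "('p, 'l) incidence \<Rightarrow> 'p \<Rightarrow> ('l, 'l \<times> 'l) pre_digraph" where
  "graph_of_lines R D = with_proj
     \<lparr> pverts = ordinary_lines R D,
       parcs = {(l, l'). l \<in> ordinary_lines R D \<and> l' \<in> ordinary_lines R D \<and> l \<noteq> l' \<and> lines_meet R l l'} \<rparr>"

definition regular_graph :: "('v, 'e) pre_digraph \<Rightarrow> nat \<Rightarrow> bool" where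
  "regular_graph G k \<longleftrightarrow> graph G \<and> (\<forall>v \<in> verts G. out_degree G v = k)"

definition common_neighbours :: "('v, 'e) pre_digraph \<Rightarrow> 'v \<Rightarrow> 'v \<Rightarrow> 'v set" where
  "common_neighbours G u v = {w \<in> verts G. dominates G u w \<and> dominates G v w}"

text \<open>Complete graphs are not excluded; for them the condition on \<open>c\<close> is void.\<close>

definition strongly_regular ::
    "('v, 'e) pre_digraph \<Rightarrow> nat \<Rightarrow> nat \<Rightarrow> nat \<Rightarrow> nat \<Rightarrow> bool" where
  "strongly_regular G N k a c \<longleftrightarrow>
     regular_graph G k \<and> card (verts G) = N \<and>
     (\<forall>u \<in> verts G. \<forall>v \<in> verts G. u \<noteq> v \<longrightarrow>
        card (common_neighbours G u v) = (if dominates G u v then a else c))"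

definition adjacency_matrix :: "('v, 'e) pre_digraph \<Rightarrow> 'v list \<Rightarrow> real mat" where
  "adjacency_matrix G vs =
     mat (length vs) (length vs) (\<lambda>(i, j). if dominates G (vs ! i) (vs ! j) then 1 else 0)"

definition eigenvalue_mult :: "real mat \<Rightarrow> real \<Rightarrow> nat" where
  "eigenvalue_mult A x = Polynomial.order x (char_poly A)"

definition graph_diameter :: "('v, 'e) pre_digraph \<Rightarrow> ereal" where
  "graph_diameter G = (SUP u \<in> verts G. SUP v \<in> verts G. wf_digraph.\<mu> G (\<lambda>_. 1) u v)"

definition graph_clique :: "('v, 'e) pre_digraph \<Rightarrow> 'v set \<Rightarrow> bool" where
  "graph_clique G C \<longleftrightarrow> C \<subseteq> verts G \<and> (\<forall>u \<in> C. \<forall>v \<in> C. u \<noteq> v \<longrightarrow> dominates G u v)"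

definition maximal_cliques :: "('v, 'e) pre_digraph \<Rightarrow> 'v set set" where
  "maximal_cliques G = {C. graph_clique G C \<and> (\<forall>C'. graph_clique G C' \<and> C \<subseteq> C' \<longrightarrow> C' = C)}"

text \<open>
  The least number of vertices whose removal leaves a disconnected graph or a single vertex; in
  particular the complete graph on \<open>N\<close> vertices has connectivity \<open>N - 1\<close>.
\<close>

definition vertex_connectivity :: "('v, 'e) pre_digraph \<Rightarrow> nat" where
  "vertex_connectivity G =
     (LEAST k. \<exists>S. S \<subseteq> verts G \<and> finite S \<and> card S = k \<and>
        (\<not> Digraph_Component.connected (G \<restriction> (verts G - S)) \<or> card (verts G - S) = 1))"

end

theory Submission
  imports Defs "Jordan_Normal_Form.Schur_Decomposition"
begin

text \<open>
  Each special line meets an ordinary line in exactly one point, so an ordinary line has \<open>m + 1\<close>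
  points, an ordinary point is on \<open>n\<close> ordinary lines, and of these exactly \<open>m\<close> meet a given ordinary
  line not through the point.  The parameters of the graph follow by sorting common neighbours
  according to their point on one of the two lines.  The multiplicities of the eigenvalues are then
  determined by their number, their sum (the trace of the adjacency matrix is \<open>0\<close>) and the sum of
  their squares (the trace of its square).

  Two ordinary lines meeting in \<open>P\<close> span a plane: its points are \<open>P\<close>, \<open>D\<close> and the points of the
  ordinary transversals, i.e. of the ordinary lines meeting both lines outside \<open>P\<close>.  Axiom (A6) makes
  any two transversals meet, and as ordinary lines all have \<open>m + 1\<close> points, injections between such
  sets of points are bijections; this is what closes the structure under joins and intersections.
  A subplane containing the two lines lies inside the spanned plane, so the spanned planes are exactly
  the maximal subplanes.

  For the connectivity, let a set \<open>S\<close> separate two nonadjacent vertices \<open>u\<close> and \<open>v\<close>.  It contains their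
  common neighbours.  Sending a unit of flow along every edge from a private neighbour of \<open>u\<close> to a
  private neighbour of \<open>v\<close> or to a vertex adjacent to neither, and on from there, gives a flow with the
  same outflow \<open>k - 1 - \<lambda>\<close> at every private neighbour; every other vertex carries at most that
  amount.  Hence \<open>S\<close> blocks as many vertices outside the common neighbourhood as there are private
  neighbours of \<open>u\<close>.
\<close>

section \<open>Spectrum of a strongly regular graph\<close>

text \<open>Injections between point sets are available on ordinary lines only: a special line has
  \<open>n + 1\<close> points, of which a plane contains just \<open>m + 1\<close>. So planes are
  full along ordinary lines, and special lines enter through (A5). (A6) yields common points only
  for lines that cross both lines of a base pair. Lines through \<open>P\<close> are outside its
  reach; that they meet a transversal has to be extracted from a count of the points of that
  transversal. For the connectivity the constants must fit: \<open>k - 1 - \<lambda>\<close> equals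
  \<open>m * (n - m)\<close>, and a vertex adjacent to neither \<open>u\<close> nor \<open>v\<close>
  has at most that many neighbours private to \<open>u\<close>, because each of its
  \<open>m + 1\<close> points provides at most \<open>min m (n - m - 1)\<close> of them. This
  estimate, with \<open>m < n\<close>, is the only geometric input; the rest concerns strongly
  regular graphs. The case \<open>m = n\<close> is not excluded in the spectrum; the multiplicity of
  \<open>\<tau>2\<close> is then 0. Nontriviality yields two ordinary lines without a common point,
  hence \<open>m < n\<close>, which is the form the classification of cliques uses.\<close>

definition srg_relation :: "'v set \<Rightarrow> ('v \<Rightarrow> 'v \<Rightarrow> bool) \<Rightarrow> nat \<Rightarrow> nat \<Rightarrow> nat \<Rightarrow> bool" where
  "srg_relation V E k a c \<longleftrightarrow> finite V \<and> (\<forall>u\<in>V. \<not> E u u) \<and> (\<forall>u\<in>V. \<forall>v\<in>V. E u v \<longrightarrow> E v u) \<and>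
     (\<forall>u\<in>V. card {w\<in>V. E u w} = k) \<and>
     (\<forall>u\<in>V. \<forall>v\<in>V. u \<noteq> v \<longrightarrow> card {w\<in>V. E u w \<and> E v w} = (if E u v then a else c))"

text \<open>Entrywise form of \<open>A^2 = (k - c) I + (a - c) A + c J\<close> with \<open>J\<close>
  the all-ones matrix: two-step walks from \<open>u\<close> to \<open>z\<close> are common
  neighbours, and on the diagonal they are neighbours.\<close>

lemma srg_walks2:
  fixes V :: "'v set"
  assumes srg: "srg_relation V E k a c" and u: "u \<in> V" and z: "z \<in> V"
  shows "(\<Sum>w\<in>V. of_bool (E u w) * of_bool (E w z)) =
    (of_nat k - of_nat c) * of_bool (u = z) + (of_nat a - of_nat c) * of_bool (E u z) + (of_nat c :: 'a :: comm_ring_1)"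
proof -
  have fin: "finite V" using srg by (simp add: srg_relation_def)
  have "(\<Sum>w\<in>V. of_bool (E u w) * of_bool (E w z)) = (\<Sum>w\<in>V. of_bool (E u w \<and> E z w) :: 'a)"
    using srg z unfolding srg_relation_def by (intro sum.cong) (auto simp: of_bool_def)
  also have "\<dots> = of_nat (card {w\<in>V. E u w \<and> E z w})"
    using fin by (simp add: of_bool_def sum.If_cases Int_def)
  also have "\<dots> = (of_nat k - of_nat c) * of_bool (u = z) + (of_nat a - of_nat c) * of_bool (E u z) + of_nat c"
    using srg u z unfolding srg_relation_def by (cases "u = z") auto
  finally show ?thesis .
qed

lemma srg_degree_sum:
  assumes srg: "srg_relation V E k a c" and u: "u \<in> V"
  shows "(\<Sum>w\<in>V. of_bool (E u w)) = (of_nat k :: 'a :: comm_ring_1)"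
  using assms unfolding srg_relation_def by (simp add: of_bool_def sum.If_cases Int_def)

text \<open>Summing the eigenvector equation over all vertices gives \<open>e * s = k * s\<close>
  for the sum \<open>s\<close> of the values. If \<open>e\<close> differs from \<open>k\<close>,
  then \<open>s = 0\<close>, so the all-ones term disappears from the square of the adjacency matrix
  and the quadratic equation remains.\<close>

lemma srg_eigenfunction:
  fixes x :: "'v \<Rightarrow> 'a :: field"
  assumes srg: "srg_relation V E k a c"
    and ev: "\<And>u. u \<in> V \<Longrightarrow> (\<Sum>w\<in>V. of_bool (E u w) * x w) = e * x u"
    and nz: "u0 \<in> V" "x u0 \<noteq> 0"
  shows "e = of_nat k \<or> e * e = (of_nat a - of_nat c) * e + (of_nat k - of_nat c)"
proof (rule disjCI)
  assume ne: "\<not> e * e = (of_nat a - of_nat c) * e + (of_nat k - of_nat c)"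
  have fin: "finite V" using srg by (simp add: srg_relation_def)
  have sym: "E u w \<longleftrightarrow> E w u" if "u \<in> V" "w \<in> V" for u w
    using srg that unfolding srg_relation_def by blast
  define s where "s = sum x V"
  have "e * s = (\<Sum>u\<in>V. \<Sum>w\<in>V. of_bool (E u w) * x w)"
    using ev by (simp add: s_def sum_distrib_left)
  also have "\<dots> = (\<Sum>w\<in>V. \<Sum>u\<in>V. of_bool (E u w) * x w)" by (rule sum.swap)
  also have "\<dots> = (\<Sum>w\<in>V. (\<Sum>u\<in>V. of_bool (E w u)) * x w)"
    unfolding sum_distrib_right using sym by (intro sum.cong refl) auto
  also have "\<dots> = of_nat k * s"
    using srg_degree_sum[OF srg, where ?'a = 'a] by (simp add: s_def sum_distrib_left del: sum_of_bool_eq)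
  finally have es: "e * s = of_nat k * s" .
  have "e * (e * x u0) = (\<Sum>w\<in>V. of_bool (E u0 w) * (e * x w))"
    unfolding ev[OF nz(1), symmetric] sum_distrib_left by (intro sum.cong) (auto simp: algebra_simps)
  also have "\<dots> = (\<Sum>w\<in>V. \<Sum>z\<in>V. of_bool (E u0 w) * (of_bool (E w z) * x z))"
    using ev by (intro sum.cong) (auto simp flip: sum_distrib_left)
  also have "\<dots> = (\<Sum>z\<in>V. \<Sum>w\<in>V. of_bool (E u0 w) * (of_bool (E w z) * x z))" by (rule sum.swap)
  also have "\<dots> = (\<Sum>z\<in>V. (\<Sum>w\<in>V. of_bool (E u0 w) * of_bool (E w z)) * x z)"
    unfolding sum_distrib_right by (simp only: mult.assoc)
  also have "\<dots> = (\<Sum>z\<in>V. (of_nat k - of_nat c) * (of_bool (u0 = z) * x z) +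
      (of_nat a - of_nat c) * (of_bool (E u0 z) * x z) + of_nat c * x z)"
  proof (rule sum.cong)
    fix z assume "z \<in> V"
    then show "(\<Sum>w\<in>V. of_bool (E u0 w) * of_bool (E w z)) * x z =
      (of_nat k - of_nat c) * (of_bool (u0 = z) * x z) +
      (of_nat a - of_nat c) * (of_bool (E u0 z) * x z) + of_nat c * x z"
      unfolding srg_walks2[OF srg nz(1) \<open>z \<in> V\<close>] by (simp only: distrib_right mult.assoc)
  qed simp
  also have "\<dots> = (of_nat k - of_nat c) * (\<Sum>z\<in>V. of_bool (u0 = z) * x z) +
      (of_nat a - of_nat c) * (\<Sum>z\<in>V. of_bool (E u0 z) * x z) + of_nat c * s"
    by (simp add: sum.distrib sum_distrib_left s_def)
  also have "(\<Sum>z\<in>V. of_bool (u0 = z) * x z) = x u0"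
    using fin nz by (simp add: of_bool_def if_distrib[of "\<lambda>t. t * _"] cong: if_cong)
  finally have main: "e * (e * x u0) = (of_nat k - of_nat c) * x u0 + (of_nat a - of_nat c) * (e * x u0)
    + of_nat c * s" using ev[OF nz(1)] by simp
  show "e = of_nat k"
  proof (rule ccontr)
    assume "e \<noteq> of_nat k"
    then have "s = 0" using es by simp
    then have "(e * e) * x u0 = ((of_nat a - of_nat c) * e + (of_nat k - of_nat c)) * x u0"
      using main by (simp add: algebra_simps)
    then show False using ne nz by simp
  qed
qed

text \<open>Over an arbitrary field because it serves both the real adjacency matrix and its
  complexification, where the characteristic polynomial factors.\<close>

lemma srg_matrix_eigenvalue:
  fixes M :: "'a :: field mat"
  assumes srg: "srg_relation {0..<N} E k a c"
    and M: "M \<in> carrier_mat N N" "\<And>i j. i < N \<Longrightarrow> j < N \<Longrightarrow> M $$ (i, j) = of_bool (E i j)"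
    and e: "eigenvalue M e"
  shows "e = of_nat k \<or> e * e = (of_nat a - of_nat c) * e + (of_nat k - of_nat c)"
proof -
  obtain v where v: "v \<in> carrier_vec N" "v \<noteq> 0\<^sub>v N" "M *\<^sub>v v = e \<cdot>\<^sub>v v"
    using e M unfolding eigenvalue_def eigenvector_def by auto
  have "\<exists>i<N. v $ i \<noteq> 0"
  proof (rule ccontr)
    assume "\<not> ?thesis"
    then have "v = 0\<^sub>v N" using v(1) by (intro eq_vecI) auto
    then show False using v by simp
  qed
  then obtain i0 where i0: "i0 < N" "v $ i0 \<noteq> 0" by blast
  show ?thesis
  proof (rule srg_eigenfunction[OF srg, where x = "\<lambda>i. v $ i" and ?u0.0 = i0])
    fix i assume i: "i \<in> {0..<N}"
    have "(\<Sum>j\<in>{0..<N}. of_bool (E i j) * v $ j) = (\<Sum>j\<in>{0..<N}. M $$ (i, j) * v $ j)"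
      using i M by (intro sum.cong) auto
    also have "\<dots> = (M *\<^sub>v v) $ i" using i M(1) v(1) by (simp add: scalar_prod_def)
    also have "\<dots> = e * v $ i" using i v(1) unfolding v(3) by simp
    finally show "(\<Sum>j\<in>{0..<N}. of_bool (E i j) * v $ j) = e * v $ i" .
  qed (use i0 in auto)
qed

section \<open>Traces and multiplicities of eigenvalues\<close>

lemma order_prod_list_linear:
  "Polynomial.order x (\<Prod>e\<leftarrow>es. [:- e, 1:]) = count_list es (x :: 'a :: field)"
proof (induction es)
  case (Cons e es)
  have nz: "(\<Prod>e\<leftarrow>es. [:- e, 1:]) \<noteq> (0 :: 'a poly)"
    by (auto simp: prod_list_zero_iff)
  have "Polynomial.order x [:- e, 1:] = (if e = x then 1 else 0)"
    using order_power_n_n[of x 1] by (auto intro: order_0I)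
  moreover have "[:- e, 1:] * (\<Prod>e\<leftarrow>es. [:- e, 1:]) \<noteq> 0"
    using nz by (simp only: mult_eq_0_iff) simp
  ultimately show ?case using Cons by (simp del: mult_pCons_left add: order_mult)
qed simp

lemma sum_diag_mult_commute:
  assumes "A \<in> carrier_mat N N" "B \<in> carrier_mat N N"
  shows "(\<Sum>i = 0..<N. (A * B) $$ (i, i)) = (\<Sum>i = 0..<N. (B * A) $$ (i, i) :: 'a :: comm_ring_1)"
proof -
  have "(\<Sum>i = 0..<N. (A * B) $$ (i, i)) = (\<Sum>i = 0..<N. \<Sum>j = 0..<N. A $$ (i, j) * B $$ (j, i))"
    using assms by (intro sum.cong) (auto simp: scalar_prod_def)
  also have "\<dots> = (\<Sum>j = 0..<N. \<Sum>i = 0..<N. A $$ (i, j) * B $$ (j, i))" by (rule sum.swap)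
  also have "\<dots> = (\<Sum>i = 0..<N. (B * A) $$ (i, i))"
    using assms by (intro sum.cong) (auto simp: scalar_prod_def mult.commute)
  finally show ?thesis .
qed

text \<open>A Schur decomposition makes \<open>A\<close> similar to a triangular matrix
  \<open>B\<close> with diagonal \<open>es\<close>; then \<open>A * A\<close> is similar to
  \<open>B * B\<close>, and the trace is invariant under similarity.\<close>

lemma eigenvalue_power_sums:
  fixes A :: "real mat"
  assumes A: "A \<in> carrier_mat N N" and cp: "char_poly A = (\<Prod>e\<leftarrow>es. [:- e, 1:])"
  shows "length es = N" "sum_list es = (\<Sum>i = 0..<N. A $$ (i, i))"
    "(\<Sum>e\<leftarrow>es. e * e) = (\<Sum>i = 0..<N. (A * A) $$ (i, i))"
proof -
  obtain B P Q where sch: "schur_decomposition A es = (B, P, Q)" by (cases "schur_decomposition A es")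
  have wit: "similar_mat_wit A B P Q" and ut: "upper_triangular B" and dg: "diag_mat B = es"
    using schur_decomposition[OF A cp sch] by auto
  note w = similar_mat_witD2[OF A wit]
  have es: "es = map (\<lambda>i. B $$ (i, i)) [0..<N]" using dg w by (simp add: diag_mat_def)
  then show "length es = N" by simp
  have tr: "(\<Sum>i = 0..<N. (P * X * Q) $$ (i, i)) = (\<Sum>i = 0..<N. X $$ (i, i))"
    if X: "X \<in> carrier_mat N N" for X
  proof -
    have "(\<Sum>i = 0..<N. (P * X * Q) $$ (i, i)) = (\<Sum>i = 0..<N. (Q * (P * X)) $$ (i, i))"
      by (rule sum_diag_mult_commute) (use X w in auto)
    also have "Q * (P * X) = (Q * P) * X" using assoc_mult_mat[of Q N N P N X N] w X by simp
    also have "\<dots> = X" using w X by simp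
    finally show ?thesis .
  qed
  show "sum_list es = (\<Sum>i = 0..<N. A $$ (i, i))"
    using tr[OF w(5)] w(3) by (simp add: es sum_list_distinct_conv_sum_set)
  have "A * A = P * B * Q * (P * B * Q)" using w(3) by simp
  also have "\<dots> = P * B * (Q * (P * B * Q))" by (rule assoc_mult_mat) (use w in auto)
  also have "Q * (P * B * Q) = Q * (P * B) * Q" by (rule assoc_mult_mat[symmetric]) (use w in auto)
  also have "Q * (P * B) = Q * P * B" by (rule assoc_mult_mat[symmetric]) (use w in auto)
  also have "Q * P * B = B" using w by simp
  also have "P * B * (B * Q) = P * B * B * Q" by (rule assoc_mult_mat[symmetric]) (use w in auto)
  also have "P * B * B = P * (B * B)" by (rule assoc_mult_mat) (use w in auto)
  finally have AA: "A * A = P * (B * B) * Q" .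
  have "(\<Sum>i = 0..<N. (A * A) $$ (i, i)) = (\<Sum>i = 0..<N. (B * B) $$ (i, i))"
    unfolding AA using tr[of "B * B"] w(5) by simp
  also have "\<dots> = (\<Sum>i = 0..<N. B $$ (i, i) * B $$ (i, i))"
  proof (rule sum.cong)
    fix i assume i: "i \<in> {0..<N}"
    \<comment> \<open>One of the two entries lies below the diagonal, so only the square of the
      diagonal entry contributes to the entry of \<open>B * B\<close>.\<close>
    have "B $$ (i, j) * B $$ (j, i) = 0" if "j < N" "j \<noteq> i" for j
      using upper_triangularD[OF ut, of j i] upper_triangularD[OF ut, of i j] that i w(5)
      by (cases "j < i") auto
    then have "(\<Sum>j = 0..<N. B $$ (i, j) * B $$ (j, i)) = (\<Sum>j\<in>{i}. B $$ (i, j) * B $$ (j, i))"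
      using i by (intro sum.mono_neutral_right) auto
    then show "(B * B) $$ (i, i) = B $$ (i, i) * B $$ (i, i)"
      using i w(5) by (simp add: scalar_prod_def)
  qed simp
  finally show "(\<Sum>e\<leftarrow>es. e * e) = (\<Sum>i = 0..<N. (A * A) $$ (i, i))"
    by (simp add: es sum_list_distinct_conv_sum_set o_def)
qed

text \<open>The Schur decomposition over the reals needs a characteristic polynomial in linear
  factors. Over the complex numbers they exist; as all roots are real, they come from real factors,
  and comparing coefficients brings the factorization back.\<close>

lemma char_poly_real_split:
  fixes A :: "real mat"
  assumes A: "A \<in> carrier_mat N N"
    and real: "\<And>e :: complex. eigenvalue (map_mat of_real A) e \<Longrightarrow> e \<in> \<real>"
  shows "\<exists>es. char_poly A = (\<Prod>e\<leftarrow>es. [:- e, 1:])"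
proof -
  interpret h: map_poly_comm_ring_hom complex_of_real ..
  let ?A = "map_mat complex_of_real A"
  have Ac: "?A \<in> carrier_mat N N" using A by simp
  obtain as where as: "char_poly ?A = (\<Prod>a\<leftarrow>as. [:- a, 1:])" using char_poly_factorized[OF Ac] by blast
  have "a \<in> \<real>" if "a \<in> set as" for a
  proof (rule real)
    have "poly (char_poly ?A) a = 0"
      unfolding as using that by (induction as) auto
    then show "eigenvalue ?A a" using eigenvalue_root_char_poly[OF Ac] by blast
  qed
  then have "map complex_of_real (map Re as) = as"
    by (intro nth_equalityI) (auto simp: complex_is_Real_iff complex_eq_iff)
  then obtain es where es: "as = map complex_of_real es" by metis
  have "map_poly complex_of_real (char_poly A) = char_poly ?A"
    by (rule of_real_hom.char_poly_hom[OF A, symmetric])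
  also have "\<dots> = map_poly complex_of_real (\<Prod>e\<leftarrow>es. [:- e, 1:])"
    unfolding as es by (induction es) (simp_all add: h.hom_mult del: mult_pCons_left)
  finally have "char_poly A = (\<Prod>e\<leftarrow>es. [:- e, 1:])"
    by (auto simp: poly_eq_iff coeff_map_poly)
  then show ?thesis by blast
qed

lemma sum_list_three_values:
  fixes g :: "real \<Rightarrow> real"
  assumes "set es \<subseteq> {x, y, z}" "x \<noteq> y" "x \<noteq> z" "y \<noteq> z"
  shows "(\<Sum>e\<leftarrow>es. g e) = real (count_list es x) * g x + real (count_list es y) * g y
    + real (count_list es z) * g z"
  using assms(1)
proof (induction es)
  case (Cons e es)
  then have "e = x \<or> e = y \<or> e = z" "set es \<subseteq> {x, y, z}" by auto
  then show ?case using Cons.IH assms(2-) by (auto simp: algebra_simps)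
qed simp

lemma srg_spectrum:
  fixes M :: "real mat" and \<tau>1 \<tau>2 :: real
  assumes srg: "srg_relation {0..<N} E k a c"
    and M: "M \<in> carrier_mat N N" "\<And>i j. i < N \<Longrightarrow> j < N \<Longrightarrow> M $$ (i, j) = of_bool (E i j)"
    and \<tau>: "\<tau>1 + \<tau>2 = real a - real c" "\<tau>1 * \<tau>2 = real c - real k"
    and ne: "real k \<noteq> \<tau>1" "real k \<noteq> \<tau>2" "\<tau>1 \<noteq> \<tau>2"
  shows "{x. eigenvalue M x} \<subseteq> {real k, \<tau>1, \<tau>2}"
    "real (eigenvalue_mult M (real k)) * (real k - \<tau>1) * (real k - \<tau>2) = real N * (real k + \<tau>1 * \<tau>2)"
    "real (eigenvalue_mult M \<tau>1) * (\<tau>1 - real k) * (\<tau>1 - \<tau>2) = real N * (real k + real k * \<tau>2)"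
    "real (eigenvalue_mult M \<tau>2) * (\<tau>2 - real k) * (\<tau>2 - \<tau>1) = real N * (real k + real k * \<tau>1)"
proof -
  have roots: "e = \<tau>1 \<or> e = \<tau>2" if "e * e = (real a - real c) * e + (real k - real c)" for e
  proof -
    have "(e - \<tau>1) * (e - \<tau>2) = e * e - (\<tau>1 + \<tau>2) * e + \<tau>1 * \<tau>2"
      by (simp add: algebra_simps)
    also have "\<dots> = 0" unfolding \<tau> that by simp
    finally show ?thesis by simp
  qed
  \<comment> \<open>The quadratic has the real roots \<open>\<tau>1\<close> and
    \<open>\<tau>2\<close> even when it is read over the complex numbers, so no nonreal eigenvalue
    can occur.\<close>
  have croots: "e = of_real \<tau>1 \<or> e = of_real \<tau>2"
    if "e * e = (of_nat a - of_nat c) * e + (of_nat k - of_nat c)" for e :: complex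
  proof -
    have s: "of_nat a - of_nat c = complex_of_real (\<tau>1 + \<tau>2)"
      "of_nat k - of_nat c = - complex_of_real (\<tau>1 * \<tau>2)"
      unfolding \<tau> by simp_all
    have "(e - of_real \<tau>1) * (e - of_real \<tau>2) = 0"
      using that unfolding s by (simp add: algebra_simps)
    then show ?thesis by simp
  qed
  show sub: "{x. eigenvalue M x} \<subseteq> {real k, \<tau>1, \<tau>2}"
    using srg_matrix_eigenvalue[OF srg M] roots by blast
  have "\<exists>es. char_poly M = (\<Prod>e\<leftarrow>es. [:- e, 1:])"
  proof (rule char_poly_real_split[OF M(1)])
    fix e :: complex assume "eigenvalue (map_mat of_real M) e"
    then have "e = of_nat k \<or> e * e = (of_nat a - of_nat c) * e + (of_nat k - of_nat c)"
      by (rule srg_matrix_eigenvalue[OF srg, rotated 2]) (use M in auto)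
    then have "e = of_nat k \<or> e = of_real \<tau>1 \<or> e = of_real \<tau>2" using croots by blast
    then show "e \<in> \<real>" by auto
  qed
  then obtain es where es: "char_poly M = (\<Prod>e\<leftarrow>es. [:- e, 1:])" by blast
  have mult: "eigenvalue_mult M x = count_list es x" for x
    by (simp add: eigenvalue_mult_def es order_prod_list_linear)
  have "eigenvalue M e" if "e \<in> set es" for e
  proof -
    have "poly (char_poly M) e = 0" unfolding es using that by (induction es) auto
    then show ?thesis using eigenvalue_root_char_poly[OF M(1)] by blast
  qed
  then have "set es \<subseteq> {real k, \<tau>1, \<tau>2}" using sub by blast
  note three = sum_list_three_values[OF this ne]
  note ps = eigenvalue_power_sums[OF M(1) es]
  define f0 f1 f2 where "f0 = real (count_list es (real k))" and "f1 = real (count_list es \<tau>1)"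
    and "f2 = real (count_list es \<tau>2)"
  have e0: "f0 + f1 + f2 = real N"
    using three[of "\<lambda>_. 1"] ps(1) by (simp add: f0_def f1_def f2_def sum_list_triv)
  have "(\<Sum>i = 0..<N. M $$ (i, i)) = (\<Sum>i = 0..<N. 0)"
    using M(2) srg by (intro sum.cong) (auto simp: srg_relation_def)
  then have e1: "f0 * real k + f1 * \<tau>1 + f2 * \<tau>2 = 0"
    using three[of "\<lambda>e. e"] ps(2) by (simp add: f0_def f1_def f2_def)
  have "(M * M) $$ (i, i) = real k" if i: "i < N" for i
  proof -
    have "(M * M) $$ (i, i) = (\<Sum>j = 0..<N. of_bool (E i j) * of_bool (E j i))"
      using M i by (simp add: scalar_prod_def)
    also have "\<dots> = real k"
      using i srg by (subst srg_walks2[OF srg]) (auto simp: srg_relation_def)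
    finally show ?thesis .
  qed
  then have e2: "f0 * (real k * real k) + f1 * (\<tau>1 * \<tau>1) + f2 * (\<tau>2 * \<tau>2) = real N * real k"
    using three[of "\<lambda>e. e * e"] ps(3) by (simp add: f0_def f1_def f2_def)
  \<comment> \<open>The polynomial \<open>(x - p) * (x - q)\<close> summed over the spectrum, where
    the identity, the matrix and its square have the traces \<open>N\<close>, \<open>0\<close> and
    \<open>N * k\<close>. Taking for \<open>p\<close> and \<open>q\<close> two of the three
    eigenvalues leaves a single multiplicity.\<close>
  have gen: "f0 * ((real k - p) * (real k - q)) + f1 * ((\<tau>1 - p) * (\<tau>1 - q)) + f2 * ((\<tau>2 - p) * (\<tau>2 - q))
    = real N * (real k + p * q)" for p q
  proof -
    have "f0 * ((real k - p) * (real k - q)) + f1 * ((\<tau>1 - p) * (\<tau>1 - q)) + f2 * ((\<tau>2 - p) * (\<tau>2 - q))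
      = (f0 * (real k * real k) + f1 * (\<tau>1 * \<tau>1) + f2 * (\<tau>2 * \<tau>2))
        - (p + q) * (f0 * real k + f1 * \<tau>1 + f2 * \<tau>2) + p * q * (f0 + f1 + f2)"
      by (simp add: algebra_simps)
    then show ?thesis unfolding e0 e1 e2 by (simp add: algebra_simps)
  qed
  show "real (eigenvalue_mult M (real k)) * (real k - \<tau>1) * (real k - \<tau>2) = real N * (real k + \<tau>1 * \<tau>2)"
    using gen[of \<tau>1 \<tau>2] by (simp add: mult f0_def)
  show "real (eigenvalue_mult M \<tau>1) * (\<tau>1 - real k) * (\<tau>1 - \<tau>2) = real N * (real k + real k * \<tau>2)"
    using gen[of "real k" \<tau>2] by (simp add: mult f1_def)
  show "real (eigenvalue_mult M \<tau>2) * (\<tau>2 - real k) * (\<tau>2 - \<tau>1) = real N * (real k + real k * \<tau>1)"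
    using gen[of "real k" \<tau>1] by (simp add: mult f2_def)
qed

section \<open>Passage from vertices to matrix indices\<close>

lemma card_nth_eq:
  assumes "distinct vs"
  shows "card {j \<in> {0..<length vs}. Pr (vs ! j)} = card {w \<in> set vs. Pr w}"
proof -
  have "bij_betw ((!) vs) {0..<length vs} (set vs)"
    using assms by (intro bij_betw_nth) auto
  then have inj: "inj_on ((!) vs) {j \<in> {0..<length vs}. Pr (vs ! j)}"
    unfolding bij_betw_def by (rule inj_on_subset[OF conjunct1]) auto
  have "(!) vs ` {j \<in> {0..<length vs}. Pr (vs ! j)} = {w \<in> set vs. Pr w}"
    by (auto simp: in_set_conv_nth)
  then show ?thesis using card_image[OF inj] by simp
qed

lemma srg_relation_nth:
  assumes srg: "srg_relation (set vs) E k a c" and d: "distinct vs"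
  shows "srg_relation {0..<length vs} (\<lambda>i j. E (vs ! i) (vs ! j)) k a c"
proof -
  have E: "\<And>u. u \<in> set vs \<Longrightarrow> \<not> E u u" "\<And>u v. u \<in> set vs \<Longrightarrow> v \<in> set vs \<Longrightarrow> E u v \<Longrightarrow> E v u"
    "\<And>u. u \<in> set vs \<Longrightarrow> card {w \<in> set vs. E u w} = k"
    "\<And>u v. u \<in> set vs \<Longrightarrow> v \<in> set vs \<Longrightarrow> u \<noteq> v \<Longrightarrow>
      card {w \<in> set vs. E u w \<and> E v w} = (if E u v then a else c)"
    using srg unfolding srg_relation_def by blast+
  show ?thesis
    unfolding srg_relation_def
  proof (intro conjI ballI impI)
    fix i assume i: "i \<in> {0..<length vs}"
    then have vi: "vs ! i \<in> set vs" by simp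
    then show "\<not> E (vs ! i) (vs ! i)" by (rule E(1))
    show "card {j \<in> {0..<length vs}. E (vs ! i) (vs ! j)} = k"
      unfolding card_nth_eq[OF d] using E(3)[OF vi] .
    fix j assume j: "j \<in> {0..<length vs}"
    then have vj: "vs ! j \<in> set vs" by simp
    then show "E (vs ! i) (vs ! j) \<Longrightarrow> E (vs ! j) (vs ! i)" using E(2) vi by blast
    assume "i \<noteq> j"
    then have "vs ! i \<noteq> vs ! j" using d i j by (simp add: nth_eq_iff_index_eq)
    then show "card {w \<in> {0..<length vs}. E (vs ! i) (vs ! w) \<and> E (vs ! j) (vs ! w)} =
        (if E (vs ! i) (vs ! j) then a else c)"
      unfolding card_nth_eq[OF d, where Pr = "\<lambda>w. E (vs ! i) w \<and> E (vs ! j) w"]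
      using E(4)[OF vi vj] by blast
  qed simp
qed

section \<open>Separating sets in a strongly regular graph\<close>

definition edge_count :: "('v \<Rightarrow> 'v \<Rightarrow> bool) \<Rightarrow> 'v set \<Rightarrow> 'v set \<Rightarrow> nat" where
  "edge_count E X Y = (\<Sum>x\<in>X. card {y\<in>Y. E x y})"

lemma edge_count_commute:
  assumes "finite X" "finite Y" "\<And>x y. x \<in> X \<Longrightarrow> y \<in> Y \<Longrightarrow> E x y \<longleftrightarrow> E y x"
  shows "edge_count E X Y = edge_count E Y X"
proof -
  have s: "card {y\<in>Y. Pr y} = (\<Sum>y\<in>Y. of_bool (Pr y))" if "finite Y" for Y :: "'a set" and Pr
    using that by (simp add: Int_def)
  have "edge_count E X Y = (\<Sum>x\<in>X. \<Sum>y\<in>Y. of_bool (E x y))"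
    unfolding edge_count_def s[OF assms(2)] ..
  also have "\<dots> = (\<Sum>y\<in>Y. \<Sum>x\<in>X. of_bool (E x y))" by (rule sum.swap)
  also have "\<dots> = (\<Sum>y\<in>Y. \<Sum>x\<in>X. of_bool (E y x))"
    using assms(3) by (intro sum.cong refl) auto
  also have "\<dots> = edge_count E Y X"
    unfolding edge_count_def s[OF assms(1)] ..
  finally show ?thesis .
qed

lemma edge_count_mono2:
  assumes "finite Y'" "Y \<subseteq> Y'"
  shows "edge_count E X Y \<le> edge_count E X Y'"
  unfolding edge_count_def using assms by (intro sum_mono card_mono) auto

lemma edge_count_Un2:
  assumes "finite Y" "finite Y'" "Y \<inter> Y' = {}"
  shows "edge_count E X (Y \<union> Y') = edge_count E X Y + edge_count E X Y'"
proof -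
  have "card {y \<in> Y \<union> Y'. E x y} = card {y\<in>Y. E x y} + card {y\<in>Y'. E x y}" for x
  proof -
    have "{y \<in> Y \<union> Y'. E x y} = {y\<in>Y. E x y} \<union> {y\<in>Y'. E x y}" by blast
    then show ?thesis using assms by (simp add: card_Un_disjoint disjoint_iff)
  qed
  then show ?thesis by (simp add: edge_count_def sum.distrib)
qed

text \<open>
  In the proof, \<open>X\<close> and \<open>Y\<close> are the private neighbours of \<open>u\<close> and \<open>v\<close>, and \<open>Z\<close> consists of the vertices
  adjacent to neither.  The edges from \<open>X\<close> to \<open>Y \<union> Z\<close> and from \<open>Z\<close> to \<open>Y\<close> carry a unit flow that is
  conserved at \<open>Z\<close>.
\<close>

lemma srg_separator_bound:
  assumes srg: "srg_relation V E k a c"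
    and V: "V = A \<union> B \<union> S" "A \<inter> B = {}" "A \<inter> S = {}" "B \<inter> S = {}"
    and u: "u \<in> A" and v: "v \<in> B"
    and sep: "\<And>x y. x \<in> A \<Longrightarrow> y \<in> B \<Longrightarrow> \<not> E x y"
    and load: "\<And>z. z \<in> V \<Longrightarrow> z \<noteq> u \<Longrightarrow> z \<noteq> v \<Longrightarrow> \<not> E z u \<Longrightarrow> \<not> E z v \<Longrightarrow>
      card {w\<in>V. E z w \<and> E u w \<and> \<not> E v w} \<le> k - 1 - a"
    and pos: "0 < k - 1 - a"
  shows "k \<le> card S"
proof -
  define \<kappa> where "\<kappa> = k - 1 - a"
  have fin: "finite V" and irr: "\<And>x. x \<in> V \<Longrightarrow> \<not> E x x"
    and sym: "\<And>x y. x \<in> V \<Longrightarrow> y \<in> V \<Longrightarrow> E x y \<longleftrightarrow> E y x"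
    and deg: "\<And>x. x \<in> V \<Longrightarrow> card {w\<in>V. E x w} = k"
    and com: "\<And>x y. x \<in> V \<Longrightarrow> y \<in> V \<Longrightarrow> x \<noteq> y \<Longrightarrow>
      card {w\<in>V. E x w \<and> E y w} = (if E x y then a else c)"
    using srg unfolding srg_relation_def by blast+
  have finP: "finite {w\<in>V. Pr w}" for Pr using fin by simp
  have uV: "u \<in> V" "v \<in> V" "u \<noteq> v" using u v V by auto
  have nuv: "\<not> E u v" "\<not> E v u" using sep u v sym uV by auto
  define C where "C = {w\<in>V. E u w \<and> E v w}"
  define X where "X = {w\<in>V. E u w \<and> \<not> E v w}"
  define Y where "Y = {w\<in>V. E v w \<and> \<not> E u w}"
  define Z where "Z = {w\<in>V. \<not> E u w \<and> \<not> E v w \<and> w \<noteq> u \<and> w \<noteq> v}"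
  have fins: "finite C" "finite X" "finite Y" "finite Z" "finite S"
    using fin V by (auto simp: C_def X_def Y_def Z_def)
  \<comment> \<open>Neighbours of \<open>x\<close> are \<open>p\<close>, the \<open>a\<close> common
    neighbours with \<open>p\<close>, and vertices of \<open>Y'\<close> or \<open>Z\<close>;
    \<open>q\<close> is not among them. Stated for \<open>p\<close> and \<open>q\<close> so that it
    covers both sides: a vertex of \<open>X\<close> emits, and a vertex of \<open>Y\<close> absorbs,
    \<open>\<kappa>\<close> units.\<close>
  have row: "card {w \<in> Y' \<union> Z. E x w} = \<kappa>"
    if pq: "p \<in> V" "q \<in> V" "p \<noteq> q" "\<not> E p q" and x: "x \<in> V" "E p x" "\<not> E q x"
      and Y': "Y' = {w\<in>V. E q w \<and> \<not> E p w}"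
      and Z': "Z = {w\<in>V. \<not> E p w \<and> \<not> E q w \<and> w \<noteq> p \<and> w \<noteq> q}" for p q x Y'
  proof -
    have xq: "\<not> E x q" "E x p" "x \<noteq> p" using sym x pq irr by auto
    have eq: "{w\<in>V. E x w} = insert p ({w\<in>V. E x w \<and> E p w} \<union> {w \<in> Y' \<union> Z. E x w})"
      unfolding Y' Z' using xq pq by auto
    have fz: "finite {w \<in> Y' \<union> Z. E x w}" using fin by (simp add: Y' Z')
    have "k = card {w\<in>V. E x w}" using deg x by simp
    also have "\<dots> = Suc (card ({w\<in>V. E x w \<and> E p w} \<union> {w \<in> Y' \<union> Z. E x w}))"
      unfolding eq using fin fz irr pq sym[of p q] by (subst card_insert_disjoint) (auto simp: Y' Z')
    also have "\<dots> = Suc (card {w\<in>V. E x w \<and> E p w} + card {w \<in> Y' \<union> Z. E x w})"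
      using finP fz by (subst card_Un_disjoint) (auto simp: Y' Z')
    also have "card {w\<in>V. E x w \<and> E p w} = a" using com[of x p] x pq xq by simp
    finally show ?thesis by (simp add: \<kappa>_def)
  qed
  have rowX: "card {w \<in> Y \<union> Z. E x w} = \<kappa>" if "x \<in> X" for x
    by (rule row[of u v]) (use that uV nuv in \<open>auto simp: X_def Y_def Z_def\<close>)
  have rowY: "card {w \<in> X \<union> Z. E y w} = \<kappa>" if "y \<in> Y" for y
    by (rule row[of v u]) (use that uV nuv in \<open>auto simp: X_def Y_def Z_def\<close>)
  \<comment> \<open>Flow conservation at \<open>z\<close>: it has \<open>c\<close> common neighbours
    with \<open>u\<close> and also with \<open>v\<close>, and its neighbours in \<open>C\<close> are
    counted in both.\<close>
  have bal: "card {w\<in>X. E z w} = card {w\<in>Y. E z w}" if z: "z \<in> Z" for z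
  proof -
    have zV: "z \<in> V" "z \<noteq> u" "z \<noteq> v" "\<not> E z u" "\<not> E z v" using z sym uV by (auto simp: Z_def)
    have "c = card {w\<in>V. E z w \<and> E u w}" using com[of z u] zV uV by simp
    also have "{w\<in>V. E z w \<and> E u w} = {w\<in>X. E z w} \<union> {w\<in>C. E z w}" by (auto simp: X_def C_def)
    also have "card \<dots> = card {w\<in>X. E z w} + card {w\<in>C. E z w}"
      using fin by (intro card_Un_disjoint) (auto simp: X_def C_def)
    finally have 1: "c = card {w\<in>X. E z w} + card {w\<in>C. E z w}" .
    have "c = card {w\<in>V. E z w \<and> E v w}" using com[of z v] zV uV by simp
    also have "{w\<in>V. E z w \<and> E v w} = {w\<in>Y. E z w} \<union> {w\<in>C. E z w}" by (auto simp: Y_def C_def)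
    also have "card \<dots> = card {w\<in>Y. E z w} + card {w\<in>C. E z w}"
      using fin by (intro card_Un_disjoint) (auto simp: Y_def C_def)
    finally have 2: "c = card {w\<in>Y. E z w} + card {w\<in>C. E z w}" .
    from 1 2 show ?thesis by simp
  qed
  have loadZ: "card {w\<in>X. E z w} \<le> \<kappa>" if z: "z \<in> Z" for z
  proof -
    have "{w\<in>X. E z w} = {w\<in>V. E z w \<and> E u w \<and> \<not> E v w}" by (auto simp: X_def)
    then show ?thesis using load[of z] z sym uV by (auto simp: Z_def \<kappa>_def)
  qed
  have CS: "C \<subseteq> S" using sep u v V sym uV unfolding C_def by blast
  have XB: "X \<inter> B = {}" using sep u unfolding X_def by blast
  have YA: "Y \<inter> A = {}" using sep v V sym uV unfolding Y_def by blast
  let ?e = "edge_count E"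
  have sub: "X \<subseteq> V" "Y \<subseteq> V" "Z \<subseteq> V" by (auto simp: X_def Y_def Z_def)
  have comm: "?e K L = ?e L K" if "K \<subseteq> V" "L \<subseteq> V" for K L
    by (rule edge_count_commute) (use that fin sym finite_subset in \<open>blast+\<close>)
  \<comment> \<open>The flow that starts inside \<open>A\<close> can leave only through
    \<open>S\<close>. Since no edge joins \<open>A\<close> to \<open>B\<close> and \<open>Y\<close>
    does not meet \<open>A\<close>, its first step ends in \<open>Y \<inter> S\<close>,
    \<open>Z \<inter> A\<close> or \<open>Z \<inter> S\<close>.\<close>
  have "\<kappa> * card (X \<inter> A) = ?e (X \<inter> A) (Y \<union> Z)"
    unfolding edge_count_def using rowX by simp
  also have "\<dots> = ?e (X \<inter> A) ((Y \<inter> S) \<union> ((Z \<inter> A) \<union> (Z \<inter> S)))"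
    unfolding edge_count_def
  proof (rule sum.cong)
    fix x assume x: "x \<in> X \<inter> A"
    have "{w \<in> Y \<union> Z. E x w} = {w \<in> (Y \<inter> S) \<union> ((Z \<inter> A) \<union> (Z \<inter> S)). E x w}"
      using x sep V sub YA by blast
    then show "card {w \<in> Y \<union> Z. E x w} = card {w \<in> (Y \<inter> S) \<union> ((Z \<inter> A) \<union> (Z \<inter> S)). E x w}" by simp
  qed simp
  also have "\<dots> = ?e (X \<inter> A) (Y \<inter> S) + (?e (X \<inter> A) (Z \<inter> A) + ?e (X \<inter> A) (Z \<inter> S))"
    using fins V by (subst edge_count_Un2, force, force, force simp: Y_def Z_def,
      subst edge_count_Un2) auto
  finally have flow: "\<kappa> * card (X \<inter> A) =
    ?e (X \<inter> A) (Y \<inter> S) + (?e (X \<inter> A) (Z \<inter> A) + ?e (X \<inter> A) (Z \<inter> S))" .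
  \<comment> \<open>By conservation, what enters \<open>Z \<inter> A\<close> is at most what leaves
    it towards \<open>Y\<close>, and separation sends all of that to
    \<open>Y \<inter> S\<close>.\<close>
  have "?e (X \<inter> A) (Z \<inter> A) = ?e (Z \<inter> A) (X \<inter> A)" using sub by (intro comm) auto
  also have "\<dots> \<le> ?e (Z \<inter> A) X" using fins by (intro edge_count_mono2) auto
  also have "\<dots> = ?e (Z \<inter> A) Y" unfolding edge_count_def using bal by (intro sum.cong) auto
  also have "\<dots> = ?e (Z \<inter> A) (Y \<inter> S)" unfolding edge_count_def
  proof (rule sum.cong)
    fix z assume z: "z \<in> Z \<inter> A"
    have "{w\<in>Y. E z w} = {w \<in> Y \<inter> S. E z w}" using z sep V sub YA by blast
    then show "card {w\<in>Y. E z w} = card {w \<in> Y \<inter> S. E z w}" by simp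
  qed simp
  also have "\<dots> = ?e (Y \<inter> S) (Z \<inter> A)" using sub by (intro comm) auto
  finally have f1: "?e (X \<inter> A) (Z \<inter> A) \<le> ?e (Y \<inter> S) (Z \<inter> A)" .
  \<comment> \<open>The direct flow and the flow through \<open>Z \<inter> A\<close> enter
    \<open>Y \<inter> S\<close> along different edges, and by \<open>rowY\<close> a vertex there
    absorbs at most \<open>\<kappa>\<close>.\<close>
  have "?e (X \<inter> A) (Y \<inter> S) + ?e (X \<inter> A) (Z \<inter> A) \<le> ?e (Y \<inter> S) (X \<inter> A) + ?e (Y \<inter> S) (Z \<inter> A)"
    using f1 comm[of "X \<inter> A" "Y \<inter> S", OF le_infI1 le_infI1, OF sub(1,2)] by simp
  also have "\<dots> = ?e (Y \<inter> S) ((X \<inter> A) \<union> (Z \<inter> A))"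
    using fins by (intro edge_count_Un2[symmetric]) (auto simp: X_def Z_def)
  also have "\<dots> \<le> ?e (Y \<inter> S) (X \<union> Z)" using fins by (intro edge_count_mono2) auto
  also have "\<dots> = \<kappa> * card (Y \<inter> S)" unfolding edge_count_def using rowY by simp
  finally have f2: "?e (X \<inter> A) (Y \<inter> S) + ?e (X \<inter> A) (Z \<inter> A) \<le> \<kappa> * card (Y \<inter> S)" .
  have "?e (X \<inter> A) (Z \<inter> S) = ?e (Z \<inter> S) (X \<inter> A)" using sub by (intro comm) auto
  also have "\<dots> \<le> ?e (Z \<inter> S) X" using fins by (intro edge_count_mono2) auto
  also have "\<dots> \<le> (\<Sum>z \<in> Z \<inter> S. \<kappa>)" unfolding edge_count_def using loadZ by (intro sum_mono) auto
  finally have f3: "?e (X \<inter> A) (Z \<inter> S) \<le> \<kappa> * card (Z \<inter> S)" by (simp add: mult.commute)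
  have "\<kappa> * card (X \<inter> A) \<le> \<kappa> * (card (Y \<inter> S) + card (Z \<inter> S))"
    using flow f2 f3 by (simp add: distrib_left)
  then have key: "card (X \<inter> A) \<le> card (Y \<inter> S) + card (Z \<inter> S)" using pos by (simp add: \<kappa>_def)
  \<comment> \<open>The sets \<open>C\<close>, \<open>X \<inter> S\<close>,
    \<open>Y \<inter> S\<close> and \<open>Z \<inter> S\<close> are disjoint parts of
    \<open>S\<close>; with the bound on \<open>card (X \<inter> A)\<close> their sizes add up to at
    least \<open>card C + card X = k\<close>.\<close>
  have "{w\<in>V. E u w} = C \<union> X" by (auto simp: C_def X_def)
  then have "k = card C + card X"
    using deg[OF uV(1)] fins by (subst card_Un_disjoint[symmetric]) (auto simp: C_def X_def)
  moreover have "X = (X \<inter> A) \<union> (X \<inter> S)" using sub V XB by blast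
  then have "card X = card (X \<inter> A) + card (X \<inter> S)"
    using fins V by (subst card_Un_disjoint[symmetric]) auto
  ultimately have "k \<le> card C + (card (X \<inter> S) + (card (Y \<inter> S) + card (Z \<inter> S)))"
    using key by simp
  also have "card (Y \<inter> S) + card (Z \<inter> S) = card ((Y \<inter> S) \<union> (Z \<inter> S))"
    using fins by (subst card_Un_disjoint) (auto simp: Y_def Z_def)
  also have "card (X \<inter> S) + \<dots> = card ((X \<inter> S) \<union> ((Y \<inter> S) \<union> (Z \<inter> S)))"
    using fins by (subst card_Un_disjoint) (auto simp: X_def Y_def Z_def)
  also have "card C + \<dots> = card (C \<union> ((X \<inter> S) \<union> ((Y \<inter> S) \<union> (Z \<inter> S))))"
    using fins by (subst card_Un_disjoint) (auto simp: C_def X_def Y_def Z_def)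
  also have "\<dots> \<le> card S" using fins CS by (intro card_mono) auto
  finally show ?thesis .
qed

section \<open>Counting in a projective rectangle\<close>

locale projective_rectangle_order = projective_rectangle R D
  for R :: "('p, 'l) incidence" and D :: 'p +
  fixes m n :: nat
  assumes order: "has_order R D m n"
begin

abbreviation on :: "'p \<Rightarrow> 'l \<Rightarrow> bool" where "on p l \<equiv> (p, l) \<in> inc R"
abbreviation Sp :: "'l set" where "Sp \<equiv> special_lines R D"
abbreviation Od :: "'l set" where "Od \<equiv> ordinary_lines R D"

section \<open>Joins, meets and the sizes of lines\<close>

lemma on_point: "on p l \<Longrightarrow> p \<in> points R" and on_line: "on p l \<Longrightarrow> l \<in> lines R"
  using wf by (auto simp: wf_incidence_def)

lemma line_points_eq: "line_points R l = {p. on p l}"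
  using on_point by (auto simp: line_points_def)

lemma lines_meet_iff: "lines_meet R l k \<longleftrightarrow> (\<exists>p. on p l \<and> on p k)"
  using on_point by (auto simp: lines_meet_def)

lemma Sp_iff: "l \<in> Sp \<longleftrightarrow> on D l"
  using on_line by (auto simp: special_lines_def)

lemma Od_iff: "l \<in> Od \<longleftrightarrow> l \<in> lines R \<and> \<not> on D l"
  by (auto simp: ordinary_lines_def)

lemma Od_on: "on p l \<Longrightarrow> l \<in> Od \<longleftrightarrow> \<not> on D l"
  using on_line by (auto simp: ordinary_lines_def)

lemma line_eqI: "\<lbrakk>on p l; on q l; on p k; on q k; p \<noteq> q\<rbrakk> \<Longrightarrow> l = k"
  using A1[of p q] on_point on_line by blast

definition join :: "'p \<Rightarrow> 'p \<Rightarrow> 'l" where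
  "join p q = (THE l. l \<in> lines R \<and> on p l \<and> on q l)"

lemma join_on:
  assumes "p \<in> points R" "q \<in> points R" "p \<noteq> q"
  shows "on p (join p q)" "on q (join p q)"
  using theI'[OF A1[OF assms]] by (auto simp: join_def)

lemma join_eqI: "\<lbrakk>on p l; on q l; p \<noteq> q\<rbrakk> \<Longrightarrow> join p q = l"
  using line_eqI[of p "join p q" q l] join_on[of p q] on_point by blast

definition meet :: "'l \<Rightarrow> 'l \<Rightarrow> 'p" where
  "meet l k = (THE p. on p l \<and> on p k)"

lemma meet_eqI: "\<lbrakk>on p l; on p k; l \<noteq> k\<rbrakk> \<Longrightarrow> meet l k = p"
  unfolding meet_def using line_eqI by blast

lemma special_meet:
  assumes "on D s" "l \<in> lines R" "l \<noteq> s"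
  shows "on (meet s l) s" "on (meet s l) l"
proof -
  obtain p where "on p s" "on p l"
    using A5[of s l] assms Sp_iff by blast
  then show "on (meet s l) s" "on (meet s l) l"
    using meet_eqI[of p s l] assms by auto
qed

lemma meet_on:
  assumes "lines_meet R l k" "l \<noteq> k"
  shows "on (meet l k) l" "on (meet l k) k"
  using assms meet_eqI by (auto simp: lines_meet_iff)

lemma finite_Sp: "finite Sp" and card_Sp: "card Sp = m + 1"
  using order card_ge_0_finite[of Sp] by (auto simp: has_order_def)

lemma special_points:
  assumes "on D s"
  shows "finite {p. on p s}" "card {p. on p s} = n + 1" "card ({p. on p s} - {D}) = n"
proof -
  show 1: "card {p. on p s} = n + 1"
    using order assms Sp_iff by (auto simp: has_order_def line_points_eq)
  then show 2: "finite {p. on p s}"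
    by (simp add: card_ge_0_finite)
  show "card ({p. on p s} - {D}) = n"
    using 1 2 assms by simp
qed

lemma ordinary_points_bij:
  assumes "l \<in> Od"
  shows "bij_betw (join D) {p. on p l} Sp"
proof (rule bij_betw_byWitness[where f' = "\<lambda>s. meet s l"])
  have D: "\<not> on D l" "l \<in> lines R" using assms by (auto simp: Od_iff)
  have j: "on D (join D p)" "on p (join D p)" if "on p l" for p
    using join_on[of D p] that on_point A4 D by blast+
  have t: "on (meet s l) s" "on (meet s l) l" if "on D s" for s
    using special_meet[OF that D(2)] D that by auto
  show "\<forall>a\<in>{p. on p l}. meet (join D a) l = a"
  proof safe
    fix a assume "on a l"
    then show "meet (join D a) l = a"
      using j[of a] D meet_eqI by metis
  qed
  show "\<forall>a'\<in>Sp. join D (meet a' l) = a'"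
  proof
    fix s assume "s \<in> Sp"
    then show "join D (meet s l) = s"
      using t[of s] D(1) join_eqI[of D s "meet s l"] Sp_iff by force
  qed
  show "join D ` {p. on p l} \<subseteq> Sp" using j Sp_iff by auto
  show "(\<lambda>s. meet s l) ` Sp \<subseteq> {p. on p l}" using t Sp_iff by auto
qed

lemma ordinary_points:
  assumes "l \<in> Od"
  shows "finite {p. on p l}" "card {p. on p l} = m + 1" "on a l \<Longrightarrow> card ({p. on p l} - {a}) = m"
proof -
  show 1: "finite {p. on p l}"
    using bij_betw_finite[OF ordinary_points_bij[OF assms]] finite_Sp by simp
  show 2: "card {p. on p l} = m + 1"
    using bij_betw_same_card[OF ordinary_points_bij[OF assms]] card_Sp by simp
  show "card ({p. on p l} - {a}) = m" if "on a l" using 1 2 that by simp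
qed

text \<open>If every line passed through \<open>D\<close>, a point \<open>x\<close> of the
  quadrangle other than \<open>D\<close> would lie only on its line to \<open>D\<close>, which would
  make \<open>x\<close> collinear with any two further points of the quadrangle.\<close>

lemma ordinary_line_exists: "\<exists>l. l \<in> Od"
proof -
  obtain a b c d where q: "a \<in> points R" "b \<in> points R" "c \<in> points R" "d \<in> points R"
    "distinct [a, b, c, d]" "\<not> collinear3 R a b c" "\<not> collinear3 R a b d"
    "\<not> collinear3 R a c d" "\<not> collinear3 R b c d"
    using A2 unfolding has_quadrangle_def by blast
  show ?thesis
  proof (rule ccontr)
    assume "\<not> ?thesis"
    then have all: "on p l \<Longrightarrow> on D l" for p l using Od_on by blast
    have "\<exists>x y z. x \<in> points R \<and> y \<in> points R \<and> z \<in> points R \<and> x \<noteq> D \<and> x \<noteq> y \<and> x \<noteq> z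
      \<and> \<not> collinear3 R x y z"
    proof (cases "a = D")
      case True
      then show ?thesis using q by (intro exI[of _ b] exI[of _ c] exI[of _ d]) auto
    next
      case False
      then show ?thesis using q by (intro exI[of _ a] exI[of _ b] exI[of _ c]) auto
    qed
    then obtain x y z where x: "x \<in> points R" "y \<in> points R" "z \<in> points R" "x \<noteq> D" "x \<noteq> y"
      "x \<noteq> z" "\<not> collinear3 R x y z" by blast
    have "join x y = join x z"
      using line_eqI[of x "join x y" D "join x z"] join_on[of x y] join_on[of x z] all x by blast
    then have "collinear3 R x y z"
      using join_on[of x y] join_on[of x z] x on_line unfolding collinear3_def by metis
    then show False using x by blast
  qed
qed

lemma m_ge_2: "m \<ge> 2"
proof -
  obtain l where l: "l \<in> Od" using ordinary_line_exists by blast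
  then obtain a b c where "{a, b, c} \<subseteq> {p. on p l}" "distinct [a, b, c]"
    using A3[of l] by (auto simp: Od_iff line_points_eq)
  then have "3 \<le> card {p. on p l}"
    using card_mono[OF ordinary_points(1)[OF l], of "{a, b, c}"] by simp
  then show ?thesis using ordinary_points(2)[OF l] by simp
qed

lemma special_exists_avoiding: "\<exists>s. on D s \<and> s \<noteq> k"
proof (rule ccontr)
  assume "\<not> ?thesis"
  then have "Sp \<subseteq> {k}" using Sp_iff by blast
  then have "card Sp \<le> 1" using card_mono[of "{k}" Sp] by simp
  then show False using card_Sp m_ge_2 by simp
qed

lemma n_ge_2: "n \<ge> 2"
proof -
  obtain s where s: "on D s" using special_exists_avoiding by blast
  then obtain a b c where "{a, b, c} \<subseteq> {p. on p s}" "distinct [a, b, c]"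
    using A3[of s] on_line by (auto simp: line_points_eq)
  then have "3 \<le> card {p. on p s}"
    using card_mono[OF special_points(1)[OF s], of "{a, b, c}"] by simp
  then show ?thesis using special_points(2)[OF s] by simp
qed

lemma ordinary_join_special:
  assumes "p \<in> points R" "p \<noteq> D"
  shows "on D (join D p)" "on p (join D p)"
  using join_on[of D p] assms A4 by auto

lemma special_eq_join: "\<lbrakk>on D s; on p s; p \<noteq> D\<rbrakk> \<Longrightarrow> s = join D p"
  using join_eqI by metis

lemma join_ordinary:
  assumes "p \<in> points R" "q \<in> points R" "p \<noteq> D" "\<not> on q (join D p)"
  shows "join p q \<in> Od" "on p (join p q)" "on q (join p q)"
proof -
  have ne: "p \<noteq> q" using assms ordinary_join_special by blast
  show j: "on p (join p q)" "on q (join p q)" using join_on assms ne by auto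
  show "join p q \<in> Od"
    using j special_eq_join[of "join p q" p] assms Od_on by metis
qed

section \<open>Ordinary lines through a point\<close>

abbreviation "Th p \<equiv> point_clique R D p"

lemma Th_iff: "l \<in> Th p \<longleftrightarrow> l \<in> Od \<and> on p l"
  by (auto simp: point_clique_def)

lemma ordinary_special_meet_unique:
  assumes "on D s" "on p s" "on p l" "on q s" "on q l" "l \<in> Od"
  shows "p = q"
  using line_eqI[of p l q s] assms Od_iff by blast

text \<open>Projection from \<open>p\<close> onto a special line. The point \<open>D\<close> is left
  out because the line joining it to \<open>p\<close> is special.\<close>

lemma Th_bij:
  assumes p: "p \<in> points R" "p \<noteq> D" and s: "on D s" "\<not> on p s"
  shows "bij_betw (\<lambda>l. meet s l) (Th p) ({q. on q s} - {D})"
proof (rule bij_betw_byWitness[where f' = "join p"])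
  have t: "on (meet s l) s" "on (meet s l) l" "meet s l \<noteq> D" "meet s l \<noteq> p" if "l \<in> Th p" for l
  proof -
    have l: "l \<in> lines R" "\<not> on D l" "on p l" using that by (auto simp: Th_iff Od_iff)
    show "on (meet s l) s" "on (meet s l) l" using special_meet[OF s(1) l(1)] l s by auto
    then show "meet s l \<noteq> D" "meet s l \<noteq> p" using l s by auto
  qed
  have j: "join p q \<in> Od" "on p (join p q)" "on q (join p q)" "join p q \<noteq> s"
    if "on q s" "q \<noteq> D" for q
  proof -
    have "\<not> on q (join D p)"
      using line_eqI[of q s D "join D p"] ordinary_join_special[OF p] s that by metis
    then show "join p q \<in> Od" "on p (join p q)" "on q (join p q)"
      using join_ordinary[of p q] p that on_point by blast+
    then show "join p q \<noteq> s" using s by metis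
  qed
  show "\<forall>a\<in>Th p. join p (meet s a) = a"
  proof
    fix l assume "l \<in> Th p"
    then show "join p (meet s l) = l"
      using t[of l] join_eqI[of p l "meet s l"] by (force simp: Th_iff)
  qed
  show "\<forall>a'\<in>{q. on q s} - {D}. meet s (join p a') = a'"
  proof
    fix q assume "q \<in> {q. on q s} - {D}"
    then show "meet s (join p q) = q"
      using j[of q] meet_eqI[of q s "join p q"] by force
  qed
  show "(\<lambda>l. meet s l) ` Th p \<subseteq> {q. on q s} - {D}" using t by auto
  show "join p ` ({q. on q s} - {D}) \<subseteq> Th p"
    unfolding image_subset_iff using j Th_iff by blast
qed

lemma Th_card:
  assumes p: "p \<in> points R" "p \<noteq> D"
  shows "finite (Th p)" "card (Th p) = n"
proof -
  obtain s where s: "on D s" "s \<noteq> join D p" using special_exists_avoiding by blast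
  have "\<not> on p s" using special_eq_join[of s p] s p by blast
  note b = Th_bij[OF p s(1) this]
  show "finite (Th p)" using bij_betw_finite[OF b] special_points[OF s(1)] by simp
  show "card (Th p) = n" using bij_betw_same_card[OF b] special_points[OF s(1)] by simp
qed

definition meeting :: "'p \<Rightarrow> 'l \<Rightarrow> 'l set" where
  "meeting p k = {l \<in> Th p. lines_meet R l k}"

lemma meeting_iff: "l \<in> meeting p k \<longleftrightarrow> l \<in> Od \<and> on p l \<and> (\<exists>q. on q l \<and> on q k)"
  by (auto simp: meeting_def Th_iff lines_meet_iff)

text \<open>Projection from \<open>p\<close> onto \<open>k\<close>. The point left out lies on the
  special line through \<open>p\<close>, so \<open>m\<close> of the \<open>m + 1\<close> points of
  \<open>k\<close> remain.\<close>

lemma meeting_bij: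
  assumes p: "p \<in> points R" "p \<noteq> D" and k: "k \<in> Od" "\<not> on p k"
  shows "bij_betw (join p) ({q. on q k} - {meet (join D p) k}) (meeting p k)"
proof (rule bij_betw_byWitness[where f' = "\<lambda>l. meet l k"])
  note s = ordinary_join_special[OF p]
  have kl: "k \<in> lines R" "\<not> on D k" using k by (auto simp: Od_iff)
  have j: "join p q \<in> Od" "on p (join p q)" "on q (join p q)"
    if "on q k" "q \<noteq> meet (join D p) k" for q
  proof -
    have "\<not> on q (join D p)"
      using meet_eqI[of q "join D p" k] that s kl k by metis
    then show "join p q \<in> Od" "on p (join p q)" "on q (join p q)"
      using join_ordinary[of p q] p that on_point by blast+
  qed
  show "\<forall>a\<in>{q. on q k} - {meet (join D p) k}. meet (join p a) k = a"
  proof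
    fix q assume "q \<in> {q. on q k} - {meet (join D p) k}"
    then show "meet (join p q) k = q"
      using j[of q] k meet_eqI[of q "join p q" k] by force
  qed
  have t: "on (meet l k) l" "on (meet l k) k" "meet l k \<noteq> p" if "l \<in> meeting p k" for l
    using that meet_on[of l k] k unfolding meeting_def Th_iff by blast+
  show "\<forall>a'\<in>meeting p k. join p (meet a' k) = a'"
  proof
    fix l assume "l \<in> meeting p k"
    then show "join p (meet l k) = l"
      using t[of l] join_eqI[of p l "meet l k"] by (force simp: meeting_iff)
  qed
  show "join p ` ({q. on q k} - {meet (join D p) k}) \<subseteq> meeting p k"
    using j by (force simp: meeting_iff)
  have "meet l k \<noteq> meet (join D p) k" if "l \<in> meeting p k" for l
  proof
    assume eq: "meet l k = meet (join D p) k"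
    have "on (meet l k) (join D p)"
      using eq special_meet[OF s(1) kl(1)] kl s by auto
    then have "meet l k = p"
      using ordinary_special_meet_unique[of "join D p" "meet l k" l p] s t[OF that] that
      by (auto simp: meeting_iff)
    then show False using t that by blast
  qed
  then show "(\<lambda>l. meet l k) ` meeting p k \<subseteq> {q. on q k} - {meet (join D p) k}"
    using t by auto
qed

lemma meeting_card:
  assumes p: "p \<in> points R" "p \<noteq> D" and k: "k \<in> Od" "\<not> on p k"
  shows "card (meeting p k) = m"
proof -
  have "on (meet (join D p) k) k"
    using special_meet(2)[OF ordinary_join_special(1)[OF p], of k] k ordinary_join_special[OF p]
    unfolding Od_iff by metis
  then show ?thesis
    using bij_betw_same_card[OF meeting_bij[OF assms]] ordinary_points(3)[OF k(1)] by simp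
qed

lemma meeting_finite: "p \<in> points R \<Longrightarrow> p \<noteq> D \<Longrightarrow> finite (meeting p k)"
  using Th_card finite_subset[of "meeting p k" "Th p"] by (auto simp: meeting_def)

lemma ordinary_third_point:
  assumes "l \<in> Od"
  shows "\<exists>q. on q l \<and> q \<noteq> x \<and> q \<noteq> y"
proof (rule ccontr)
  assume "\<not> ?thesis"
  then have "{q. on q l} \<subseteq> {x, y}" by blast
  then have "card {q. on q l} \<le> card {x, y}" by (intro card_mono) auto
  also have "\<dots> \<le> 2" by (simp add: card_insert_if)
  finally show False using ordinary_points(2)[OF assms] m_ge_2 by simp
qed

text \<open>Combined with \<open>Th_disjoint_special\<close> this splits the ordinary lines along
  any special line into \<open>n\<close> classes of size \<open>n\<close>, which gives their
  number.\<close>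

lemma Od_eq_Union_Th:
  assumes s: "on D s"
  shows "Od = (\<Union>p \<in> {p. on p s} - {D}. Th p)"
proof -
  have "\<exists>p. on p s \<and> p \<noteq> D \<and> on p l" if "l \<in> Od" for l
    using special_meet[OF s, of l] that s unfolding Od_iff by metis
  then show ?thesis
    using Th_iff by blast
qed

lemma Th_disjoint_special:
  assumes "on D s" "on p s" "on q s" "p \<noteq> q"
  shows "Th p \<inter> Th q = {}"
  using ordinary_special_meet_unique[of s p _ q] assms by (auto simp: Th_iff)

lemma Th_Int:
  assumes "p \<noteq> q" "l \<in> Th p \<inter> Th q" "k \<in> Th p \<inter> Th q"
  shows "l = k"
  using line_eqI[of p l q k] assms by (auto simp: Th_iff)

lemma finite_Od: "finite Od" and card_Od: "card Od = n\<^sup>2"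
proof -
  obtain s where s: "on D s" using special_exists_avoiding by blast
  have f: "finite (Th p)" "card (Th p) = n" if "p \<in> {p. on p s} - {D}" for p
    using Th_card[of p] that on_point by auto
  show "finite Od"
    unfolding Od_eq_Union_Th[OF s] using f special_points[OF s] by auto
  have "card Od = (\<Sum>p \<in> {p. on p s} - {D}. card (Th p))"
    unfolding Od_eq_Union_Th[OF s]
    using f special_points[OF s] Th_disjoint_special[OF s]
    by (intro card_UN_disjoint) auto
  also have "\<dots> = n\<^sup>2"
    using f special_points[OF s] by (simp add: power2_eq_square)
  finally show "card Od = n\<^sup>2" .
qed

section \<open>Adjacency: degrees and common neighbours\<close>

definition adj :: "'l \<Rightarrow> 'l \<Rightarrow> bool" where
  "adj l k \<longleftrightarrow> l \<in> Od \<and> k \<in> Od \<and> l \<noteq> k \<and> (\<exists>p. on p l \<and> on p k)"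

lemma adj_sym: "adj l k \<longleftrightarrow> adj k l"
  by (auto simp: adj_def)

lemma ordinary_on: "l \<in> Od \<Longrightarrow> on p l \<Longrightarrow> p \<in> points R \<and> p \<noteq> D"
  using on_point Od_iff by blast

lemma adj_degree:
  assumes l: "l \<in> Od"
  shows "card {k. adj l k} = (m + 1) * (n - 1)"
proof -
  have eq: "{k. adj l k} = (\<Union>p \<in> {p. on p l}. Th p - {l})"
    using l by (auto simp: adj_def Th_iff)
  have "card {k. adj l k} = (\<Sum>p \<in> {p. on p l}. card (Th p - {l}))"
    unfolding eq
  proof (intro card_UN_disjoint ballI impI)
    show "finite {p. on p l}" using ordinary_points[OF l] by blast
    show "finite (Th p - {l})" if "p \<in> {p. on p l}" for p
      using Th_card[of p] ordinary_on[OF l] that by auto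
    show "(Th p - {l}) \<inter> (Th q - {l}) = {}" if "p \<in> {p. on p l}" "q \<in> {p. on p l}" "p \<noteq> q" for p q
    proof (rule equals0I)
      fix w assume "w \<in> (Th p - {l}) \<inter> (Th q - {l})"
      then show False using line_eqI[of p w q l] that by (force simp: Th_iff)
    qed
  qed
  also have "\<dots> = (\<Sum>p \<in> {p. on p l}. n - 1)"
  proof (rule sum.cong)
    fix p assume "p \<in> {p. on p l}"
    then show "card (Th p - {l}) = n - 1"
      using Th_card[of p] ordinary_on[OF l] l by (auto simp: Th_iff)
  qed simp
  finally show ?thesis using ordinary_points[OF l] by simp
qed

lemma finite_adj: "finite {k. adj l k \<and> Q k}"
  by (rule finite_subset[OF _ finite_Od]) (auto simp: adj_def)

lemma common_nonadjacent:
  assumes l: "l \<in> Od" and k: "k \<in> Od" and ne: "l \<noteq> k" and na: "\<not> adj l k"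
  shows "card {w. adj l w \<and> adj k w} = m * (m + 1)"
proof -
  have nm: "\<not> on p k" if "on p l" for p
    using that l k ne na by (auto simp: adj_def)
  have eq: "{w. adj l w \<and> adj k w} = (\<Union>p \<in> {p. on p l}. meeting p k)"
    using l k nm by (auto simp: adj_def meeting_iff)
  have "card {w. adj l w \<and> adj k w} = (\<Sum>p \<in> {p. on p l}. card (meeting p k))"
    unfolding eq
  proof (intro card_UN_disjoint ballI impI)
    show "finite {p. on p l}" using ordinary_points[OF l] by blast
    show "finite (meeting p k)" if "p \<in> {p. on p l}" for p
      using meeting_finite ordinary_on[OF l] that by auto
    show "meeting p k \<inter> meeting q k = {}" if "p \<in> {p. on p l}" "q \<in> {p. on p l}" "p \<noteq> q" for p q
    proof (rule equals0I)
      fix w assume w: "w \<in> meeting p k \<inter> meeting q k"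
      then have "w = l" using line_eqI[of p w q l] that by (force simp: meeting_iff)
      then show False using w nm by (auto simp: meeting_iff)
    qed
  qed
  also have "\<dots> = (\<Sum>p \<in> {p. on p l}. m)"
    using meeting_card[OF _ _ k] ordinary_on[OF l] nm by (intro sum.cong) auto
  finally show ?thesis using ordinary_points[OF l] by simp
qed

text \<open>The common point \<open>P\<close> contributes the \<open>n - 2\<close> other ordinary
  lines through it. Each of the remaining \<open>m\<close> points of \<open>l\<close> contributes
  the \<open>m\<close> ordinary lines that meet \<open>k\<close>, minus \<open>l\<close> itself,
  which meets \<open>k\<close> in \<open>P\<close>.\<close>

lemma common_adjacent:
  assumes a: "adj l k"
  shows "card {w. adj l w \<and> adj k w} = m * (m - 1) + n - 2"
proof -
  have l: "l \<in> Od" and k: "k \<in> Od" and ne: "l \<noteq> k" using a by (auto simp: adj_def)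
  obtain P where P: "on P l" "on P k" using a by (auto simp: adj_def)
  have nm: "\<not> on p k" if "on p l" "p \<noteq> P" for p
    using line_eqI[of p l P k] that P ne by blast
  let ?X = "{p. on p l} - {P}"
  let ?Y = "\<Union>p \<in> ?X. meeting p k - {l}"
  have eq: "{w. adj l w \<and> adj k w} = (Th P - {l, k}) \<union> ?Y"
  proof (intro equalityI subsetI)
    fix w assume w: "w \<in> {w. adj l w \<and> adj k w}"
    then obtain p q where "on p w" "on p l" "on q w" "on q k" by (auto simp: adj_def)
    then show "w \<in> (Th P - {l, k}) \<union> ?Y"
      using w by (cases "p = P") (auto simp: adj_def meeting_iff Th_iff)
  next
    fix w assume w: "w \<in> (Th P - {l, k}) \<union> ?Y"
    then show "w \<in> {w. adj l w \<and> adj k w}"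
      using l k ne P nm by (auto simp: adj_def meeting_iff Th_iff)
  qed
  have fT: "finite (Th P)" "card (Th P) = n" using Th_card[of P] ordinary_on[OF l P(1)] by auto
  have lk: "{l, k} \<subseteq> Th P" using l k P by (auto simp: Th_iff)
  have c1: "card (Th P - {l, k}) = n - 2"
    using card_Diff_subset[OF _ lk] fT ne by simp
  have fX: "finite ?X" "card ?X = m" using ordinary_points[OF l] P by auto
  have fm: "finite (meeting p k)" if "p \<in> ?X" for p
    using meeting_finite ordinary_on[OF l] that by auto
  have "card ?Y = (\<Sum>p \<in> ?X. card (meeting p k - {l}))"
  proof (intro card_UN_disjoint ballI impI)
    show "finite ?X" by (fact fX)
    show "finite (meeting p k - {l})" if "p \<in> ?X" for p using fm that by blast
    show "(meeting p k - {l}) \<inter> (meeting q k - {l}) = {}" if "p \<in> ?X" "q \<in> ?X" "p \<noteq> q" for p q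
    proof (rule equals0I)
      fix w assume "w \<in> (meeting p k - {l}) \<inter> (meeting q k - {l})"
      then show False using line_eqI[of p w q l] that by (force simp: meeting_iff)
    qed
  qed
  also have "\<dots> = (\<Sum>p \<in> ?X. m - 1)"
  proof (rule sum.cong)
    fix p assume p: "p \<in> ?X"
    then have "l \<in> meeting p k" using l P by (auto simp: meeting_iff)
    then show "card (meeting p k - {l}) = m - 1"
      using meeting_card[OF _ _ k] ordinary_on[OF l] nm p by auto
  qed simp
  finally have c2: "card ?Y = m * (m - 1)" using fX by simp
  have dis: "(Th P - {l, k}) \<inter> ?Y = {}"
  proof (rule equals0I)
    fix w assume "w \<in> (Th P - {l, k}) \<inter> ?Y"
    then obtain p where "on p l" "p \<noteq> P" "on p w" "on P w" "w \<noteq> l" by (auto simp: meeting_iff Th_iff)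
    then show False using line_eqI[of p w P l] P by blast
  qed
  have fY: "finite ?Y" using fX fm by blast
  have "card {w. adj l w \<and> adj k w} = (n - 2) + m * (m - 1)"
    unfolding eq using card_Un_disjoint[OF _ fY dis] fT c1 c2 by simp
  then show ?thesis using n_ge_2 by simp
qed

section \<open>Comparison of \<open>m\<close> and \<open>n\<close>, and the load of a vertex\<close>

lemma special_has_two_ordinary_points:
  assumes s: "on D s"
  shows "\<exists>q. on q s \<and> q \<noteq> D \<and> q \<noteq> p"
proof (rule ccontr)
  assume "\<not> ?thesis"
  then have "{q. on q s} \<subseteq> {D, p}" by blast
  then have "card {q. on q s} \<le> card {D, p}" by (intro card_mono) auto
  also have "\<dots> \<le> 2" by (simp add: card_insert_if)
  finally show False using special_points[OF s] n_ge_2 by simp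
qed

lemma m_le_n: "m \<le> n"
proof -
  obtain l where l: "l \<in> Od" using ordinary_line_exists by blast
  obtain s where s: "on D s" using special_exists_avoiding by blast
  obtain q where q: "on q s" "q \<noteq> D" "q \<noteq> meet s l"
    using special_has_two_ordinary_points[OF s] by blast
  have "\<not> on q l" using meet_eqI[of q s l] q l s by (auto simp: Od_iff)
  then have "card (meeting q l) = m"
    using meeting_card[of q l] q l on_point by blast
  moreover have "meeting q l \<subseteq> Th q" by (auto simp: meeting_def)
  ultimately show ?thesis
    using card_mono[of "Th q" "meeting q l"] Th_card[of q] q on_point by auto
qed

text \<open>Through a point \<open>q\<close> of \<open>l\<close> there are \<open>n\<close> ordinary
  lines; \<open>m\<close> of them meet \<open>k\<close>, and \<open>l\<close> does not.\<close>

lemma m_less_n: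
  assumes "l \<in> Od" "k \<in> Od" "l \<noteq> k" "\<not> adj l k"
  shows "m < n"
proof -
  have "card {p. on p l} > 0" using ordinary_points(2)[OF assms(1)] by simp
  then obtain q where q: "on q l" using card_gt_0_iff[of "{p. on p l}"] by auto
  have nm: "\<not> on p k" if "on p l" for p
    using that assms by (auto simp: adj_def)
  have "l \<notin> meeting q k" "l \<in> Th q" using nm q assms by (auto simp: meeting_iff Th_iff)
  moreover have "meeting q k \<subseteq> Th q" by (auto simp: meeting_def)
  ultimately have "meeting q k \<subset> Th q" by blast
  then show ?thesis
    using psubset_card_mono[of "Th q" "meeting q k"] Th_card[of q] meeting_card[of q k]
      ordinary_on[OF assms(1) q] nm[OF q] assms(2) by auto
qed

text \<open>Bounds the load of the vertex \<open>z\<close> in the flow argument. At a point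
  \<open>p\<close> of \<open>z\<close> only \<open>m\<close> lines meet \<open>u\<close>, and of the
  \<open>n\<close> ordinary lines through \<open>p\<close> only \<open>n - m - 1\<close> avoid
  \<open>v\<close> and differ from \<open>z\<close>.\<close>

lemma card_common_avoiding_le:
  assumes z: "z \<in> Od" and u: "u \<in> Od" and v: "v \<in> Od"
    and zu: "z \<noteq> u" "\<not> adj z u" and zv: "z \<noteq> v" "\<not> adj z v"
  shows "card {w. adj z w \<and> adj u w \<and> \<not> adj v w \<and> w \<noteq> v} \<le> m * (n - m)"
proof -
  let ?W = "{w. adj z w \<and> adj u w \<and> \<not> adj v w \<and> w \<noteq> v}"
  have nu: "\<not> on p u" "\<not> on p v" if "on p z" for p
    using that zu zv z u v by (auto simp: adj_def)
  have sub: "?W \<subseteq> (\<Union>p \<in> {p. on p z}. meeting p u - meeting p v)"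
  proof
    fix w assume w: "w \<in> ?W"
    then obtain p where p: "on p z" "on p w" by (auto simp: adj_def)
    then have "w \<in> meeting p u - meeting p v" using w v by (auto simp: adj_def meeting_iff)
    then show "w \<in> (\<Union>p \<in> {p. on p z}. meeting p u - meeting p v)" using p by blast
  qed
  have b: "card (meeting p u - meeting p v) \<le> min m (n - m - 1)" if p: "on p z" for p
  proof -
    have pp: "p \<in> points R" "p \<noteq> D" using ordinary_on[OF z p] by auto
    have cu: "card (meeting p u) = m" "card (meeting p v) = m"
      using meeting_card[OF pp] u v nu[OF p] by auto
    have "meeting p u - meeting p v \<subseteq> Th p - insert z (meeting p v)"
      using nu z by (auto simp: meeting_iff Th_iff)
    then have "card (meeting p u - meeting p v) \<le> card (Th p - insert z (meeting p v))"
      using Th_card[OF pp] by (intro card_mono) auto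
    also have "\<dots> = n - card (insert z (meeting p v))"
      using Th_card[OF pp] z p meeting_finite[OF pp]
      by (subst card_Diff_subset) (auto simp: meeting_def Th_iff)
    also have "\<dots> = n - m - 1"
      using cu meeting_finite[OF pp] nu by (subst card_insert_disjoint) (auto simp: meeting_iff)
    finally have "card (meeting p u - meeting p v) \<le> n - m - 1" .
    moreover have "card (meeting p u - meeting p v) \<le> m"
      using card_mono[of "meeting p u" "meeting p u - meeting p v"] cu meeting_finite[OF pp] by auto
    ultimately show ?thesis by simp
  qed
  have "card ?W \<le> card (\<Union>p \<in> {p. on p z}. meeting p u - meeting p v)"
    using meeting_finite ordinary_on[OF z] ordinary_points[OF z] by (intro card_mono sub) auto
  also have "\<dots> \<le> (\<Sum>p \<in> {p. on p z}. card (meeting p u - meeting p v))"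
    by (intro card_UN_le) (use ordinary_points[OF z] in auto)
  also have "\<dots> \<le> (\<Sum>p \<in> {p. on p z}. min m (n - m - 1))"
    using b by (intro sum_mono) auto
  also have "\<dots> = (m + 1) * min m (n - m - 1)"
    using ordinary_points[OF z] by simp
  \<comment> \<open>Put \<open>d = n - m\<close>. Either \<open>d \<ge> m + 1\<close> and the bound
    \<open>m\<close> suffices, or \<open>d \<le> m\<close> and, for positive \<open>d\<close>,
    \<open>(m + 1) * (d - 1) = m * d + d - (m + 1) \<le> m * d\<close>. For \<open>d = 0\<close>
    truncated subtraction makes the left side \<open>0\<close>.\<close>
  also have "\<dots> \<le> m * (n - m)"
  proof (cases "n - m \<ge> m + 1")
    case True
    then have "m * (m + 1) \<le> m * (n - m)" by (rule mult_le_mono2)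
    moreover have "(m + 1) * min m (n - m - 1) \<le> (m + 1) * m" by (intro mult_le_mono2) simp
    ultimately show ?thesis by (simp only: mult.commute[of m "m + 1"])
  next
    case False
    show ?thesis
    proof (cases "n - m")
      case (Suc d)
      then show ?thesis using False by (simp add: algebra_simps min_def)
    qed simp
  qed
  finally show ?thesis .
qed

end

section \<open>The plane spanned by two intersecting ordinary lines\<close>

locale pencil = projective_rectangle_order R D m n
  for R :: "('p, 'l) incidence" and D :: 'p and m n +
  fixes l1 l2 :: 'l and P :: 'p
  assumes l1: "l1 \<in> Od" and l2: "l2 \<in> Od" and l12: "l1 \<noteq> l2"
    and P1: "on P l1" and P2: "on P l2"
begin

text \<open>The configuration is symmetric in the two lines, so results about \<open>l1\<close>
  carry over to \<open>l2\<close>, given that the derived notions are invariant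
  (\<open>swap_transversal\<close>, \<open>swap_Q\<close>).\<close>

lemma swap: "pencil R D m n l2 l1 P"
  using l1 l2 l12 P1 P2 by unfold_locales auto

definition transversal :: "'l \<Rightarrow> bool" where
  "transversal g \<longleftrightarrow> \<not> on P g \<and> (\<exists>a. on a l1 \<and> on a g) \<and> (\<exists>b. on b l2 \<and> on b g)"

lemma swap_transversal: "pencil.transversal R l2 l1 P = transversal"
  unfolding fun_eq_iff pencil.transversal_def[OF swap] transversal_def by blast

lemma on_l1_l2: "on a l1 \<Longrightarrow> on a l2 \<Longrightarrow> a = P"
  using line_eqI[of a l1 P l2] P1 P2 l12 by blast

lemma transversalI:
  assumes "on a l1" "a \<noteq> P" "on b l2" "b \<noteq> P" "on a g" "on b g"
  shows "transversal g"
proof -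
  have "\<not> on P g"
    using line_eqI[of P g a l1] assms P1 on_l1_l2[of b] by blast
  then show ?thesis using assms by (auto simp: transversal_def)
qed

lemma transversalE:
  assumes "transversal g"
  obtains a b where "on a l1" "a \<noteq> P" "on b l2" "b \<noteq> P" "on a g" "on b g" "a \<noteq> b" "\<not> on b l1"
    "\<not> on a l2"
  using assms on_l1_l2 unfolding transversal_def by metis

lemma special_transversal:
  assumes "on D s" "\<not> on P s"
  shows "transversal s"
proof -
  have "l1 \<in> lines R" "l2 \<in> lines R" "l1 \<noteq> s" "l2 \<noteq> s"
    using l1 l2 assms by (auto simp: Od_iff)
  then show ?thesis
    unfolding transversal_def using special_meet[OF assms(1)] assms(2) by blast
qed

lemma transversal_meet:
  assumes g: "transversal g" and h: "transversal h"
  shows "lines_meet R g h"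
proof -
  obtain a b where ab: "on a l1" "a \<noteq> P" "on b l2" "b \<noteq> P" "on a g" "on b g" "a \<noteq> b" "\<not> on b l1"
    using g by (rule transversalE)
  obtain c d where cd: "on c l1" "c \<noteq> P" "on d l2" "d \<noteq> P" "on c h" "on d h" "c \<noteq> d" "\<not> on d l1"
    using h by (rule transversalE)
  show ?thesis
  \<comment> \<open>(A6) demands four distinct points; in the degenerate cases a common point is
    already at hand.\<close>
  proof (cases "a = c \<or> b = d \<or> g = h")
    case True
    then show ?thesis using ab cd unfolding lines_meet_iff by blast
  next
    case False
    then have "distinct [a, b, c, d]" using ab cd by auto
    moreover have "lines_meet R l1 l2" using P1 P2 by (auto simp: lines_meet_iff)
    ultimately show ?thesis
      using A6[OF l1 l2 l12, of g h a b c d] False ab cd on_line by (auto simp: line_points_eq)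
  qed
qed

text \<open>
  The \<open>m\<close> transversals through \<open>a'\<close> hit \<open>g\<close> in distinct points other than \<open>a\<close>, hence in all of them.
\<close>

lemma ordinary_transversal_projects:
  assumes g: "transversal g" "g \<in> Od" and x: "on x g" "\<not> on x l1" and a': "on a' l1" "a' \<noteq> P"
  shows "transversal (join x a')"
proof -
  obtain a b where ab: "on a l1" "a \<noteq> P" "on b l2" "b \<noteq> P" "on a g" "on b g" "a \<noteq> b" "\<not> on b l1"
    using g(1) by (rule transversalE)
  have Pg: "\<not> on P g" using g by (simp add: transversal_def)
  show ?thesis
  proof (cases "a' = a")
    case True
    then have "join x a' = g" using join_eqI[of x g a'] x ab by blast
    then show ?thesis using g by simp
  next
    case False
    have a'g: "\<not> on a' g"
      using line_eqI[of a g a' l1] ab a' False Pg P1 by blast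
    define f where "f b' = meet (join a' b') g" for b'
    have J: "on a' (join a' b')" "on b' (join a' b')" "transversal (join a' b')" "\<not> on P (join a' b')"
      "on (f b') (join a' b')" "on (f b') g" "f b' \<noteq> a"
      if b': "on b' l2" "b' \<noteq> P" for b'
    proof -
      have "a' \<noteq> b'" using on_l1_l2 a' b' by blast
      then show J1: "on a' (join a' b')" "on b' (join a' b')"
        using join_on[of a' b'] on_point a' b' by blast+
      then show J2: "transversal (join a' b')" using transversalI[OF a' b'] by blast
      then show J3: "\<not> on P (join a' b')" by (simp add: transversal_def)
      have "join a' b' \<noteq> g" using J1 a'g by metis
      then show J4: "on (f b') (join a' b')" "on (f b') g"
        using meet_on[OF transversal_meet[OF J2 g(1)]] by (auto simp: f_def)
      show "f b' \<noteq> a"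
        using line_eqI[of a' "join a' b'" a l1] J1 J3 J4 a' ab False P1 by metis
    qed
    let ?B = "{b. on b l2} - {P}" and ?G = "{y. on y g} - {a}"
    \<comment> \<open>A common image, together with \<open>a'\<close>, makes the two joins equal;
      for different \<open>b1\<close> and \<open>b2\<close> this line would be \<open>l2\<close>,
      which passes through \<open>P\<close>.\<close>
    have "inj_on f ?B"
    proof (rule inj_onI)
      fix b1 b2 assume b: "b1 \<in> ?B" "b2 \<in> ?B" and eq: "f b1 = f b2"
      have j1: "on a' (join a' b1)" "on b1 (join a' b1)" "on (f b1) (join a' b1)" "on (f b1) g"
        and nP: "\<not> on P (join a' b1)" using J[of b1] b by auto
      have j2: "on a' (join a' b2)" "on b2 (join a' b2)" "on (f b1) (join a' b2)"
        using J[of b2] b eq by auto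
      have "f b1 \<noteq> a'" using j1 a'g by metis
      then have e: "join a' b1 = join a' b2"
        using line_eqI[of a' "join a' b1" "f b1" "join a' b2"] j1 j2 by blast
      show "b1 = b2"
      proof (rule ccontr)
        assume "b1 \<noteq> b2"
        then have "join a' b1 = l2"
          using line_eqI[of b1 "join a' b1" b2 l2] j1 j2 e b by auto
        then show False using nP P2 by simp
      qed
    qed
    moreover have "card ?B = m" "card ?G = m" "finite ?G"
      using ordinary_points[OF l2] ordinary_points[OF g(2)] P2 ab by auto
    moreover have "f ` ?B \<subseteq> ?G" using J by blast
    ultimately have "f ` ?B = ?G"
      by (intro card_subset_eq) (auto simp: card_image)
    moreover have "x \<in> ?G" using x ab by auto
    ultimately obtain b' where b': "on b' l2" "b' \<noteq> P" "x = f b'" by blast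
    have "x \<noteq> a'" using x a' by blast
    then have "join x a' = join a' b'"
      using join_eqI[of x "join a' b'" a'] J[of b'] b' by blast
    then show ?thesis using J b' by auto
  qed
qed

text \<open>\<open>P\<close> and \<open>D\<close> have to be added by hand: transversals avoid
  \<open>P\<close>, and ordinary lines avoid \<open>D\<close>.\<close>

definition Q :: "'p set" where
  "Q = {P, D} \<union> {x. \<exists>g. transversal g \<and> g \<in> Od \<and> on x g}"

lemma swap_Q: "pencil.Q R D l2 l1 P = Q"
  unfolding pencil.Q_def[OF swap] Q_def swap_transversal by simp

lemma Q_transversal:
  assumes x: "x \<in> Q" "\<not> on x l1" and a: "on a l1" "a \<noteq> P"
  shows "transversal (join x a)"
proof (cases "x = D")
  case True
  have "a \<noteq> D" using l1 a by (auto simp: Od_iff)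
  then have j: "on D (join D a)" "on a (join D a)"
    using ordinary_join_special[of a] on_point a by blast+
  have "\<not> on P (join D a)"
    using line_eqI[of P "join D a" a l1] j a P1 l1 by (metis Od_iff)
  then show ?thesis using special_transversal[OF j(1)] True by simp
next
  case False
  then obtain g where "transversal g" "g \<in> Od" "on x g" using x P1 by (auto simp: Q_def)
  then show ?thesis using ordinary_transversal_projects x a by blast
qed

lemma l1_Q: "on a l1 \<Longrightarrow> a \<in> Q"
proof (cases "a = P")
  case False
  assume a: "on a l1"
  have aD: "a \<in> points R" "a \<noteq> D" using l1 a on_point by (auto simp: Od_iff)
  \<comment> \<open>Among the at least three points of \<open>l2\<close>, two are avoided:
    \<open>P\<close>, and the point on the special line through \<open>a\<close>, whose join with
    \<open>a\<close> would not be ordinary.\<close>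
  obtain b where b: "on b l2" "b \<noteq> P" "b \<noteq> meet (join D a) l2"
    using ordinary_third_point[OF l2] by blast
  have "\<not> on b (join D a)"
    using meet_eqI[of b "join D a" l2] b l2 ordinary_join_special[OF aD] by (auto simp: Od_iff)
  then have "join a b \<in> Od" "on a (join a b)" "on b (join a b)"
    using join_ordinary[of a b] aD b on_point by blast+
  then show ?thesis using transversalI[of a b "join a b"] a b False by (auto simp: Q_def)
qed (simp add: Q_def)

lemma l2_Q: "on a l2 \<Longrightarrow> a \<in> Q"
  using pencil.l1_Q[OF swap] swap_Q by simp

lemma Q_points: "Q \<subseteq> points R"
  using A4 P1 on_point by (auto simp: Q_def)

text \<open>For ordinary \<open>k\<close> it is enough to find a point \<open>y\<close> of
  \<open>k\<close> on \<open>l1\<close>: as \<open>k\<close> avoids \<open>P\<close>, it is the join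
  of \<open>y\<close> with a point of \<open>Q\<close> off \<open>l1\<close>, and
  \<open>Q_transversal\<close> applies. Only when both given points are off \<open>l1\<close> does
  such a \<open>y\<close> take work.\<close>

lemma Q_join:
  assumes x: "x \<in> Q" "x' \<in> Q" "x \<noteq> x'" and k: "on x k" "on x' k" "\<not> on P k"
  shows "transversal k"
proof -
  consider "on x l1" | "on x' l1" | "on D k" | "\<not> on x l1" "\<not> on x' l1" "\<not> on D k" by blast
  then show ?thesis
  proof cases
    case 1
    then have "\<not> on x' l1" using line_eqI[of x l1 x' k] x k P1 by blast
    then show ?thesis
      using Q_transversal[OF x(2), of x] 1 k x join_eqI[of x' k x] by metis
  next
    case 2
    then have "\<not> on x l1" using line_eqI[of x l1 x' k] x k P1 by blast
    then show ?thesis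
      using Q_transversal[OF x(1), of x'] 2 k x join_eqI[of x k x'] by metis
  next
    case 3
    then show ?thesis using special_transversal k by blast
  next
    case 4
    have xD: "x \<in> points R" "x \<noteq> D" "x' \<in> points R" "x' \<noteq> D" using 4 k on_point by blast+
    define s s' where "s = join D x" and "s' = join D x'"
    have s: "on D s" "on x s" and s': "on D s'" "on x' s'"
      using ordinary_join_special xD by (auto simp: s_def s'_def)
    have ss': "s \<noteq> s'" using line_eqI[of x s x' k] s s' x k 4 by metis
    \<comment> \<open>The base pair of (A6) must be ordinary, so \<open>a\<close> has to avoid
      \<open>s\<close> and \<open>a'\<close> has to avoid \<open>s'\<close>. Two points of
      \<open>l1\<close> suffice: a special line contains at most one of them, and no point of
      \<open>l1\<close> lies on both \<open>s\<close> and \<open>s'\<close>, so one of the two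
      assignments works.\<close>
    obtain a1 where a1: "on a1 l1" "a1 \<noteq> P" using ordinary_third_point[OF l1] by blast
    obtain a2 where a2: "on a2 l1" "a2 \<noteq> P" "a2 \<noteq> a1" using ordinary_third_point[OF l1] by blast
    have n1: "\<not> (on a1 t \<and> on a2 t)" if "on D t" for t
      using line_eqI[of a1 t a2 l1] a1 a2 that l1 by (auto simp: Od_iff)
    have n2: "\<not> (on a s \<and> on a s')" if "on a l1" for a
      using line_eqI[of D s a s'] s s' ss' that l1 by (auto simp: Od_iff)
    have "\<exists>a a'. on a l1 \<and> on a' l1 \<and> a \<noteq> P \<and> a' \<noteq> P \<and> a \<noteq> a' \<and> \<not> on a s \<and> \<not> on a' s'"
      using n1[OF s(1)] n1[OF s'(1)] n2[OF a1(1)] n2[OF a2(1)] a1 a2 by metis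
    then obtain a a' where a: "on a l1" "on a' l1" "a \<noteq> P" "a' \<noteq> P" "a \<noteq> a'" "\<not> on a s" "\<not> on a' s'"
      by blast
    \<comment> \<open>(A6) for the pair \<open>g\<close>, \<open>g'\<close> and its common transversals \<open>k\<close> and \<open>l1\<close>.\<close>
    define g g' where "g = join x a" and "g' = join x' a'"
    have g: "g \<in> Od" "on x g" "on a g" "transversal g"
      using join_ordinary[of x a] xD a on_point Q_transversal[of x a] x 4 by (auto simp: g_def s_def)
    have g': "g' \<in> Od" "on x' g'" "on a' g'" "transversal g'"
      using join_ordinary[of x' a'] xD a on_point Q_transversal[of x' a'] x 4 by (auto simp: g'_def s'_def)
    show ?thesis
    proof (cases "g = g'")
      case True
      then have "k = g" using line_eqI[of x k x' g] g g' k x by blast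
      then show ?thesis using g by simp
    next
      case False
      have "distinct [x, x', a, a']" using x 4 a by auto
      moreover have "k \<noteq> l1" using 4 k by blast
      moreover have "k \<in> lines R" "l1 \<in> lines R" using k a on_line by blast+
      ultimately have "lines_meet R k l1"
        using A6[OF g(1) g'(1) False transversal_meet[OF g(4) g'(4)], of k l1 x x' a a'] g g' k a
        by (auto simp: line_points_eq)
      then obtain y where y: "on y k" "on y l1" by (auto simp: lines_meet_iff)
      then have "y \<noteq> P" "join x y = k" using k 4 join_eqI[of x k y] by blast+
      then show ?thesis using Q_transversal[of x y] x 4 y by simp
    qed
  qed
qed

text \<open>A line through \<open>P\<close> needs a second point of \<open>Q\<close>, since of the
  \<open>n\<close> ordinary lines through \<open>P\<close> only \<open>m\<close> belong to the
  plane.\<close>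

definition \<Lambda> :: "'l set" where
  "\<Lambda> = {g. transversal g} \<union> {k. on P k \<and> (\<exists>x\<in>Q. x \<noteq> P \<and> on x k)}"

lemma \<Lambda>_lines: "\<Lambda> \<subseteq> lines R"
  using on_line by (auto simp: \<Lambda>_def transversal_def)

lemma l1_\<Lambda>: "l1 \<in> \<Lambda>"
  using ordinary_third_point[OF l1, of P P] l1_Q P1 by (auto simp: \<Lambda>_def)

lemma l2_\<Lambda>: "l2 \<in> \<Lambda>"
  using ordinary_third_point[OF l2, of P P] l2_Q P2 by (auto simp: \<Lambda>_def)

lemma \<Lambda>_join:
  assumes "x \<in> Q" "x' \<in> Q" "x \<noteq> x'" "on x k" "on x' k"
  shows "k \<in> \<Lambda>"
proof (cases "on P k")
  case True
  then show ?thesis using assms by (cases "x = P") (auto simp: \<Lambda>_def)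
next
  case False
  then show ?thesis using Q_join[of x x' k] assms by (simp add: \<Lambda>_def)
qed

text \<open>\<open>g\<close> has \<open>m + 1\<close> points, but only \<open>m\<close> points of
  \<open>l1\<close> other than \<open>P\<close> can be projected from \<open>x\<close> to
  \<open>g\<close>, so some point \<open>z\<close> of \<open>g\<close> is missed. A transversal
  through \<open>x\<close> and \<open>z\<close> would come from a point of \<open>l1\<close>; hence
  the join of \<open>x\<close> and \<open>z\<close> passes through \<open>P\<close> and is
  \<open>k\<close>.\<close>

lemma ordinary_transversal_meets_pencil_line:
  assumes g: "transversal g" "g \<in> Od" and k: "on P k" "x \<in> Q" "x \<noteq> P" "on x k"
  shows "lines_meet R g k"
proof (cases "k = l1 \<or> on x g")
  case True
  then show ?thesis using g k unfolding transversal_def lines_meet_iff by blast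
next
  case False
  then have xl: "\<not> on x l1" "\<not> on x g" using line_eqI[of x l1 P k] k P1 by blast+
  let ?A = "{a. on a l1} - {P}"
  have A: "finite ?A" "card ?A = m" using ordinary_points[OF l1] P1 by auto
  have "card ((\<lambda>a. meet (join x a) g) ` ?A) \<le> m" using card_image_le[OF A(1)] A(2) by metis
  then have "card ((\<lambda>a. meet (join x a) g) ` ?A) < card {z. on z g}"
    using ordinary_points[OF g(2)] by simp
  then have "\<not> {z. on z g} \<subseteq> (\<lambda>a. meet (join x a) g) ` ?A"
    using card_mono[of "(\<lambda>a. meet (join x a) g) ` ?A" "{z. on z g}"] A by auto
  then obtain z where z: "on z g" "z \<notin> (\<lambda>a. meet (join x a) g) ` ?A" by blast
  have zQ: "z \<in> Q" "x \<noteq> z" using z g xl by (auto simp: Q_def)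
  define h where "h = join x z"
  have h: "on x h" "on z h" using join_on[of x z] zQ k Q_points by (auto simp: h_def)
  have "on P h"
  proof (rule ccontr)
    assume nP: "\<not> on P h"
    then have "transversal h" using Q_join[OF k(2) zQ] h by blast
    then obtain a where a: "on a l1" "on a h" "a \<noteq> P" by (rule transversalE)
    then have "join x a = h" using join_eqI[of x h a] h xl by blast
    moreover have "h \<noteq> g" using h xl by blast
    ultimately have "meet (join x a) g = z" using meet_eqI[of z h g] h z by simp
    then show False using z a by blast
  qed
  then have "h = k" using line_eqI[of x h P k] h k by blast
  then show ?thesis using h z by (auto simp: lines_meet_iff)
qed

text \<open>On an ordinary line \<open>k\<close> through \<open>P\<close> other than
  \<open>l1\<close> and \<open>l2\<close>, the points of \<open>l2\<close> are projected to
  \<open>k\<close> from a point \<open>a\<close> of \<open>l1\<close>. The projecting lines are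
  ordinary transversals, so all images are in \<open>Q\<close>; domain and range both have
  \<open>m - 1\<close> points, so the projection is onto.\<close>

lemma \<Lambda>_ordinary_points:
  assumes k: "k \<in> \<Lambda>" "k \<in> Od" and y: "on y k"
  shows "y \<in> Q"
proof -
  consider "transversal k" | "k = l1" | "k = l2" | "y = P" | "\<not> transversal k" "k \<noteq> l1" "k \<noteq> l2" "y \<noteq> P" by blast
  then show ?thesis
  proof cases
    case 5
    then obtain x where x: "on P k" "x \<in> Q" "x \<noteq> P" "on x k" using k by (auto simp: \<Lambda>_def)
    have yD: "y \<in> points R" "y \<noteq> D" using ordinary_on[OF k(2) y] by auto
    \<comment> \<open>The last condition keeps \<open>y\<close> off the special line through
      \<open>a\<close>, so that \<open>y\<close> is in the range of the projection.\<close>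
    obtain a where a: "on a l1" "a \<noteq> P" "a \<noteq> meet (join D y) l1"
      using ordinary_third_point[OF l1] by blast
    have aD: "a \<in> points R" "a \<noteq> D" using ordinary_on[OF l1 a(1)] by auto
    note sa = ordinary_join_special[OF aD]
    have ak: "\<not> on a k" using line_eqI[of a k P l1] a x P1 5 by blast
    have ya: "\<not> on y (join D a)"
    proof
      assume "on y (join D a)"
      then have "join D y = join D a" using join_eqI[of D "join D a" y] yD sa by blast
      then have "meet (join D y) l1 = a"
        using meet_eqI[of a "join D a" l1] sa a l1 by (auto simp: Od_iff)
      then show False using a by simp
    qed
    \<comment> \<open>The special line through \<open>a\<close> cuts \<open>l2\<close> and
      \<open>k\<close> here. Removing these points and \<open>P\<close> leaves the part where the
      projecting line is an ordinary transversal.\<close>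
    define b0 k0 where "b0 = meet (join D a) l2" and "k0 = meet (join D a) k"
    have b0: "on b0 l2" "on b0 (join D a)" and k0: "on k0 k" "on k0 (join D a)"
      using special_meet[OF sa(1), of l2] special_meet[OF sa(1), of k] l2 k(2) sa(1)
      unfolding b0_def k0_def Od_iff by metis+
    have Psa: "\<not> on P (join D a)"
      using line_eqI[of P "join D a" a l1] sa a P1 l1 unfolding Od_iff by metis
    have b0P: "b0 \<noteq> P" "k0 \<noteq> P" using b0 k0 Psa by metis+
    let ?B = "{b. on b l2} - {P, b0}" and ?K = "{z. on z k} - {P, k0}"
    have cB: "card ?B = m - 1"
      using ordinary_points[OF l2] P2 b0 b0P by (subst card_Diff_subset) auto
    have cK: "card ?K = m - 1" 
      using ordinary_points[OF k(2)] x k0 b0P by (subst card_Diff_subset) auto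
    have fK: "finite ?K" using ordinary_points[OF k(2)] by blast
    define f where "f b = meet (join a b) k" for b
    have J: "on a (join a b)" "on b (join a b)" "transversal (join a b)" "join a b \<in> Od"
      "on (f b) (join a b)" "on (f b) k" "f b \<noteq> P" "f b \<noteq> k0" "f b \<noteq> a"
      if b: "on b l2" "b \<noteq> P" "b \<noteq> b0" for b
    proof -
      have "\<not> on b (join D a)"
        using meet_eqI[of b "join D a" l2] b sa l2 unfolding b0_def Od_iff by metis
      then show J1: "on a (join a b)" "on b (join a b)" "join a b \<in> Od"
        using join_ordinary[of a b] aD b on_point by blast+
      show J2: "transversal (join a b)" using transversalI[of a b "join a b"] J1 a b by blast
      have J3: "\<not> on P (join a b)" using J2 by (simp add: transversal_def)
      have ne: "join a b \<noteq> k" using J1 ak by metis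
      show J4: "on (f b) (join a b)" "on (f b) k"
        using meet_on[OF ordinary_transversal_meets_pencil_line[OF J2 J1(3) x] ne] by (auto simp: f_def)
      show "f b \<noteq> P" "f b \<noteq> a" using J3 J4 ak by metis+
      show "f b \<noteq> k0"
      proof
        assume "f b = k0"
        then have "f b = a"
          using ordinary_special_meet_unique[of "join D a" "f b" "join a b" a] sa J1 J4 k0 by simp
        then show False using J4 ak by simp
      qed
    qed
    have "inj_on f ?B"
    proof (rule inj_onI)
      fix b1 b2 assume b: "b1 \<in> ?B" "b2 \<in> ?B" and eq: "f b1 = f b2"
      have j1: "on a (join a b1)" "on b1 (join a b1)" "on (f b1) (join a b1)" "f b1 \<noteq> a"
        and t: "transversal (join a b1)" using J[of b1] b by auto
      have j2: "on a (join a b2)" "on b2 (join a b2)" "on (f b1) (join a b2)"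
        using J[of b2] b eq by auto
      have e: "join a b1 = join a b2"
        using line_eqI[of a "join a b1" "f b1" "join a b2"] j1 j2 by blast
      show "b1 = b2"
      proof (rule ccontr)
        assume "b1 \<noteq> b2"
        then have "join a b1 = l2"
          using line_eqI[of b1 "join a b1" b2 l2] j1 j2 e b by auto
        then show False using t P2 by (simp add: transversal_def)
      qed
    qed
    moreover have "f ` ?B \<subseteq> ?K" using J by blast
    ultimately have "f ` ?B = ?K"
      using cB cK fK by (intro card_subset_eq) (auto simp: card_image)
    moreover have "y \<in> ?K" using y 5 ya k0 by auto
    ultimately obtain b where b: "on b l2" "b \<noteq> P" "b \<noteq> b0" "y = f b" by blast
    then show ?thesis using J[of b] unfolding Q_def by blast
  qed (use k y l1_Q l2_Q in \<open>auto simp: Q_def\<close>)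
qed

text \<open>Two special lines meet in \<open>D\<close>, and two lines through \<open>P\<close> in
  \<open>P\<close>. Otherwise one line is a transversal and at least one is ordinary; their common
  point lies in \<open>Q\<close> because an ordinary line of \<open>\<Lambda>\<close> has all its
  points there.\<close>

lemma \<Lambda>_meet:
  assumes h: "h \<in> \<Lambda>" and k: "k \<in> \<Lambda>"
  shows "\<exists>z\<in>Q. on z h \<and> on z k"
proof -
  have tk: "\<exists>z\<in>Q. on z g \<and> on z k" if g: "transversal g" and k: "k \<in> \<Lambda>" for g k
  proof -
    have gk: "g \<in> \<Lambda>" using g by (simp add: \<Lambda>_def)
    consider "on D g" "on D k" | "k \<in> Od" "on D g" | "g \<in> Od"
      using gk k \<Lambda>_lines Od_iff by blast
    then show ?thesis
    proof cases
      case 1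
      then show ?thesis by (auto simp: Q_def)
    next
      case 2
      then have "on (meet g k) g" "on (meet g k) k"
        using special_meet[OF 2(2), of k] unfolding Od_iff by metis+
      then show ?thesis using \<Lambda>_ordinary_points[OF k 2(1)] by blast
    next
      case 3
      have "lines_meet R g k"
        using k transversal_meet[OF g] ordinary_transversal_meets_pencil_line[OF g 3] by (auto simp: \<Lambda>_def)
      then show ?thesis using \<Lambda>_ordinary_points[OF gk 3] by (auto simp: lines_meet_iff)
    qed
  qed
  consider "transversal h" | "transversal k" | "on P h" "on P k" using h k by (auto simp: \<Lambda>_def)
  then show ?thesis
  proof cases
    case 3
    then show ?thesis by (auto simp: Q_def)
  qed (use tk h k in blast)+
qed

lemma special_\<Lambda>: "on D s \<Longrightarrow> s \<in> \<Lambda>"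
  using special_transversal[of s] l1 P1 by (auto simp: \<Lambda>_def Q_def Od_iff)

end

section \<open>Points on a line of an abstract projective plane\<close>

lemma collinear3_swap12: "collinear3 S a b c \<longleftrightarrow> collinear3 S b a c"
  and collinear3_swap23: "collinear3 S a b c \<longleftrightarrow> collinear3 S a c b"
  by (auto simp: collinear3_def)

text \<open>If \<open>l\<close> contains two points of the quadrangle, the line through the other
  two cuts \<open>l\<close> in a third point. Otherwise three points of the quadrangle are off
  \<open>l\<close>, and their joins cut \<open>l\<close> in three different points.\<close>

lemma projective_plane_third_point:
  assumes S: "projective_plane S" and l: "l \<in> lines S"
  shows "\<exists>q\<in>points S. (q, l) \<in> inc S \<and> q \<noteq> x \<and> q \<noteq> y"
proof -
  have j: "\<exists>k. k \<in> lines S \<and> (p, k) \<in> inc S \<and> (q, k) \<in> inc S"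
    if "p \<in> points S" "q \<in> points S" "p \<noteq> q" for p q
    using S that unfolding projective_plane_def by blast
  have jm: "\<exists>k p. k \<in> lines S \<and> (a, k) \<in> inc S \<and> (b, k) \<in> inc S \<and> p \<in> points S \<and> (p, k) \<in> inc S \<and>
      (p, l) \<in> inc S"
    if ab: "a \<in> points S" "b \<in> points S" "a \<noteq> b" for a b
  proof -
    obtain k where k: "k \<in> lines S" "(a, k) \<in> inc S" "(b, k) \<in> inc S" using j[OF ab] by blast
    show ?thesis
    proof (cases "k = l")
      case True
      then show ?thesis using k ab by blast
    next
      case False
      then have "\<exists>p. p \<in> points S \<and> (p, k) \<in> inc S \<and> (p, l) \<in> inc S"
        using S k l unfolding projective_plane_def by blast
      then show ?thesis using k by blast
    qed
  qed
  have ju: "k = k'"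
    if "(p, k) \<in> inc S" "(q, k) \<in> inc S" "(p, k') \<in> inc S" "(q, k') \<in> inc S" "p \<noteq> q" for p q k k'
  proof -
    have "inc S \<subseteq> points S \<times> lines S" using S by (simp add: projective_plane_def wf_incidence_def)
    then have "p \<in> points S" "q \<in> points S" "k \<in> lines S" "k' \<in> lines S" using that by auto
    then show ?thesis using S that unfolding projective_plane_def by blast
  qed
  define T where "T \<longleftrightarrow> (\<exists>u\<in>points S. \<exists>v\<in>points S. \<exists>w\<in>points S. (u, l) \<in> inc S \<and> (v, l) \<in> inc S \<and>
    (w, l) \<in> inc S \<and> u \<noteq> v \<and> u \<noteq> w \<and> v \<noteq> w)"
  have tri: T
    if abc: "a \<in> points S" "b \<in> points S" "c \<in> points S" "distinct [a, b, c]" "\<not> collinear3 S a b c"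
      and off: "(a, l) \<notin> inc S" "(b, l) \<notin> inc S" "(c, l) \<notin> inc S" for a b c
  proof -
    obtain k1 p1 where 1: "k1 \<in> lines S" "(a, k1) \<in> inc S" "(b, k1) \<in> inc S" "p1 \<in> points S"
      "(p1, k1) \<in> inc S" "(p1, l) \<in> inc S" using jm[of a b] abc by auto
    obtain k2 p2 where 2: "k2 \<in> lines S" "(a, k2) \<in> inc S" "(c, k2) \<in> inc S" "p2 \<in> points S"
      "(p2, k2) \<in> inc S" "(p2, l) \<in> inc S" using jm[of a c] abc by auto
    obtain k3 p3 where 3: "k3 \<in> lines S" "(b, k3) \<in> inc S" "(c, k3) \<in> inc S" "p3 \<in> points S"
      "(p3, k3) \<in> inc S" "(p3, l) \<in> inc S" using jm[of b c] abc by auto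
    have ne: "k1 \<noteq> k2" "k1 \<noteq> k3" "k2 \<noteq> k3"
      using 1 2 3 abc(5) unfolding collinear3_def by blast+
    have "p1 \<noteq> p2" using ju[of a k1 p1 k2] 1 2 ne off by metis
    moreover have "p1 \<noteq> p3" using ju[of b k1 p1 k3] 1 3 ne off by metis
    moreover have "p2 \<noteq> p3" using ju[of c k2 p2 k3] 2 3 ne off by metis
    ultimately show T unfolding T_def using 1 2 3 by blast
  qed
  have two: T
    if abcd: "a \<in> points S" "b \<in> points S" "c \<in> points S" "d \<in> points S" "distinct [a, b, c, d]"
      "\<not> collinear3 S a c d" "\<not> collinear3 S b c d" and onl: "(a, l) \<in> inc S" "(b, l) \<in> inc S"
    for a b c d
  proof -
    obtain k p where k: "k \<in> lines S" "(c, k) \<in> inc S" "(d, k) \<in> inc S" "p \<in> points S"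
      "(p, k) \<in> inc S" "(p, l) \<in> inc S" using jm[of c d] abcd by auto
    have "p \<noteq> a" "p \<noteq> b" using k abcd(6,7) unfolding collinear3_def by blast+
    then show T unfolding T_def using k abcd onl by auto
  qed
  have quad: "has_quadrangle S" using S by (simp add: projective_plane_def)
  obtain a b c d where q: "a \<in> points S" "b \<in> points S" "c \<in> points S" "d \<in> points S"
    "distinct [a, b, c, d]" "\<not> collinear3 S a b c" "\<not> collinear3 S a b d"
    "\<not> collinear3 S a c d" "\<not> collinear3 S b c d"
    using quad unfolding has_quadrangle_def by blast
  have T
  proof -
    consider "(a, l) \<in> inc S" "(b, l) \<in> inc S" | "(a, l) \<in> inc S" "(c, l) \<in> inc S"
      | "(a, l) \<in> inc S" "(d, l) \<in> inc S" | "(b, l) \<in> inc S" "(c, l) \<in> inc S"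
      | "(b, l) \<in> inc S" "(d, l) \<in> inc S" | "(c, l) \<in> inc S" "(d, l) \<in> inc S"
      | "(a, l) \<notin> inc S" "(b, l) \<notin> inc S" "(c, l) \<notin> inc S"
      | "(a, l) \<notin> inc S" "(b, l) \<notin> inc S" "(d, l) \<notin> inc S"
      | "(a, l) \<notin> inc S" "(c, l) \<notin> inc S" "(d, l) \<notin> inc S"
      | "(b, l) \<notin> inc S" "(c, l) \<notin> inc S" "(d, l) \<notin> inc S" by blast
    then show T
    proof cases
      case 1 show T by (rule two[of a b c d]) (use q 1 in auto)
    next
      case 2 show T by (rule two[of a c b d]) (use q 2 collinear3_swap12[of S c b d] in auto)
    next
      case 3 show T
        by (rule two[of a d b c])
          (use q 3 collinear3_swap12[of S d b c] collinear3_swap23[of S b d c] in auto)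
    next
      case 4 show T
        by (rule two[of b c a d])
          (use q 4 collinear3_swap12[of S b a d] collinear3_swap12[of S c a d] in auto)
    next
      case 5 show T
        by (rule two[of b d a c])
          (use q 5 collinear3_swap12[of S b a c] collinear3_swap12[of S d a c]
            collinear3_swap23[of S a d c] in auto)
    next
      case 6 show T
        by (rule two[of c d a b])
          (use q 6 collinear3_swap12[of S c a b] collinear3_swap23[of S a c b]
            collinear3_swap12[of S d a b] collinear3_swap23[of S a d b] in auto)
    next
      case 7 show T by (rule tri[of a b c]) (use q 7 in auto)
    next
      case 8 show T by (rule tri[of a b d]) (use q 8 in auto)
    next
      case 9 show T by (rule tri[of a c d]) (use q 9 in auto)
    next
      case 10 show T by (rule tri[of b c d]) (use q 10 in auto)
    qed
  qed
  then show ?thesis unfolding T_def by metis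
qed

lemma substructure_antisym:
  fixes S T :: "('p, 'l) incidence"
  shows "substructure S T \<Longrightarrow> substructure T S \<Longrightarrow> S = T"
  by (rule incidence.equality) (auto simp: substructure_def)

text \<open>Isolates what counting in a plane needs. \<open>L_full\<close> is the characteristic
  property: ordinary lines of a plane keep all their points, while special lines, though all
  present, may lose some of theirs.\<close>

locale full_plane = projective_rectangle_order R D m n
  for R :: "('p, 'l) incidence" and D :: 'p and m n +
  fixes Q :: "'p set" and L :: "'l set"
  assumes Q_points: "Q \<subseteq> points R"
    and L_join: "\<lbrakk>x \<in> Q; y \<in> Q; x \<noteq> y; on x k; on y k\<rbrakk> \<Longrightarrow> k \<in> L"
    and L_meet: "\<lbrakk>h \<in> L; k \<in> L\<rbrakk> \<Longrightarrow> \<exists>z\<in>Q. on z h \<and> on z k"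
    and special_L: "on D s \<Longrightarrow> s \<in> L"
    and L_full: "\<lbrakk>k \<in> L; k \<in> Od; on y k\<rbrakk> \<Longrightarrow> y \<in> Q"
    and L_two: "\<exists>k1 k2. k1 \<in> L \<inter> Od \<and> k2 \<in> L \<inter> Od \<and> k1 \<noteq> k2"
begin

text \<open>If two ordinary lines of the plane both pass through \<open>p\<close>, an ordinary join
  of a further point of each is again in \<open>L\<close>; if it passed through \<open>p\<close>, it
  would equal both.\<close>

lemma ordinary_line_missing:
  assumes p: "p \<in> Q" "p \<noteq> D"
  shows "\<exists>k\<in>L \<inter> Od. \<not> on p k"
proof -
  obtain k1 k2 where k: "k1 \<in> L \<inter> Od" "k2 \<in> L \<inter> Od" "k1 \<noteq> k2" using L_two by blast
  show ?thesis
  proof (cases "on p k1 \<and> on p k2")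
    case False
    then show ?thesis using k by blast
  next
    case True
    obtain a where a: "on a k1" "a \<noteq> p" using ordinary_third_point[of k1] k by blast
    obtain b where b: "on b k2" "b \<noteq> p" "b \<noteq> meet (join D a) k2"
      using ordinary_third_point[of k2] k by blast
    have aD: "a \<in> points R" "a \<noteq> D" using ordinary_on[of k1 a] k a by auto
    have nb: "\<not> on b (join D a)"
      using meet_eqI[of b "join D a" k2] ordinary_join_special[OF aD] b k by (auto simp: Od_iff)
    note j = join_ordinary[OF aD(1) _ aD(2) nb]
    have jj: "join a b \<in> Od" "on a (join a b)" "on b (join a b)" using j b on_point by blast+
    have ab: "a \<noteq> b" using nb ordinary_join_special[OF aD] by blast
    then have "join a b \<in> L" using L_join[of a b] L_full[of k1 a] L_full[of k2 b] a b k jj by blast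
    moreover have "\<not> on p (join a b)"
    proof
      assume p: "on p (join a b)"
      have "join a b = k1" using line_eqI[of a "join a b" p k1] p jj a True by blast
      moreover have "join a b = k2" using line_eqI[of b "join a b" p k2] p jj b True by blast
      ultimately show False using k by simp
    qed
    ultimately show ?thesis using jj by blast
  qed
qed

text \<open>For an ordinary line \<open>k\<close> of the plane off \<open>p\<close>, the ordinary
  lines of the plane through \<open>p\<close> are exactly those meeting \<open>k\<close>: as
  \<open>k\<close> is full, a line through \<open>p\<close> meeting it has two points in
  \<open>Q\<close>.\<close>

lemma lines_through_card:
  assumes p: "p \<in> Q" "p \<noteq> D"
  shows "card (Th p \<inter> L) = m" "finite (Th p \<inter> L)"
proof -
  have pp: "p \<in> points R" using p Q_points by blast
  obtain k where k: "k \<in> L" "k \<in> Od" "\<not> on p k" using ordinary_line_missing[OF p] by blast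
  have "Th p \<inter> L = meeting p k"
  proof (intro equalityI subsetI)
    fix l assume "l \<in> Th p \<inter> L"
    then show "l \<in> meeting p k" using L_meet[of l k] k by (auto simp: Th_iff meeting_iff)
  next
    fix l assume l: "l \<in> meeting p k"
    then obtain q where q: "on q l" "on q k" by (auto simp: meeting_iff)
    then have "l \<in> L" using L_join[of p q l] L_full[OF k(1,2)] l p k by (auto simp: meeting_iff)
    then show "l \<in> Th p \<inter> L" using l by (simp add: meeting_def)
  qed
  then show "card (Th p \<inter> L) = m" using meeting_card[OF pp p(2) k(2,3)] by simp
  show "finite (Th p \<inter> L)" using Th_card[OF pp p(2)] by blast
qed

lemma Th_disjoint:
  assumes "p \<notin> Q"
  shows "Th p \<inter> L = {}"
  using assms L_full by (auto simp: Th_iff)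

text \<open>From a point \<open>p\<close> of the plane off \<open>s\<close>, the bijection
  \<open>Th_bij\<close> restricts to the \<open>m\<close> ordinary lines of the plane through
  \<open>p\<close> and the points of the plane on \<open>s\<close>.\<close>

lemma special_Q_card:
  assumes s: "on D s"
  shows "card ({q \<in> Q. on q s} - {D}) = m" "finite ({q \<in> Q. on q s} - {D})"
proof -
  obtain k where k: "k \<in> L" "k \<in> Od" using L_two by blast
  obtain p where p: "on p k" "p \<noteq> meet s k" using ordinary_third_point[OF k(2)] by blast
  have ps: "\<not> on p s" using meet_eqI[of p s k] p s k by (auto simp: Od_iff)
  have pp: "p \<in> points R" "p \<noteq> D" using ordinary_on[OF k(2) p(1)] by auto
  have pQ: "p \<in> Q" using L_full k p by blast
  note b = Th_bij[OF pp s ps]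
  have "meet s ` (Th p \<inter> L) = {q \<in> Q. on q s} - {D}"
  proof (intro equalityI subsetI)
    fix q assume "q \<in> meet s ` (Th p \<inter> L)"
    then obtain l where l: "l \<in> Th p" "l \<in> L" "q = meet s l" by blast
    obtain z where z: "z \<in> Q" "on z s" "on z l" using L_meet[OF special_L[OF s] l(2)] by blast
    have "s \<noteq> l" using l s by (auto simp: Th_iff Od_iff)
    then have "q = z" using meet_eqI[OF z(2,3)] l by simp
    moreover have "q \<noteq> D" using b l unfolding bij_betw_def by blast
    ultimately show "q \<in> {q \<in> Q. on q s} - {D}" using z by simp
  next
    fix q assume q: "q \<in> {q \<in> Q. on q s} - {D}"
    then obtain l where l: "l \<in> Th p" "q = meet s l" using b unfolding bij_betw_def by blast
    have "s \<noteq> l" using l s by (auto simp: Th_iff Od_iff)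
    then have "on q l" using special_meet(2)[OF s, of l] l by (auto simp: Th_iff Od_iff)
    then have "l \<in> L" using L_join[of p q l] q l pQ ps by (auto simp: Th_iff)
    then show "q \<in> meet s ` (Th p \<inter> L)" using l by blast
  qed
  moreover have "inj_on (meet s) (Th p \<inter> L)"
    using b by (auto simp: bij_betw_def intro: inj_on_subset)
  ultimately show "card ({q \<in> Q. on q s} - {D}) = m"
    using lines_through_card(1)[OF pQ pp(2)] card_image by metis
  show "finite ({q \<in> Q. on q s} - {D})"
    by (rule finite_subset[OF _ special_points(1)[OF s]]) blast
qed

lemma card_ordinary_L: "card (L \<inter> Od) = m\<^sup>2"
proof -
  obtain s where s: "on D s" using special_exists_avoiding by blast
  let ?S = "{q \<in> Q. on q s} - {D}"
  have "L \<inter> Od = (\<Union>q\<in>?S. Th q \<inter> L)"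
  proof (intro equalityI subsetI)
    fix l assume l: "l \<in> L \<inter> Od"
    then obtain z where "z \<in> Q" "on z s" "on z l" using L_meet[OF special_L[OF s]] by blast
    then show "l \<in> (\<Union>q\<in>?S. Th q \<inter> L)" using l by (auto simp: Th_iff Od_iff)
  qed (auto simp: Th_iff)
  also have "card \<dots> = (\<Sum>q\<in>?S. card (Th q \<inter> L))"
  proof (rule card_UN_disjoint)
    show "finite ?S" by (fact special_Q_card(2)[OF s])
    show "\<forall>i\<in>?S. finite (Th i \<inter> L)" using lines_through_card(2) by blast
    show "\<forall>i\<in>?S. \<forall>j\<in>?S. i \<noteq> j \<longrightarrow> Th i \<inter> L \<inter> (Th j \<inter> L) = {}"
      using Th_disjoint_special[OF s] by blast
  qed
  also have "\<dots> = (\<Sum>q\<in>?S. m)" using lines_through_card(1) by (intro sum.cong) auto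
  also have "\<dots> = m\<^sup>2" using special_Q_card(1)[OF s] by (simp add: power2_eq_square)
  finally show ?thesis .
qed

text \<open>As \<open>m < n\<close>, a special line \<open>s\<close> has a point \<open>p\<close>
  outside \<open>Q\<close>. The other \<open>m\<close> special lines carry \<open>m * m\<close>
  ordinary points of the plane, and these are joined to \<open>p\<close> by different ordinary
  lines: an ordinary line with two points in \<open>Q\<close> lies in \<open>L\<close>, is full and
  cannot contain \<open>p\<close>. Only \<open>n\<close> ordinary lines pass through
  \<open>p\<close>.\<close>

lemma square_le:
  assumes "m < n"
  shows "m\<^sup>2 \<le> n"
proof -
  obtain s where s: "on D s" using special_exists_avoiding by blast
  have "\<not> {q. on q s} - {D} \<subseteq> {q \<in> Q. on q s} - {D}"
    using card_mono[OF special_Q_card(2)[OF s], of "{q. on q s} - {D}"] special_Q_card(1)[OF s]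
      special_points(3)[OF s] assms by auto
  then obtain p where p: "on p s" "p \<noteq> D" "p \<notin> Q" by blast
  have pp: "p \<in> points R" using p on_point by blast
  have s_eq: "s = join D p" using special_eq_join s p by blast
  let ?X = "\<Union>t\<in>Sp - {s}. {q \<in> Q. on q t} - {D}"
  have "card ?X = (\<Sum>t\<in>Sp - {s}. card ({q \<in> Q. on q t} - {D}))"
  proof (rule card_UN_disjoint)
    show "finite (Sp - {s})" using finite_Sp by blast
    show "\<forall>i\<in>Sp - {s}. finite ({q \<in> Q. on q i} - {D})" using special_Q_card(2) Sp_iff by blast
    show "\<forall>i\<in>Sp - {s}. \<forall>j\<in>Sp - {s}. i \<noteq> j \<longrightarrow>
        ({q \<in> Q. on q i} - {D}) \<inter> ({q \<in> Q. on q j} - {D}) = {}"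
      using special_eq_join Sp_iff by blast
  qed
  also have "\<dots> = (\<Sum>t\<in>Sp - {s}. m)"
    using special_Q_card(1) Sp_iff by (intro sum.cong) auto
  also have "\<dots> = m\<^sup>2" using card_Sp finite_Sp s Sp_iff by (simp add: power2_eq_square)
  finally have cX: "card ?X = m\<^sup>2" .
  have J: "join p q \<in> Od" "on p (join p q)" "on q (join p q)" "q \<in> Q" if "q \<in> ?X" for q
  proof -
    obtain t where t: "on D t" "t \<noteq> s" "q \<in> Q" "on q t" "q \<noteq> D" using \<open>q \<in> ?X\<close> Sp_iff by blast
    have "\<not> on q s" using special_eq_join[of s q] special_eq_join[of t q] t s by blast
    then show "join p q \<in> Od" "on p (join p q)" "on q (join p q)" "q \<in> Q"
      using join_ordinary[OF pp _ p(2), of q] t s_eq on_point by blast+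
  qed
  have "inj_on (join p) ?X"
  proof (rule inj_onI)
    fix q q' assume q: "q \<in> ?X" "q' \<in> ?X" and eq: "join p q = join p q'"
    show "q = q'"
    proof (rule ccontr)
      assume "q \<noteq> q'"
      then have "join p q \<in> L" using L_join[of q q' "join p q"] J[OF q(1)] J[OF q(2)] eq by simp
      then show False using L_full[of "join p q" p] J[OF q(1)] p by blast
    qed
  qed
  moreover have "join p ` ?X \<subseteq> Th p" unfolding image_subset_iff Th_iff using J by blast
  ultimately have "card ?X \<le> card (Th p)" using card_inj_on_le Th_card(1)[OF pp p(2)] by blast
  then show ?thesis using cX Th_card(2)[OF pp p(2)] by simp
qed

end

section \<open>Spanned planes as maximal subplanes\<close>

context pencil
begin

definition pl :: "('p, 'l) incidence" where
  "pl = \<lparr>points = Q, lines = \<Lambda>, inc = inc R \<inter> (Q \<times> \<Lambda>)\<rparr>"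

lemma pl_sel: "points pl = Q" "lines pl = \<Lambda>" "inc pl = inc R \<inter> (Q \<times> \<Lambda>)"
  by (simp_all add: pl_def)

lemma full_plane_pl: "full_plane R D m n Q \<Lambda>"
proof unfold_locales
  show "\<exists>k1 k2. k1 \<in> \<Lambda> \<inter> Od \<and> k2 \<in> \<Lambda> \<inter> Od \<and> k1 \<noteq> k2"
    using l1_\<Lambda> l2_\<Lambda> l1 l2 l12 by blast
qed (use Q_points \<Lambda>_join \<Lambda>_meet special_\<Lambda> \<Lambda>_ordinary_points in blast)+

lemma subplane_pl: "subplane pl R"
proof -
  have "\<exists>!l. l \<in> \<Lambda> \<and> on p l \<and> on q l" if "p \<in> Q" "q \<in> Q" "p \<noteq> q" for p q
  proof (rule ex1I[of _ "join p q"])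
    have "on p (join p q)" "on q (join p q)" using join_on that Q_points by blast+
    then show "join p q \<in> \<Lambda> \<and> on p (join p q) \<and> on q (join p q)" using \<Lambda>_join that by blast
  qed (use join_eqI that in auto)
  moreover have "\<exists>!p. p \<in> Q \<and> on p l \<and> on p k" if "l \<in> \<Lambda>" "k \<in> \<Lambda>" "l \<noteq> k" for l k
  proof -
    obtain z where z: "z \<in> Q" "on z l" "on z k" using \<Lambda>_meet \<open>l \<in> \<Lambda>\<close> \<open>k \<in> \<Lambda>\<close> by blast
    show ?thesis
    proof (rule ex1I[of _ z])
      show "p = z" if "p \<in> Q \<and> on p l \<and> on p k" for p
        using line_eqI[of p l z k] z \<open>l \<noteq> k\<close> that by blast
    qed (use z in blast)
  qed
  moreover have "has_quadrangle pl"
  proof -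
    \<comment> \<open>The quadrangle consists of two points other than \<open>P\<close> on each of
      \<open>l1\<close> and \<open>l2\<close>; any three of them are two points of one line and a
      point off it.\<close>
    obtain a where a: "on a l1" "a \<noteq> P" using ordinary_third_point[OF l1] by blast
    obtain a' where a': "on a' l1" "a' \<noteq> P" "a' \<noteq> a" using ordinary_third_point[OF l1] by blast
    obtain b where b: "on b l2" "b \<noteq> P" using ordinary_third_point[OF l2] by blast
    obtain b' where b': "on b' l2" "b' \<noteq> P" "b' \<noteq> b" using ordinary_third_point[OF l2] by blast
    have n1: "\<not> on x l1" if "on x l2" "x \<noteq> P" for x using on_l1_l2 that by blast
    have n2: "\<not> on x l2" if "on x l1" "x \<noteq> P" for x using on_l1_l2 that by blast
    have c1: "\<not> collinear3 pl a a' x" if "on x l2" "x \<noteq> P" for x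
    proof
      assume "collinear3 pl a a' x"
      then obtain l where "on a l" "on a' l" "on x l" by (auto simp: collinear3_def pl_sel)
      then have "l = l1" "on x l" using line_eqI[of a l a' l1] a a' by blast+
      then show False using n1 that by blast
    qed
    have c2: "\<not> collinear3 pl x b b'" if "on x l1" "x \<noteq> P" for x
    proof
      assume "collinear3 pl x b b'"
      then obtain l where "on b l" "on b' l" "on x l" by (auto simp: collinear3_def pl_sel)
      then have "l = l2" "on x l" using line_eqI[of b l b' l2] b b' by blast+
      then show False using n2 that by blast
    qed
    have "a \<in> points pl" "a' \<in> points pl" "b \<in> points pl" "b' \<in> points pl"
      using a a' b b' l1_Q l2_Q by (auto simp: pl_sel)
    moreover have "distinct [a, a', b, b']" using a a' b b' n1 by auto
    ultimately show ?thesis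
      unfolding has_quadrangle_def using c1 c2 a a' b b' by blast
  qed
  ultimately have "projective_plane pl"
    unfolding projective_plane_def wf_incidence_def by (simp add: pl_sel cong: conj_cong)
  then show ?thesis
    using Q_points \<Lambda>_lines by (auto simp: subplane_def substructure_def pl_sel)
qed

text \<open>Lines of \<open>T\<close> off \<open>P\<close> meet \<open>l1\<close> and
  \<open>l2\<close>, hence are transversals. A point of \<open>T\<close> off \<open>l1\<close> is
  joined in \<open>T\<close> to two points of \<open>l1\<close> other than \<open>P\<close>; these
  joins are transversals, and their only common point lies in \<open>Q\<close> by
  \<open>\<Lambda>_meet\<close>.\<close>

lemma subplane_le_pl:
  assumes T: "subplane T R" "l1 \<in> lines T" "l2 \<in> lines T"
  shows "substructure T pl"
proof -
  have pp: "projective_plane T" and sub: "points T \<subseteq> points R" "lines T \<subseteq> lines R"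
    and inc: "inc T = inc R \<inter> (points T \<times> lines T)"
    using T by (auto simp: subplane_def substructure_def)
  have mt: "\<exists>p\<in>points T. on p l \<and> on p k" if "l \<in> lines T" "k \<in> lines T" "l \<noteq> k" for l k
  proof -
    have "\<exists>p. p \<in> points T \<and> (p, l) \<in> inc T \<and> (p, k) \<in> inc T"
      using pp that unfolding projective_plane_def by blast
    then show ?thesis using inc by blast
  qed
  have jn: "\<exists>l\<in>lines T. on p l \<and> on q l" if "p \<in> points T" "q \<in> points T" "p \<noteq> q" for p q
  proof -
    have "\<exists>l. l \<in> lines T \<and> (p, l) \<in> inc T \<and> (q, l) \<in> inc T"
      using pp that unfolding projective_plane_def by blast
    then show ?thesis using inc by blast
  qed
  have th: "\<exists>q\<in>points T. on q l \<and> q \<noteq> x \<and> q \<noteq> y" if "l \<in> lines T" for l x y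
    using projective_plane_third_point[OF pp that, of x y] inc by blast
  have tr: "transversal g" if "g \<in> lines T" "\<not> on P g" for g
    using mt[OF _ T(2), of g] mt[OF _ T(3), of g] that P1 P2 unfolding transversal_def by blast
  have PT: "points T \<subseteq> Q"
  proof
    fix q assume q: "q \<in> points T"
    show "q \<in> Q"
    proof (cases "on q l1")
      case True
      then show ?thesis using l1_Q by blast
    next
      case False
      obtain a where a: "a \<in> points T" "on a l1" "a \<noteq> P" using th[OF T(2)] by blast
      obtain a' where a': "a' \<in> points T" "on a' l1" "a' \<noteq> P" "a' \<noteq> a" using th[OF T(2)] by blast
      obtain k where k: "k \<in> lines T" "on q k" "on a k" using jn[OF q a(1)] False a by blast
      obtain k' where k': "k' \<in> lines T" "on q k'" "on a' k'" using jn[OF q a'(1)] False a' by blast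
      have "\<not> on P k" using line_eqI[of a k P l1] a k P1 False by blast
      then have tk: "transversal k" using tr k by blast
      have "\<not> on P k'" using line_eqI[of a' k' P l1] a' k' P1 False by blast
      then have tk': "transversal k'" using tr k' by blast
      have kk': "k \<noteq> k'" using line_eqI[of a k a' l1] a a' k k' False by blast
      obtain z where "z \<in> Q" "on z k" "on z k'"
        using \<Lambda>_meet[of k k'] tk tk' by (auto simp: \<Lambda>_def)
      then show ?thesis using line_eqI[of z k q k'] k k' kk' by blast
    qed
  qed
  have LT: "lines T \<subseteq> \<Lambda>"
  proof
    fix g assume g: "g \<in> lines T"
    show "g \<in> \<Lambda>"
    proof (cases "on P g")
      case True
      obtain q where "q \<in> points T" "on q g" "q \<noteq> P" using th[OF g] by blast
      then show ?thesis using True PT by (auto simp: \<Lambda>_def)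
    next
      case False
      then show ?thesis using tr g by (simp add: \<Lambda>_def)
    qed
  qed
  show ?thesis using PT LT inc by (auto simp: substructure_def pl_sel)
qed

lemma pl_planes: "pl \<in> planes R"
proof -
  have "T = pl" if T: "subplane T R" "substructure pl T" for T
  proof -
    have "l1 \<in> lines T" "l2 \<in> lines T"
      using T l1_\<Lambda> l2_\<Lambda> by (auto simp: substructure_def pl_sel)
    then show ?thesis using subplane_le_pl[OF T(1)] T(2) substructure_antisym by blast
  qed
  then show ?thesis using subplane_pl by (auto simp: planes_def)
qed

lemma plane_eq_pl:
  assumes S: "S \<in> planes R" "l1 \<in> lines S" "l2 \<in> lines S"
  shows "S = pl"
proof -
  have "subplane S R" using S by (simp add: planes_def)
  then have "substructure S pl" using subplane_le_pl S by blast
  then show ?thesis using S subplane_pl by (auto simp: planes_def)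
qed

end

section \<open>Planes and cliques of ordinary lines\<close>

context projective_rectangle_order
begin

lemma adj_pencil: "adj l k \<Longrightarrow> \<exists>P. pencil R D m n l k P"
  unfolding adj_def pencil_def pencil_axioms_def
  using projective_rectangle_order_axioms by blast

text \<open>A quadrangle point other than \<open>D\<close> lies on three different lines to the
  remaining points, and at most one of these is special.\<close>

lemma subplane_ordinary_lines:
  assumes S: "subplane S R"
  shows "\<exists>l k. l \<in> lines S \<and> k \<in> lines S \<and> adj l k"
proof -
  have pp: "projective_plane S" and sub: "points S \<subseteq> points R" "lines S \<subseteq> lines R"
    and inc: "inc S = inc R \<inter> (points S \<times> lines S)"
    using S by (auto simp: subplane_def substructure_def)
  have jn: "\<exists>l\<in>lines S. on p l \<and> on q l" if "p \<in> points S" "q \<in> points S" "p \<noteq> q" for p q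
  proof -
    have "\<exists>l. l \<in> lines S \<and> (p, l) \<in> inc S \<and> (q, l) \<in> inc S"
      using pp that unfolding projective_plane_def by blast
    then show ?thesis using inc by blast
  qed
  have col: "collinear3 S x y z" if "l \<in> lines S" "x \<in> points S" "y \<in> points S" "z \<in> points S"
    "on x l" "on y l" "on z l" for x y z l
    using that inc unfolding collinear3_def by blast
  have quad: "has_quadrangle S" using pp by (simp add: projective_plane_def)
  obtain a b c d where q: "a \<in> points S" "b \<in> points S" "c \<in> points S" "d \<in> points S"
    "distinct [a, b, c, d]" "\<not> collinear3 S a b c" "\<not> collinear3 S a b d"
    "\<not> collinear3 S a c d" "\<not> collinear3 S b c d"
    using quad unfolding has_quadrangle_def by blast
  have main: ?thesis if x: "x \<in> points S" "x \<noteq> D" and abc: "a \<in> points S" "b \<in> points S" "c \<in> points S"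
    "distinct [x, a, b, c]" "\<not> collinear3 S x a b" "\<not> collinear3 S x a c" "\<not> collinear3 S x b c" for x a b c
  proof -
    obtain k1 where k1: "k1 \<in> lines S" "on x k1" "on a k1" using jn[of x a] abc x by auto
    obtain k2 where k2: "k2 \<in> lines S" "on x k2" "on b k2" using jn[of x b] abc x by auto
    obtain k3 where k3: "k3 \<in> lines S" "on x k3" "on c k3" using jn[of x c] abc x by auto
    have ne: "k1 \<noteq> k2" "k1 \<noteq> k3" "k2 \<noteq> k3" using k1 k2 k3 col abc x by blast+
    have sp: "k = k'" if "on D k" "on D k'" "on x k" "on x k'" for k k'
      using line_eqI[of D k x k'] that x by blast
    have ad: "adj k k'" if "\<not> on D k" "\<not> on D k'" "on x k" "on x k'" "k \<noteq> k'" for k k'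
      using that Od_on by (auto simp: adj_def)
    consider "\<not> on D k1" "\<not> on D k2" | "\<not> on D k1" "\<not> on D k3" | "\<not> on D k2" "\<not> on D k3"
      using sp ne k1 k2 k3 by blast
    then show ?thesis using ad ne k1 k2 k3 by cases blast+
  qed
  show ?thesis
  proof (cases "a = D")
    case True
    show ?thesis
      by (rule main[of b a c d])
        (use q True collinear3_swap12[of S b a c] collinear3_swap12[of S b a d] in auto)
  next
    case False
    show ?thesis by (rule main[of a b c d]) (use q False in auto)
  qed
qed

lemma plane_full_plane:
  assumes S: "S \<in> planes R"
  shows "full_plane R D m n (points S) (lines S)"
proof -
  obtain l k where lk: "l \<in> lines S" "k \<in> lines S" "adj l k"
    using subplane_ordinary_lines S unfolding planes_def by blast
  then obtain P where "pencil R D m n l k P" using adj_pencil by blast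
  then interpret pencil R D m n l k P .
  show ?thesis using plane_eq_pl[OF S lk(1,2)] full_plane_pl by (simp add: pl_sel)
qed

lemma plane_exists_unique:
  assumes a: "adj l k"
  shows "\<exists>!S. S \<in> planes R \<and> l \<in> lines S \<and> k \<in> lines S"
proof -
  obtain P where "pencil R D m n l k P" using adj_pencil a by blast
  then interpret pencil R D m n l k P .
  show ?thesis
  proof (rule ex1I[of _ pl])
    show "pl \<in> planes R \<and> l \<in> lines pl \<and> k \<in> lines pl"
      using pl_planes l1_\<Lambda> l2_\<Lambda> by (simp add: pl_sel)
  qed (use plane_eq_pl in blast)
qed

lemma plane_lines_adj:
  assumes "S \<in> planes R" "l \<in> lines S" "k \<in> lines S" "l \<in> Od" "k \<in> Od" "l \<noteq> k"
  shows "adj l k"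
proof -
  interpret full_plane R D m n "points S" "lines S" using plane_full_plane assms by blast
  show ?thesis using L_meet[OF assms(2,3)] assms unfolding adj_def by blast
qed

text \<open>Let \<open>P\<close> be the common point of two members. A member \<open>h\<close> off
  \<open>P\<close> meets both and is therefore a transversal; every member through \<open>P\<close>
  meets \<open>h\<close> in a point of \<open>Q\<close>, so the whole clique lies in the spanned
  plane.\<close>

lemma clique_cases:
  assumes C: "C \<subseteq> Od" "\<And>l k. l \<in> C \<Longrightarrow> k \<in> C \<Longrightarrow> l \<noteq> k \<Longrightarrow> adj l k"
  shows "(\<exists>p\<in>ordinary_points R D. C \<subseteq> Th p) \<or> (\<exists>S\<in>planes R. C \<subseteq> plane_clique R D S)"
proof (cases "\<exists>l\<in>C. \<exists>k\<in>C. l \<noteq> k")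
  case False
  obtain l where l: "l \<in> Od" "C \<subseteq> {l}"
  proof (cases "C = {}")
    case True
    obtain l where "l \<in> Od" using ordinary_line_exists by blast
    then show ?thesis using that[of l] True by simp
  next
    case f: False
    then obtain l where "l \<in> C" by blast
    then show ?thesis using that[of l] False C(1) by blast
  qed
  obtain p where p: "on p l" using ordinary_third_point[OF l(1)] by blast
  have "p \<in> ordinary_points R D" using ordinary_on[OF l(1) p] by (simp add: ordinary_points_def)
  moreover have "C \<subseteq> Th p" using l p by (auto simp: Th_iff)
  ultimately show ?thesis by blast
next
  case True
  then obtain l k where lk: "l \<in> C" "k \<in> C" "l \<noteq> k" by blast
  then obtain P where pen: "pencil R D m n l k P" using adj_pencil C by blast
  then interpret pencil R D m n l k P .
  show ?thesis
  proof (cases "C \<subseteq> Th P")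
    case True
    have "P \<in> ordinary_points R D" using ordinary_on[OF l1 P1] by (simp add: ordinary_points_def)
    then show ?thesis using True by blast
  next
    case False
    then obtain h where h: "h \<in> C" "\<not> on P h" using C(1) Th_iff by blast
    have off: "transversal g" if "g \<in> C" "\<not> on P g" for g
    proof -
      have "g \<noteq> l" "g \<noteq> k" using that P1 P2 by auto
      then have "adj l g" "adj k g" using C(2) lk that by auto
      then show ?thesis using that unfolding transversal_def adj_def by blast
    qed
    have "g \<in> \<Lambda>" if g: "g \<in> C" for g
    proof (cases "on P g")
      case True
      then have "adj g h" using C(2) g h by blast
      then obtain x where x: "on x g" "on x h" by (auto simp: adj_def)
      have "x \<in> Q" using x off[OF h] h C(1) unfolding Q_def by blast
      then show ?thesis using x h True by (auto simp: \<Lambda>_def)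
    next
      case False
      then show ?thesis using off g by (simp add: \<Lambda>_def)
    qed
    then have "C \<subseteq> plane_clique R D pl" using C by (auto simp: plane_clique_def pl_sel)
    then show ?thesis using pl_planes by blast
  qed
qed

end

section \<open>The graph of lines\<close>

context projective_rectangle_order
begin

abbreviation "G \<equiv> graph_of_lines R D"

lemma G_simps: "verts G = Od" "arcs G = {(l, k). adj l k}" "tail G = fst" "head G = snd"
  "arcs_ends G = {(l, k). adj l k}"
  by (auto simp: graph_of_lines_def adj_def lines_meet_iff)

lemma dominates_G: "dominates G l k \<longleftrightarrow> adj l k"
  by (simp add: G_simps)

lemma adj_Od: "adj l k \<Longrightarrow> l \<in> Od \<and> k \<in> Od \<and> l \<noteq> k"
  by (simp add: adj_def)

lemma graph_G: "graph G"
proof unfold_locales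
  show "finite (arcs G)"
    using finite_subset[of "arcs G" "Od \<times> Od"] finite_Od adj_Od by (auto simp: G_simps)
  show "symmetric G" using adj_sym by (auto simp: symmetric_def G_simps intro: symI)
qed (use finite_Od adj_Od in \<open>auto simp: G_simps arc_to_ends_def\<close>)

lemma regular_G: "regular_graph G ((m + 1) * (n - 1))"
proof -
  have "out_degree G v = (m + 1) * (n - 1)" if "v \<in> Od" for v
  proof -
    have "out_arcs G v = Pair v ` {k. adj v k}" by (auto simp: out_arcs_def G_simps)
    then have "out_degree G v = card {k. adj v k}"
      by (simp add: out_degree_def card_image inj_on_def)
    then show ?thesis using adj_degree that by simp
  qed
  then show ?thesis using graph_G by (simp add: regular_graph_def G_simps)
qed

lemma strongly_regular_G:
  "strongly_regular G (n\<^sup>2) ((m + 1) * (n - 1)) (m * (m - 1) + n - 2) (m * (m + 1))"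
proof -
  have "common_neighbours G u v = {w. adj u w \<and> adj v w}" for u v
    using adj_Od by (auto simp: common_neighbours_def G_simps)
  then show ?thesis
    using regular_G card_Od common_adjacent common_nonadjacent
    by (auto simp: strongly_regular_def G_simps)
qed

lemma srg_adj: "srg_relation Od adj ((m + 1) * (n - 1)) (m * (m - 1) + n - 2) (m * (m + 1))"
proof -
  have "{w \<in> Od. adj u w} = {w. adj u w}" "{w \<in> Od. adj u w \<and> adj v w} = {w. adj u w \<and> adj v w}" for u v
    using adj_Od by blast+
  moreover have "\<not> adj u u" for u by (simp add: adj_def)
  ultimately show ?thesis
    using finite_Od adj_degree common_adjacent common_nonadjacent adj_sym
    unfolding srg_relation_def by auto
qed

lemma lambda_identity: "m * (m - 1) + n - 2 = n + (m + 1) * (m - 2)"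
proof -
  obtain j where "m = Suc (Suc j)" using m_ge_2 by (metis add_2_eq_Suc le_Suc_ex)
  then show ?thesis by simp
qed

text \<open>The differences \<open>k - \<tau>1 = m * n\<close>,
  \<open>k - \<tau>2 = (m + 1) * n\<close> and \<open>\<tau>1 - \<tau>2 = n\<close> do not vanish,
  so the three values are distinct even for \<open>m = n\<close>, and the multiplicities follow by
  cancellation.\<close>

lemma spectrum_G:
  assumes d: "distinct vs" and vs: "set vs = Od"
  defines "A \<equiv> adjacency_matrix G vs"
  shows "{x. eigenvalue A x} \<subseteq> {(real m + 1) * (real n - 1), real n - real m - 1, - (real m + 1)}"
    "eigenvalue_mult A ((real m + 1) * (real n - 1)) = 1"
    "eigenvalue_mult A (real n - real m - 1) = (m + 1) * (n - 1)"
    "eigenvalue_mult A (- (real m + 1)) = (n - m) * (n - 1)"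
proof -
  let ?k = "(m + 1) * (n - 1)" and ?a = "m * (m - 1) + n - 2" and ?c = "m * (m + 1)"
  let ?N = "length vs"
  let ?t1 = "real n - real m - 1" and ?t2 = "- (real m + 1)"
  have "?N = n * n" using distinct_card[OF d] vs card_Od by (simp add: power2_eq_square)
  then have N: "real ?N = real n * real n" by simp
  have srg: "srg_relation {0..<?N} (\<lambda>i j. adj (vs ! i) (vs ! j)) ?k ?a ?c"
    using srg_relation_nth[OF _ d] srg_adj vs by metis
  have A: "A \<in> carrier_mat ?N ?N" "\<And>i j. i < ?N \<Longrightarrow> j < ?N \<Longrightarrow> A $$ (i, j) = of_bool (adj (vs ! i) (vs ! j))"
    by (auto simp: A_def adjacency_matrix_def dominates_G)
  have k: "real ?k = (real m + 1) * (real n - 1)"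
  proof -
    have "real (n - 1) = real n - 1" using n_ge_2 by (simp add: of_nat_diff)
    then show ?thesis by (simp only: of_nat_mult of_nat_add of_nat_1)
  qed
  have a: "real ?a = real m * (real m - 1) + real n - 2"
    using n_ge_2 m_ge_2 by (simp add: of_nat_diff)
  have m0: "real m > 0" and n0: "real n > 0" using m_ge_2 n_ge_2 by auto
  have d1: "real ?k - ?t1 = real m * real n" and d2: "real ?k - ?t2 = (real m + 1) * real n"
    and d3: "?t1 - ?t2 = real n"
    unfolding k by (simp_all add: algebra_simps)
  have ne: "real ?k \<noteq> ?t1" "real ?k \<noteq> ?t2" "?t1 \<noteq> ?t2"
  proof -
    have "real ?k - ?t1 > 0" unfolding d1 using m0 n0 by simp
    then show "real ?k \<noteq> ?t1" by linarith
    have "real ?k - ?t2 > 0" unfolding d2 using m0 n0 by simp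
    then show "real ?k \<noteq> ?t2" by linarith
    show "?t1 \<noteq> ?t2" using d3 n0 by linarith
  qed
  have t: "?t1 + ?t2 = real ?a - real ?c" "?t1 * ?t2 = real ?c - real ?k"
    unfolding k a by (simp_all add: algebra_simps)
  note sp = srg_spectrum[OF srg A t ne]
  show "{x. eigenvalue A x} \<subseteq> {(real m + 1) * (real n - 1), ?t1, ?t2}"
    using sp(1) unfolding k .
  have "real (eigenvalue_mult A (real ?k)) * (real m * real n) * ((real m + 1) * real n)
    = real n * real n * (real ?k + ?t1 * ?t2)"
    using sp(2) unfolding d1 d2 N .
  also have "\<dots> = 1 * (real m * real n) * ((real m + 1) * real n)"
    unfolding k by (simp add: algebra_simps)
  finally have "real (eigenvalue_mult A (real ?k)) = 1"
    using m0 n0 by (simp add: mult.assoc)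
  then show "eigenvalue_mult A ((real m + 1) * (real n - 1)) = 1" unfolding k by simp
  have d4: "?t1 - real ?k = - (real m * real n)" "?t2 - real ?k = - ((real m + 1) * real n)"
    "?t2 - ?t1 = - real n"
    using arg_cong[OF d1, of uminus] arg_cong[OF d2, of uminus] arg_cong[OF d3, of uminus]
    unfolding minus_diff_eq by blast+
  have "real (eigenvalue_mult A ?t1) * (- (real m * real n)) * real n
    = real n * real n * (real ?k + real ?k * ?t2)"
    using sp(3) unfolding d4 d3 N .
  also have "\<dots> = real ?k * (- (real m * real n)) * real n"
    unfolding k by (simp add: algebra_simps)
  finally have "real (eigenvalue_mult A ?t1) = real ?k"
    using m0 n0 by (simp add: mult.assoc)
  then show "eigenvalue_mult A ?t1 = ?k" by (simp only: of_nat_eq_iff)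
  have "real (eigenvalue_mult A ?t2) * (- ((real m + 1) * real n)) * (- real n)
    = real n * real n * (real ?k + real ?k * ?t1)"
    using sp(4) unfolding d4 N .
  also have "\<dots> = (real n - real m) * (real n - 1) * (- ((real m + 1) * real n)) * (- real n)"
    unfolding k by (simp add: algebra_simps)
  finally have "real (eigenvalue_mult A ?t2) = (real n - real m) * (real n - 1)"
    using m0 n0 by (simp add: mult.assoc)
  also have "\<dots> = real ((n - m) * (n - 1))" using m_le_n n_ge_2 by (simp add: of_nat_diff)
  finally show "eigenvalue_mult A ?t2 = (n - m) * (n - 1)" by (simp only: of_nat_eq_iff)
qed

text \<open>Among the axioms of a projective plane, only the intersection of two ordinary lines can
  fail in a projective rectangle; (A5) covers all pairs with a special line.\<close>

lemma nontrivial_nonadjacent: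
  assumes "\<not> trivial_rectangle R"
  shows "\<exists>l k. l \<in> Od \<and> k \<in> Od \<and> l \<noteq> k \<and> \<not> adj l k"
proof (rule ccontr)
  assume all: "\<not> ?thesis"
  have mt: "\<exists>p. on p l \<and> on p k" if lk: "l \<in> lines R" "k \<in> lines R" "l \<noteq> k" for l k
  proof -
    consider "on D l" | "on D k" | "l \<in> Od" "k \<in> Od" 
      using Od_iff[of l] Od_iff[of k] lk(1,2) by blast
    then show ?thesis
    proof cases
      case 1
      show ?thesis using special_meet[OF 1 lk(2) lk(3)[symmetric]] by (intro exI[of _ "meet l k"] conjI)
    next
      case 2
      show ?thesis using special_meet[OF 2 lk(1,3)] by (intro exI[of _ "meet k l"] conjI)
    next
      case 3
      then have "adj l k" using all lk by blast
      then show ?thesis by (simp add: adj_def)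
    qed
  qed
  have mu: "\<exists>!p. p \<in> points R \<and> on p l \<and> on p k" if lk: "l \<in> lines R" "k \<in> lines R" "l \<noteq> k" for l k
  proof -
    obtain p where p: "on p l" "on p k" using mt lk by blast
    show ?thesis
    proof (rule ex1I[of _ p])
      show "q = p" if "q \<in> points R \<and> on q l \<and> on q k" for q
        using line_eqI[of q l p k] p lk that by blast
    qed (use p on_point in blast)
  qed
  have "projective_plane R"
    unfolding projective_plane_def using wf A1 A2 mu by simp
  then show False using assms by (simp add: trivial_rectangle_def)
qed

lemma trivial_adjacent:
  assumes "trivial_rectangle R" "l \<in> Od" "k \<in> Od" "l \<noteq> k"
  shows "adj l k"
proof -
  have "\<exists>p. p \<in> points R \<and> on p l \<and> on p k"
    using assms unfolding trivial_rectangle_def projective_plane_def Od_iff by blast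
  then show ?thesis using assms by (auto simp: adj_def)
qed

lemma nonadjacent_common:
  assumes "u \<in> Od" "v \<in> Od" "u \<noteq> v" "\<not> adj u v"
  shows "\<exists>w. adj u w \<and> adj w v"
proof -
  have "card {w. adj u w \<and> adj v w} > 0" using common_nonadjacent[OF assms] m_ge_2 by simp
  then have "{w. adj u w \<and> adj v w} \<noteq> {}" using card_gt_0_iff by blast
  then show ?thesis using adj_sym by blast
qed

lemma diameter_G:
  assumes "\<not> trivial_rectangle R"
  shows "graph_diameter G = 2"
proof -
  interpret graph G by (rule graph_G)
  have cost: "awalk_cost (\<lambda>_. 1) p = real (length p)" for p :: "('l \<times> 'l) list"
    by (induction p) auto
  have up: "\<mu> (\<lambda>_. 1) u v \<le> 2" if uv: "u \<in> Od" "v \<in> Od" for u v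
  proof -
    have "\<exists>p. awalk u p v \<and> length p \<le> 2"
    proof -
      consider "u = v" | "adj u v" | w where "adj u w" "adj w v"
        using nonadjacent_common uv by blast
      then show ?thesis
      proof cases
        case 1
        then show ?thesis using uv by (intro exI[of _ "[]"]) (auto simp: awalk_Nil_iff G_simps)
      next
        case 2
        then show ?thesis
          using uv by (intro exI[of _ "[(u, v)]"]) (auto simp: awalk_Nil_iff awalk_Cons_iff G_simps)
      next
        case 3
        then show ?thesis
          using uv by (intro exI[of _ "[(u, w), (w, v)]"])
            (auto simp: awalk_Nil_iff awalk_Cons_iff G_simps)
      qed
    qed
    then obtain p where p: "awalk u p v" "length p \<le> 2" by blast
    have "\<mu> (\<lambda>_. 1) u v \<le> ereal (awalk_cost (\<lambda>_. 1) p)" by (rule min_cost_le_walk_cost[OF p(1)])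
    also have "\<dots> \<le> ereal 2" using p(2) by (simp add: cost)
    finally show ?thesis by simp
  qed
  obtain u v where uv: "u \<in> Od" "v \<in> Od" "u \<noteq> v" "\<not> adj u v"
    using nontrivial_nonadjacent[OF assms] by blast
  have low: "2 \<le> \<mu> (\<lambda>_. 1) u v"
    unfolding \<mu>_def
  proof (rule INF_greatest)
    fix p assume "p \<in> {p. awalk u p v}"
    then have "awalk u p v" by simp
    then have "length p \<noteq> 0" "length p \<noteq> 1"
      using uv by (auto simp: awalk_Nil_iff awalk_Cons_iff G_simps length_Suc_conv)
    then have "2 \<le> length p" by linarith
    then have "ereal 2 \<le> ereal (awalk_cost (\<lambda>_. 1) p)" by (simp add: cost)
    then show "2 \<le> ereal (awalk_cost (\<lambda>_. 1) p)" by simp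
  qed
  show ?thesis unfolding graph_diameter_def
  proof (rule antisym)
    show "(SUP u\<in>verts G. SUP v\<in>verts G. \<mu> (\<lambda>_. 1) u v) \<le> 2"
      using up by (intro SUP_least) (auto simp: G_simps)
    show "2 \<le> (SUP u\<in>verts G. SUP v\<in>verts G. \<mu> (\<lambda>_. 1) u v)"
      using low uv by (intro SUP_upper2[of u] SUP_upper2[of v]) (auto simp: G_simps)
  qed
qed

lemma complete_G:
  assumes "trivial_rectangle R"
  shows "complete_digraph (card (verts G)) G"
proof -
  have "adj l k \<longleftrightarrow> l \<in> Od \<and> k \<in> Od \<and> l \<noteq> k" for l k
    using trivial_adjacent[OF assms] adj_Od by blast
  then show ?thesis using graph_G by (simp add: complete_digraph_def G_simps mem_Times_iff)
qed

text \<open>\<open>adj\<close> is symmetric, so the symmetric closure adds no arcs. The condition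
  \<open>W \<noteq> {}\<close> makes the empty graph count as disconnected.\<close>

lemma connected_restrict_iff:
  "Digraph_Component.connected (G \<restriction> W) \<longleftrightarrow>
    W \<noteq> {} \<and> (\<forall>u\<in>W. \<forall>v\<in>W. (u, v) \<in> rtrancl_on W {(l, k). adj l k \<and> l \<in> W \<and> k \<in> W})"
proof -
  have "parcs (mk_symmetric (G \<restriction> W)) = {(l, k). adj l k \<and> l \<in> W \<and> k \<in> W}"
    using adj_sym by (auto simp: parcs_mk_symmetric G_simps) blast
  then show ?thesis
    by (simp add: Digraph_Component.connected_def strongly_connected_def reachable_def)
qed

lemma separator_bound:
  assumes S: "S \<subseteq> Od" and dis: "\<not> Digraph_Component.connected (G \<restriction> (Od - S))"
  shows "(m + 1) * (n - 1) \<le> card S"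
proof (cases "Od - S = {}")
  \<comment> \<open>The empty graph counts as disconnected, so \<open>S\<close> may consist of all
    ordinary lines; it then contains a whole neighbourhood.\<close>
  case True
  obtain l where l: "l \<in> Od" using ordinary_line_exists by blast
  have "card {k. adj l k} \<le> card S"
    using True S finite_subset[OF S finite_Od] adj_Od by (intro card_mono) auto
  then show ?thesis using adj_degree[OF l] by simp
next
  case False
  define W where "W = Od - S"
  define r where "r = {(l, k). adj l k \<and> l \<in> W \<and> k \<in> W}"
  obtain u v where uv: "u \<in> W" "v \<in> W" "(u, v) \<notin> rtrancl_on W r"
    using dis False unfolding connected_restrict_iff W_def r_def by blast
  define A where "A = {w \<in> W. (u, w) \<in> rtrancl_on W r}"
  define B where "B = W - A"
  have uA: "u \<in> A" using uv by (auto simp: A_def)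
  have vB: "v \<in> B" using uv by (auto simp: A_def B_def)
  have sep: "\<not> adj x y" if "x \<in> A" "y \<in> B" for x y
  proof
    assume "adj x y"
    then have "(x, y) \<in> r" "y \<in> W" using that by (auto simp: r_def A_def B_def)
    then have "(u, y) \<in> rtrancl_on W r"
      using that rtrancl_on_into_rtrancl_on[of u x W r y] by (auto simp: A_def)
    then show False using that by (auto simp: A_def B_def)
  qed
  have uO: "u \<in> Od" "v \<in> Od" "u \<noteq> v" "\<not> adj u v" using uv uA vB sep by (auto simp: W_def A_def B_def)
  have mn: "m < n" using m_less_n[OF uO] .
  \<comment> \<open>This is the flow through a private neighbour. It agrees with the bound of
    \<open>card_common_avoiding_le\<close>, and \<open>m < n\<close> makes it positive.\<close>
  have kap: "(m + 1) * (n - 1) - 1 - (m * (m - 1) + n - 2) = m * (n - m)"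
  proof -
    obtain d where d: "n = m + Suc d" using mn less_imp_Suc_add by auto
    obtain j where j: "m = Suc (Suc j)" using m_ge_2 by (metis add_2_eq_Suc le_Suc_ex)
    show ?thesis unfolding d unfolding j by (simp add: algebra_simps)
  qed
  show ?thesis
  proof (rule srg_separator_bound[OF srg_adj, where A = A and B = B and u = u and v = v])
    show "Od = A \<union> B \<union> S" "A \<inter> B = {}" "A \<inter> S = {}" "B \<inter> S = {}"
      using S by (auto simp: A_def B_def W_def)
    show "u \<in> A" "v \<in> B" by fact+
    show "\<not> adj x y" if "x \<in> A" "y \<in> B" for x y using sep that .
    show "card {w \<in> Od. adj z w \<and> adj u w \<and> \<not> adj v w} \<le> (m + 1) * (n - 1) - 1 - (m * (m - 1) + n - 2)"
      if z: "z \<in> Od" "z \<noteq> u" "z \<noteq> v" "\<not> adj z u" "\<not> adj z v" for z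
    proof -
      have "{w \<in> Od. adj z w \<and> adj u w \<and> \<not> adj v w} = {w. adj z w \<and> adj u w \<and> \<not> adj v w \<and> w \<noteq> v}"
        using uO adj_Od by auto
      then show ?thesis
        unfolding kap using card_common_avoiding_le[OF z(1) uO(1,2) z(2,4,3,5)] by simp
    qed
    show "0 < (m + 1) * (n - 1) - 1 - (m * (m - 1) + n - 2)"
      unfolding kap using mn m_ge_2 by simp
  qed
qed

lemma connectivity_G: "vertex_connectivity G = (m + 1) * (n - 1)"
  unfolding vertex_connectivity_def G_simps(1)
proof (rule Least_equality)
  obtain u where u: "u \<in> Od" using ordinary_line_exists by blast
  \<comment> \<open>Removing the neighbourhood of \<open>u\<close> isolates \<open>u\<close>; if no
    other line is left, the alternative of a single vertex applies.\<close>
  let ?S = "{k. adj u k}"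
  have S: "?S \<subseteq> Od" "finite ?S" "card ?S = (m + 1) * (n - 1)"
    using adj_Od finite_adj[of u "\<lambda>_. True"] adj_degree[OF u] by auto
  have "\<not> Digraph_Component.connected (G \<restriction> (Od - ?S)) \<or> card (Od - ?S) = 1"
  proof (cases "Od - ?S = {u}")
    case False
    have "u \<in> Od - ?S" using u adj_Od by blast
    then obtain v where v: "v \<in> Od - ?S" "v \<noteq> u" using False by blast
    let ?W = "Od - ?S"
    have "(u, v) \<notin> rtrancl_on ?W {(l, k). adj l k \<and> l \<in> ?W \<and> k \<in> ?W}"
    proof
      assume "(u, v) \<in> rtrancl_on ?W {(l, k). adj l k \<and> l \<in> ?W \<and> k \<in> ?W}"
      then show False by (cases rule: converse_rtrancl_on_cases) (use v in auto)
    qed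
    then show ?thesis unfolding connected_restrict_iff using v \<open>u \<in> Od - ?S\<close> by blast
  qed simp
  then show "\<exists>S\<subseteq>Od. finite S \<and> card S = (m + 1) * (n - 1) \<and>
      (\<not> Digraph_Component.connected (G \<restriction> (Od - S)) \<or> card (Od - S) = 1)"
    using S by blast
next
  fix y assume "\<exists>S\<subseteq>Od. finite S \<and> card S = y \<and>
      (\<not> Digraph_Component.connected (G \<restriction> (Od - S)) \<or> card (Od - S) = 1)"
  then obtain S where S: "S \<subseteq> Od" "card S = y"
    "\<not> Digraph_Component.connected (G \<restriction> (Od - S)) \<or> card (Od - S) = 1" by blast
  show "(m + 1) * (n - 1) \<le> y"
  proof (cases "card (Od - S) = 1")
    case True
    then obtain u where u: "Od - S = {u}" using card_1_singletonE by blast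
    have "{k. adj u k} \<subseteq> S"
    proof
      fix k assume "k \<in> {k. adj u k}"
      then have "k \<in> Od" "k \<noteq> u" using adj_Od by blast+
      then show "k \<in> S" using u by blast
    qed
    then have "card {k. adj u k} \<le> card S"
      using finite_subset[OF S(1) finite_Od] by (intro card_mono)
    moreover have "u \<in> Od" using u by blast
    ultimately show ?thesis using adj_degree[of u] S by simp
  next
    case False
    then show ?thesis using separator_bound S by blast
  qed
qed

end

section \<open>Cliques of the graph of lines\<close>

lemma card_ge_2_obtain:
  assumes "2 \<le> card X"
  obtains x y where "x \<in> X" "y \<in> X" "x \<noteq> y"
proof -
  have "\<not> (\<forall>x\<in>X. \<forall>y\<in>X. x = y)"
    using assms card_le_Suc0_iff_eq[of X] card_ge_0_finite[of X] by auto
  then show ?thesis using that by blast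
qed

context projective_rectangle_order
begin

abbreviation "Pl S \<equiv> plane_clique R D S"

lemma Pl_iff: "l \<in> Pl S \<longleftrightarrow> l \<in> Od \<and> l \<in> lines S"
  by (simp add: plane_clique_def)

lemma ordinary_points_iff: "p \<in> ordinary_points R D \<longleftrightarrow> p \<in> points R \<and> p \<noteq> D"
  by (auto simp: ordinary_points_def)

lemma graph_clique_G: "graph_clique G C \<longleftrightarrow> C \<subseteq> Od \<and> (\<forall>l\<in>C. \<forall>k\<in>C. l \<noteq> k \<longrightarrow> adj l k)"
  by (simp add: graph_clique_def G_simps)

lemma Th_clique: "graph_clique G (Th p)"
  by (auto simp: graph_clique_G Th_iff adj_def)

lemma Pl_clique: "S \<in> planes R \<Longrightarrow> graph_clique G (Pl S)"
  using plane_lines_adj by (auto simp: graph_clique_G Pl_iff)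

lemma card_Pl: "S \<in> planes R \<Longrightarrow> card (Pl S) = m\<^sup>2"
  using full_plane.card_ordinary_L[OF plane_full_plane] by (simp add: plane_clique_def Int_commute)

lemma m_square_ge: "2 \<le> m\<^sup>2" "m < m\<^sup>2"
proof -
  have "2 * m \<le> m * m" using m_ge_2 by (intro mult_le_mono1)
  then show "2 \<le> m\<^sup>2" "m < m\<^sup>2" using m_ge_2 unfolding power2_eq_square by linarith+
qed

lemma Pl_shared_line:
  assumes S: "S \<in> planes R" "S' \<in> planes R" "S \<noteq> S'" and lk: "l \<in> Pl S \<inter> Pl S'" "k \<in> Pl S \<inter> Pl S'"
  shows "l = k"
proof (rule ccontr)
  assume "l \<noteq> k"
  then have "adj l k" using plane_lines_adj[of S l k] S lk by (auto simp: Pl_iff)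
  then show False using plane_exists_unique[of l k] S lk unfolding Int_iff Pl_iff by blast
qed

text \<open>A plane clique has at least two members, and two of its lines lie together in only one
  plane.\<close>

lemma Pl_subset:
  assumes S: "S \<in> planes R" "S' \<in> planes R" "Pl S \<subseteq> Pl S'"
  shows "S = S'"
proof (rule ccontr)
  assume ne: "S \<noteq> S'"
  obtain l k where "l \<in> Pl S" "k \<in> Pl S" "l \<noteq> k"
    using card_ge_2_obtain[of "Pl S"] card_Pl[OF S(1)] m_square_ge by metis
  then show False using Pl_shared_line[OF S(1,2) ne, of l k] S(3) by blast
qed

lemma Th_subset:
  assumes p: "p \<in> ordinary_points R D" "q \<in> ordinary_points R D" "Th p \<subseteq> Th q"
  shows "p = q"
proof (rule ccontr)
  assume ne: "p \<noteq> q"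
  obtain l k where "l \<in> Th p" "k \<in> Th p" "l \<noteq> k"
    using card_ge_2_obtain[of "Th p"] Th_card[of p] p n_ge_2 ordinary_points_iff by metis
  then show False using Th_Int[OF ne, of l k] p(3) by blast
qed

lemma inj_Pl: "inj_on Pl (planes R)"
  by (rule inj_onI) (use Pl_subset in blast)

lemma inj_Th: "inj_on (\<lambda>p. Th p) (ordinary_points R D)"
  by (rule inj_onI) (use Th_subset in blast)

text \<open>Ordinary lines of a plane are full, so a point outside the plane lies on none of them;
  an ordinary point inside lies on \<open>m\<close>.\<close>

lemma Pl_Th:
  assumes S: "S \<in> planes R" and p: "p \<in> ordinary_points R D"
  shows "Pl S \<inter> Th p = {} \<or> card (Pl S \<inter> Th p) = m"
proof -
  interpret full_plane R D m n "points S" "lines S" using plane_full_plane S by blast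
  have eq: "Pl S \<inter> Th p = Th p \<inter> lines S" by (auto simp: Pl_iff Th_iff)
  show ?thesis
    unfolding eq using Th_disjoint[of p] lines_through_card(1)[of p] p
    by (cases "p \<in> points S") (auto simp: ordinary_points_iff)
qed

lemma Pl_not_subset_Th:
  assumes S: "S \<in> planes R" and p: "p \<in> ordinary_points R D"
  shows "\<not> Pl S \<subseteq> Th p"
proof
  assume "Pl S \<subseteq> Th p"
  then have "Pl S \<inter> Th p = Pl S" by blast
  then show False using Pl_Th[OF S p] card_Pl[OF S] m_square_ge by auto
qed

lemma Th_not_subset_Pl:
  assumes "m < n" and S: "S \<in> planes R" and p: "p \<in> ordinary_points R D"
  shows "\<not> Th p \<subseteq> Pl S"
proof
  assume "Th p \<subseteq> Pl S"
  then have "Pl S \<inter> Th p = Th p" by blast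
  then show False using Pl_Th[OF S p] Th_card[of p] p assms(1) by (auto simp: ordinary_points_iff)
qed

lemma clique_subset:
  assumes "graph_clique G C"
  shows "(\<exists>p\<in>ordinary_points R D. C \<subseteq> Th p) \<or> (\<exists>S\<in>planes R. C \<subseteq> Pl S)"
  using clique_cases assms unfolding graph_clique_G by blast

text \<open>As every clique is contained in one of the two kinds, it remains to exclude proper
  inclusions between these. Only the inclusion of a point clique in a plane clique requires
  \<open>m < n\<close>: they share at most \<open>m\<close> of its \<open>n\<close> lines.\<close>

lemma maximal_cliques_G:
  assumes mn: "m < n"
  shows "maximal_cliques G = plane_cliques R D \<union> point_cliques R D"
proof (intro equalityI subsetI)
  fix C assume "C \<in> maximal_cliques G"
  then have C: "graph_clique G C" "\<And>C'. graph_clique G C' \<Longrightarrow> C \<subseteq> C' \<Longrightarrow> C' = C"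
    by (auto simp: maximal_cliques_def)
  show "C \<in> plane_cliques R D \<union> point_cliques R D"
    using clique_subset[OF C(1)]
  proof
    assume "\<exists>p\<in>ordinary_points R D. C \<subseteq> Th p"
    then obtain p where p: "p \<in> ordinary_points R D" "C \<subseteq> Th p" by blast
    then have "Th p = C" using C(2)[OF Th_clique] by blast
    then show ?thesis using p by (auto simp: point_cliques_def)
  next
    assume "\<exists>S\<in>planes R. C \<subseteq> Pl S"
    then obtain S where S: "S \<in> planes R" "C \<subseteq> Pl S" by blast
    then have "Pl S = C" using C(2)[OF Pl_clique] by blast
    then show ?thesis using S by (auto simp: plane_cliques_def)
  qed
next
  fix C assume "C \<in> plane_cliques R D \<union> point_cliques R D"
  then consider S where "S \<in> planes R" "C = Pl S" | p where "p \<in> ordinary_points R D" "C = Th p"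
    by (auto simp: plane_cliques_def point_cliques_def)
  then show "C \<in> maximal_cliques G"
  proof cases
    case 1
    have "C' = C" if C': "graph_clique G C'" "C \<subseteq> C'" for C'
      using clique_subset[OF C'(1)]
    proof
      assume "\<exists>p\<in>ordinary_points R D. C' \<subseteq> Th p"
      then show ?thesis using Pl_not_subset_Th[OF 1(1)] 1(2) C'(2) by blast
    next
      assume "\<exists>T\<in>planes R. C' \<subseteq> Pl T"
      then obtain T where T: "T \<in> planes R" "C' \<subseteq> Pl T" by blast
      then have "S = T" using Pl_subset[OF 1(1), of T] 1(2) C'(2) by blast
      then show ?thesis using T 1 C' by blast
    qed
    then show ?thesis using Pl_clique[OF 1(1)] 1(2) by (auto simp: maximal_cliques_def)
  next
    case 2
    have "C' = C" if C': "graph_clique G C'" "C \<subseteq> C'" for C'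
      using clique_subset[OF C'(1)]
    proof
      assume "\<exists>q\<in>ordinary_points R D. C' \<subseteq> Th q"
      then obtain q where q: "q \<in> ordinary_points R D" "C' \<subseteq> Th q" by blast
      then have "p = q" using Th_subset[OF 2(1), of q] 2(2) C'(2) by blast
      then show ?thesis using q 2 C' by blast
    next
      assume "\<exists>T\<in>planes R. C' \<subseteq> Pl T"
      then show ?thesis using Th_not_subset_Pl[OF mn _ 2(1)] 2(2) C'(2) by blast
    qed
    then show ?thesis using Th_clique 2(2) by (auto simp: maximal_cliques_def)
  qed
qed

section \<open>Numbers of cliques and their intersections\<close>

lemma card_ordinary_points: "finite (ordinary_points R D)" "card (ordinary_points R D) = (m + 1) * n"
proof -
  have eq: "ordinary_points R D = (\<Union>s\<in>Sp. {p. on p s} - {D})"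
  proof (intro equalityI subsetI)
    fix p assume "p \<in> ordinary_points R D"
    then have "p \<in> points R" "p \<noteq> D" by (auto simp: ordinary_points_iff)
    then show "p \<in> (\<Union>s\<in>Sp. {p. on p s} - {D})"
      using ordinary_join_special[of p] Sp_iff by blast
  next
    fix p assume "p \<in> (\<Union>s\<in>Sp. {p. on p s} - {D})"
    then show "p \<in> ordinary_points R D" using on_point ordinary_points_iff by blast
  qed
  have f: "finite ({p. on p s} - {D})" "card ({p. on p s} - {D}) = n" if "s \<in> Sp" for s
    using special_points[of s] that Sp_iff by auto
  show "finite (ordinary_points R D)" unfolding eq using finite_Sp f(1) by (rule finite_UN_I)
  have "card (ordinary_points R D) = (\<Sum>s\<in>Sp. card ({p. on p s} - {D}))"
    unfolding eq
  proof (rule card_UN_disjoint)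
    show "\<forall>i\<in>Sp. \<forall>j\<in>Sp. i \<noteq> j \<longrightarrow> ({p. on p i} - {D}) \<inter> ({p. on p j} - {D}) = {}"
      using special_eq_join Sp_iff by blast
  qed (use finite_Sp f in blast)+
  then show "card (ordinary_points R D) = (m + 1) * n" using f(2) card_Sp by simp
qed

lemma card_point_cliques: "card (point_cliques R D) = (m + 1) * n"
  unfolding point_cliques_def using card_image[OF inj_Th] card_ordinary_points(2) by simp

lemma point_cliques_through:
  assumes v: "v \<in> Od"
  shows "card {C \<in> point_cliques R D. v \<in> C} = m + 1"
proof -
  have "{C \<in> point_cliques R D. v \<in> C} = (\<lambda>p. Th p) ` {p. on p v}"
    using ordinary_on[OF v] v by (auto simp: point_cliques_def Th_iff ordinary_points_iff)
  moreover have "inj_on (\<lambda>p. Th p) {p. on p v}"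
    by (rule inj_on_subset[OF inj_Th]) (use ordinary_on[OF v] in \<open>auto simp: ordinary_points_iff\<close>)
  ultimately show ?thesis using ordinary_points(2)[OF v] by (simp add: card_image)
qed

lemma unique_point_clique:
  assumes "adj u v"
  shows "\<exists>!C. C \<in> point_cliques R D \<and> u \<in> C \<and> v \<in> C"
proof -
  have uv: "u \<in> Od" "v \<in> Od" "u \<noteq> v" using assms by (auto simp: adj_def)
  obtain p where p: "on p u" "on p v" using assms by (auto simp: adj_def)
  show ?thesis
  proof (rule ex1I[of _ "Th p"])
    show "Th p \<in> point_cliques R D \<and> u \<in> Th p \<and> v \<in> Th p"
      using p uv ordinary_on[OF uv(1) p(1)] by (auto simp: point_cliques_def Th_iff ordinary_points_iff)
    fix C assume "C \<in> point_cliques R D \<and> u \<in> C \<and> v \<in> C"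
    then obtain q where q: "C = Th q" "on q u" "on q v" by (auto simp: point_cliques_def Th_iff)
    then have "q = p" using line_eqI[of p u q v] p uv by blast
    then show "C = Th p" using q by simp
  qed
qed

lemma unique_plane_clique:
  assumes "adj u v"
  shows "\<exists>!C. C \<in> plane_cliques R D \<and> u \<in> C \<and> v \<in> C"
proof -
  have uv: "u \<in> Od" "v \<in> Od" using assms by (auto simp: adj_def)
  obtain S where S: "S \<in> planes R" "u \<in> lines S" "v \<in> lines S"
    and un: "\<And>T. T \<in> planes R \<Longrightarrow> u \<in> lines T \<Longrightarrow> v \<in> lines T \<Longrightarrow> T = S"
    using plane_exists_unique[OF assms] by blast
  show ?thesis
  proof (rule ex1I[of _ "Pl S"])
    show "Pl S \<in> plane_cliques R D \<and> u \<in> Pl S \<and> v \<in> Pl S"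
      using S uv by (auto simp: plane_cliques_def Pl_iff)
    fix C assume "C \<in> plane_cliques R D \<and> u \<in> C \<and> v \<in> C"
    then obtain T where T: "C = Pl T" "T \<in> planes R" "u \<in> lines T" "v \<in> lines T"
      by (auto simp: plane_cliques_def Pl_iff)
    then show "C = Pl S" using un by blast
  qed
qed

lemma plane_cliques_inter:
  assumes C: "C \<in> plane_cliques R D" "C' \<in> plane_cliques R D" "C \<noteq> C'"
  shows "card (C \<inter> C') \<le> 1"
proof -
  obtain S S' where S: "S \<in> planes R" "S' \<in> planes R" "C = Pl S" "C' = Pl S'"
    using C by (auto simp: plane_cliques_def)
  then have "S \<noteq> S'" using C by blast
  note sh = Pl_shared_line[OF S(1,2) this]
  show ?thesis
  proof (rule ccontr)
    assume "\<not> ?thesis"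
    then have "2 \<le> card (C \<inter> C')" by simp
    then obtain l k where "l \<in> C \<inter> C'" "k \<in> C \<inter> C'" "l \<noteq> k" by (rule card_ge_2_obtain)
    then show False using sh[of l k] S by simp
  qed
qed

lemma point_cliques_inter:
  assumes C: "C \<in> point_cliques R D" "C' \<in> point_cliques R D" "C \<noteq> C'"
  shows "card (C \<inter> C') \<le> 1"
proof -
  obtain p q where p: "C = Th p" "C' = Th q" using C by (auto simp: point_cliques_def)
  then have "p \<noteq> q" using C by blast
  note sh = Th_Int[OF this]
  show ?thesis
  proof (rule ccontr)
    assume "\<not> ?thesis"
    then have "2 \<le> card (C \<inter> C')" by simp
    then obtain l k where "l \<in> C \<inter> C'" "k \<in> C \<inter> C'" "l \<noteq> k" by (rule card_ge_2_obtain)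
    then show False using sh[of l k] p by simp
  qed
qed

lemma plane_cliques_Pow: "plane_cliques R D \<subseteq> Pow Od"
  by (auto simp: plane_cliques_def Pl_iff)

lemma finite_plane_cliques: "finite (plane_cliques R D)"
  using finite_subset[OF plane_cliques_Pow] finite_Od by simp

lemma plane_cliques_adj:
  assumes "C \<in> plane_cliques R D" "l \<in> C" "k \<in> C" "l \<noteq> k"
  shows "adj l k"
  using assms Pl_clique unfolding plane_cliques_def graph_clique_G by blast

lemma plane_cliques_card: "C \<in> plane_cliques R D \<Longrightarrow> card C = m\<^sup>2"
  using card_Pl by (auto simp: plane_cliques_def)

text \<open>Two adjacent lines lie in exactly one plane clique, so the plane cliques through
  \<open>v\<close>, with \<open>v\<close> removed, partition its \<open>(m + 1) * (n - 1)\<close>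
  neighbours into blocks of size \<open>m\<^sup>2 - 1\<close>.\<close>

lemma plane_cliques_through:
  assumes v: "v \<in> Od"
  shows "real (card {C \<in> plane_cliques R D. v \<in> C}) = (real n - 1) / (real m - 1)"
proof -
  let ?F = "{C \<in> plane_cliques R D. v \<in> C}"
  have eq: "{k. adj v k} = (\<Union>C\<in>?F. C - {v})"
  proof (intro equalityI subsetI)
    fix k assume "k \<in> {k. adj v k}"
    then have k: "adj v k" by simp
    obtain C where "C \<in> plane_cliques R D" "v \<in> C" "k \<in> C" using unique_plane_clique[OF k] by blast
    moreover have "k \<noteq> v" using k by (auto simp: adj_def)
    ultimately show "k \<in> (\<Union>C\<in>?F. C - {v})" by blast
  next
    fix k assume "k \<in> (\<Union>C\<in>?F. C - {v})"
    then show "k \<in> {k. adj v k}" using plane_cliques_adj by blast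
  qed
  have fC: "finite C" if "C \<in> ?F" for C
    using that plane_cliques_Pow finite_subset[OF _ finite_Od] by blast
  have "card {k. adj v k} = (\<Sum>C\<in>?F. card (C - {v}))"
    unfolding eq
  proof (intro card_UN_disjoint ballI impI)
    show "finite ?F" using finite_plane_cliques by simp
    show "finite (C - {v})" if "C \<in> ?F" for C using fC[OF that] by simp
    show "(C - {v}) \<inter> (C' - {v}) = {}" if C: "C \<in> ?F" "C' \<in> ?F" "C \<noteq> C'" for C C'
    proof (rule equals0I)
      fix k assume "k \<in> (C - {v}) \<inter> (C' - {v})"
      then have "k \<in> C" "k \<in> C'" "k \<noteq> v" by auto
      then show False
        using unique_plane_clique[OF plane_cliques_adj[of C v k]] C by blast
    qed
  qed
  also have "\<dots> = (\<Sum>C\<in>?F. m\<^sup>2 - 1)"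
    using plane_cliques_card fC by (intro sum.cong) auto
  finally have "(m + 1) * (n - 1) = card ?F * (m\<^sup>2 - 1)" using adj_degree[OF v] by simp
  then have "real ((m + 1) * (n - 1)) = real (card ?F * (m\<^sup>2 - 1))" by simp
  moreover have "real (n - 1) = real n - 1" using n_ge_2 by (simp add: of_nat_diff)
  moreover have "real (m\<^sup>2 - 1) = (real m + 1) * (real m - 1)"
    using m_square_ge by (simp add: of_nat_diff algebra_simps power2_eq_square)
  ultimately have "(real m + 1) * (real n - 1) = (real m + 1) * (real (card ?F) * (real m - 1))"
    by (simp only: of_nat_mult of_nat_add of_nat_1) (simp add: algebra_simps)
  then have "real n - 1 = real (card ?F) * (real m - 1)"
    by (subst (asm) mult_cancel_left) auto
  then show ?thesis using m_ge_2 by (simp add: field_simps)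
qed

text \<open>Double counting of the pairs of an ordinary line and a plane clique containing
  it.\<close>

lemma card_plane_cliques:
  "real (card (plane_cliques R D)) = (real n)\<^sup>2 * (real n - 1) / ((real m)\<^sup>2 * (real m - 1))"
proof -
  let ?F = "plane_cliques R D"
  have "(\<Sum>C\<in>?F. card {v \<in> Od. v \<in> C}) = (\<Sum>v\<in>Od. card {C \<in> ?F. v \<in> C})"
    by (rule sum_multicount_gen[OF finite_plane_cliques finite_Od]) simp
  moreover have "card {v \<in> Od. v \<in> C} = m\<^sup>2" if "C \<in> ?F" for C
  proof -
    have "{v \<in> Od. v \<in> C} = C" using that plane_cliques_Pow by blast
    then show ?thesis using plane_cliques_card[OF that] by simp
  qed
  ultimately have "card ?F * m\<^sup>2 = (\<Sum>v\<in>Od. card {C \<in> ?F. v \<in> C})" by simp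
  then have "real (card ?F * m\<^sup>2) = (\<Sum>v\<in>Od. real (card {C \<in> ?F. v \<in> C}))" by simp
  also have "\<dots> = (\<Sum>v\<in>Od. (real n - 1) / (real m - 1))"
    using plane_cliques_through by (intro sum.cong) auto
  finally have "real (card ?F) * (real m)\<^sup>2 = (real n)\<^sup>2 * ((real n - 1) / (real m - 1))"
    using card_Od by simp
  then show ?thesis using m_ge_2 by (simp add: field_simps)
qed

lemma plane_point_cliques_inter:
  assumes "C \<in> plane_cliques R D" "C' \<in> point_cliques R D"
  shows "C \<inter> C' = {} \<or> card (C \<inter> C') = m"
  using assms Pl_Th unfolding plane_cliques_def point_cliques_def by blast

lemma plane_point_cliques_disjoint: "plane_cliques R D \<inter> point_cliques R D = {}"
proof (rule equals0I)
  fix C assume "C \<in> plane_cliques R D \<inter> point_cliques R D"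
  then obtain S p where "S \<in> planes R" "p \<in> ordinary_points R D" "C = Pl S" "C = Th p"
    by (auto simp: plane_cliques_def point_cliques_def)
  then show False using Pl_not_subset_Th[of S p] by blast
qed

lemma point_cliques_card: "C \<in> point_cliques R D \<Longrightarrow> card C = n"
  using Th_card by (auto simp: point_cliques_def ordinary_points_iff)

text \<open>Every clique is inside a point clique, of size \<open>n\<close>, or a plane clique, of
  size \<open>m\<^sup>2\<close>, which \<open>square_le\<close> bounds by \<open>n\<close>.\<close>

lemma max_clique_G:
  assumes mn: "m < n"
  shows "Max (card ` {C. graph_clique G C}) = n"
proof (rule Max_eqI)
  have "{C. graph_clique G C} \<subseteq> Pow Od" by (auto simp: graph_clique_G)
  then show "finite (card ` {C. graph_clique G C})"
    using finite_subset[of "{C. graph_clique G C}" "Pow Od"] finite_Od by simp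
  fix y assume "y \<in> card ` {C. graph_clique G C}"
  then obtain C where C: "graph_clique G C" "y = card C" by blast
  show "y \<le> n"
    using clique_subset[OF C(1)]
  proof
    assume "\<exists>p\<in>ordinary_points R D. C \<subseteq> Th p"
    then obtain p where p: "p \<in> points R" "p \<noteq> D" "C \<subseteq> Th p" by (auto simp: ordinary_points_iff)
    then show ?thesis using card_mono[OF Th_card(1)[OF p(1,2)] p(3)] Th_card(2)[OF p(1,2)] C by simp
  next
    assume "\<exists>S\<in>planes R. C \<subseteq> Pl S"
    then obtain S where S: "S \<in> planes R" "C \<subseteq> Pl S" by blast
    have "finite (Pl S)" by (rule finite_subset[OF _ finite_Od]) (auto simp: Pl_iff)
    then have "card C \<le> m\<^sup>2" using card_mono[OF _ S(2)] card_Pl[OF S(1)] by simp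
    also have "\<dots> \<le> n" by (rule full_plane.square_le[OF plane_full_plane[OF S(1)] mn])
    finally show ?thesis using C by simp
  qed
next
  obtain l where l: "l \<in> Od" using ordinary_line_exists by blast
  obtain p where p: "on p l" using ordinary_third_point[OF l] by blast
  then have "card (Th p) = n" using Th_card[of p] ordinary_on[OF l p] by simp
  then show "n \<in> card ` {C. graph_clique G C}" using Th_clique by blast
qed

end

theorem theorem3p1:
  fixes R :: "('p, 'l) incidence" and D :: 'p and m n :: nat
    and G :: "('l, 'l \<times> 'l) pre_digraph"
  assumes "projective_rectangle R D"
    and "has_order R D m n"
    and G: "G = graph_of_lines R D"
  shows
    "\<comment> \<open>(a)\<close> (finite (verts G) \<and> card (verts G) = n\<^sup>2) \<and>
     \<comment> \<open>(b)\<close> (regular_graph G ((m + 1) * (n - 1))) \<and>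
     \<comment> \<open>(c)\<close> (strongly_regular G (n\<^sup>2) ((m + 1) * (n - 1)) (m * (m - 1) + n - 2) (m * (m + 1))) \<and>
     (m * (m - 1) + n - 2 = n + (m + 1) * (m - 2)) \<and>
     \<comment> \<open>(d)\<close> (\<forall>vs. distinct vs \<and> set vs = verts G \<longrightarrow>
       {x. eigenvalue (adjacency_matrix G vs) x}
         \<subseteq> {(real m + 1) * (real n - 1), real n - real m - 1, - (real m + 1)} \<and>
       eigenvalue_mult (adjacency_matrix G vs) ((real m + 1) * (real n - 1)) = 1 \<and>
       eigenvalue_mult (adjacency_matrix G vs) (real n - real m - 1) = (m + 1) * (n - 1) \<and>
       eigenvalue_mult (adjacency_matrix G vs) (- (real m + 1)) = (n - m) * (n - 1)) \<and>
     \<comment> \<open>(e)\<close> (\<not> trivial_rectangle R \<longrightarrow> graph_diameter G = 2) \<and>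
     (trivial_rectangle R \<longrightarrow> complete_digraph (card (verts G)) G) \<and>
     \<comment> \<open>(f)\<close> (\<not> trivial_rectangle R \<longrightarrow>
       maximal_cliques G = plane_cliques R D \<union> point_cliques R D \<and>
       (\<forall>C \<in> plane_cliques R D. card C = m\<^sup>2) \<and>
       (\<forall>C \<in> point_cliques R D. card C = n) \<and>
       inj_on (plane_clique R D) (planes R) \<and>
       inj_on (point_clique R D) (ordinary_points R D) \<and>
       plane_cliques R D \<inter> point_cliques R D = {} \<and>
       real (card (plane_cliques R D))
         = (real n)\<^sup>2 * (real n - 1) / ((real m)\<^sup>2 * (real m - 1)) \<and>
       card (point_cliques R D) = (m + 1) * n \<and>
       Max (card ` {C. graph_clique G C}) = n \<and>
       (\<forall>v \<in> verts G.
          real (card {C \<in> plane_cliques R D. v \<in> C}) = (real n - 1) / (real m - 1) \<and>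
          card {C \<in> point_cliques R D. v \<in> C} = m + 1) \<and>
       (\<forall>u \<in> verts G. \<forall>v \<in> verts G. dominates G u v \<longrightarrow>
          (\<exists>!C. C \<in> plane_cliques R D \<and> u \<in> C \<and> v \<in> C) \<and>
          (\<exists>!C. C \<in> point_cliques R D \<and> u \<in> C \<and> v \<in> C)) \<and>
       (\<forall>C \<in> plane_cliques R D. \<forall>C' \<in> plane_cliques R D. C \<noteq> C' \<longrightarrow> card (C \<inter> C') \<le> 1) \<and>
       (\<forall>C \<in> point_cliques R D. \<forall>C' \<in> point_cliques R D. C \<noteq> C' \<longrightarrow> card (C \<inter> C') \<le> 1) \<and>
       (\<forall>C \<in> plane_cliques R D. \<forall>C' \<in> point_cliques R D.
          C \<inter> C' = {} \<or> card (C \<inter> C') = m)) \<and>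
     \<comment> \<open>(g)\<close> (vertex_connectivity G = (m + 1) * (n - 1))"
proof -
  interpret projective_rectangle_order R D m n
    using assms(1,2) by (simp add: projective_rectangle_order_def projective_rectangle_order_axioms_def)
  have mn: "m < n" if "\<not> trivial_rectangle R"
    using nontrivial_nonadjacent[OF that] m_less_n by blast
  have f: "maximal_cliques G = plane_cliques R D \<union> point_cliques R D \<and>
    Max (card ` {C. graph_clique G C}) = n" if "\<not> trivial_rectangle R"
    using maximal_cliques_G[OF mn] max_clique_G[OF mn] that unfolding G by blast
  show ?thesis
    apply (intro conjI impI allI ballI)
    subgoal using finite_Od by (simp add: G G_simps)
    subgoal using card_Od by (simp add: G G_simps)
    subgoal unfolding G by (rule regular_G)
    subgoal unfolding G by (rule strongly_regular_G)
    subgoal by (rule lambda_identity)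
    subgoal unfolding G G_simps(1) by (rule spectrum_G(1)) auto
    subgoal unfolding G G_simps(1) by (rule spectrum_G(2)) auto
    subgoal unfolding G G_simps(1) by (rule spectrum_G(3)) auto
    subgoal unfolding G G_simps(1) by (rule spectrum_G(4)) auto
    subgoal unfolding G by (rule diameter_G)
    subgoal unfolding G by (rule complete_G)
    subgoal using f by blast
    subgoal by (rule plane_cliques_card)
    subgoal by (rule point_cliques_card)
    subgoal by (rule inj_Pl)
    subgoal by (rule inj_Th)
    subgoal by (rule plane_point_cliques_disjoint)
    subgoal by (rule card_plane_cliques)
    subgoal by (rule card_point_cliques)
    subgoal using f by blast
    subgoal unfolding G G_simps(1) by (rule plane_cliques_through)
    subgoal unfolding G G_simps(1) by (rule point_cliques_through)
    subgoal unfolding G dominates_G by (rule unique_plane_clique)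
    subgoal unfolding G dominates_G by (rule unique_point_clique)
    subgoal by (rule plane_cliques_inter)
    subgoal by (rule point_cliques_inter)
    subgoal by (rule plane_point_cliques_inter)
    subgoal unfolding G by (rule connectivity_G)
    done
qed

end
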